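(* Let $\mathfrak{g}$ be a finite-dimensional real solvable Lie algebra whose nilradical $\mathfrak{n}$ is abelian. Then $\mathfrak{g}$ admits an inner product of negative Ricci curvature if and only if there exists $Y\in\mathfrak{g}$ such that all the (complex) eigenvalues of the restriction of $\operatorname{ad}_Y$ to $\mathfrak{n}$ have positive real part.
   Context: The nilradical of $\mathfrak{g}$ is its maximal nilpotent ideal. Ricci curvature: given an inner product $\langle\cdot,\cdot\rangle$ on a finite-dimensional real Lie algebra $\mathfrak{g}$, let $B$ be the Killing form of $\mathfrak{g}$, let $H\in\mathfrak{g}$ be defined by $\langle H,X\rangle=\operatorname{Tr}\operatorname{ad}_X$ for all $X\in\mathfrak g$, and let $\{E_i\}$ be any orthonormal basis of $(\mathfrak{g},\langle\cdot,\cdot\rangle)$. The Ricci curvature of the metric Lie algebra $(\mathfrak{g},\langle\cdot,\cdot\rangle)$ is the quadratic form $$\mathrm{ric}(X)=-\langle[H,X],X\rangle-\tfrac12 B(X,X)-\tfrac12\sum_i\|[X,E_i]\|^2+\tfrac14\sum_{i,j}\langle[E_i,E_j],X\rangle^2 ,\quad X\in\mathfrak g$$ (this is the Ricci curvature at the identity of the corresponding left-invariant metric on a Lie group with Lie algebra $\mathfrak{g}$). The inner product $\langle\cdot,\cdot\rangle$ is said to be of negative Ricci curvature if $\mathrm{ric}(X)<0$ for all $X\ne0$. *)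

theory Defs
  imports "HOL-Analysis.Analysis"
begin

section \<open>Finite-dimensional real Lie algebras\<close>

text \<open>
  The underlying vector space is the whole type, of class \<open>real_vector\<close>; no inner product
  or norm on it is fixed in advance, and the zero Lie algebra is not excluded.
\<close>

definition finite_dim_lie_algebra :: "('a::real_vector \<Rightarrow> 'a \<Rightarrow> 'a) \<Rightarrow> bool" where
  "finite_dim_lie_algebra br \<longleftrightarrow>
     (\<exists>B::'a set. finite B \<and> span B = UNIV) \<and>
     bilinear br \<and>
     (\<forall>x. br x x = 0) \<and>
     (\<forall>x y z. br x (br y z) + br y (br z x) + br z (br x y) = 0)"

definition lie_product :: "('a::real_vector \<Rightarrow> 'a \<Rightarrow> 'a) \<Rightarrow> 'a set \<Rightarrow> 'a set \<Rightarrow> 'a set" where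
  "lie_product br U V = span {br u v | u v. u \<in> U \<and> v \<in> V}"

fun lie_derived_series :: "('a::real_vector \<Rightarrow> 'a \<Rightarrow> 'a) \<Rightarrow> nat \<Rightarrow> 'a set" where
  "lie_derived_series br 0 = UNIV"
| "lie_derived_series br (Suc k) =
     lie_product br (lie_derived_series br k) (lie_derived_series br k)"

definition lie_solvable :: "('a::real_vector \<Rightarrow> 'a \<Rightarrow> 'a) \<Rightarrow> bool" where
  "lie_solvable br \<longleftrightarrow> (\<exists>k. lie_derived_series br k = {0})"

fun lie_lower_central :: "('a::real_vector \<Rightarrow> 'a \<Rightarrow> 'a) \<Rightarrow> 'a set \<Rightarrow> nat \<Rightarrow> 'a set" where
  "lie_lower_central br N 0 = N"
| "lie_lower_central br N (Suc k) = lie_product br N (lie_lower_central br N k)"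

definition lie_nilpotent_on :: "('a::real_vector \<Rightarrow> 'a \<Rightarrow> 'a) \<Rightarrow> 'a set \<Rightarrow> bool" where
  "lie_nilpotent_on br N \<longleftrightarrow> (\<exists>k. lie_lower_central br N k = {0})"

definition lie_abelian_on :: "('a::real_vector \<Rightarrow> 'a \<Rightarrow> 'a) \<Rightarrow> 'a set \<Rightarrow> bool" where
  "lie_abelian_on br N \<longleftrightarrow> (\<forall>x\<in>N. \<forall>y\<in>N. br x y = 0)"

definition lie_ideal :: "('a::real_vector \<Rightarrow> 'a \<Rightarrow> 'a) \<Rightarrow> 'a set \<Rightarrow> bool" where
  "lie_ideal br N \<longleftrightarrow> subspace N \<and> (\<forall>x. \<forall>y\<in>N. br x y \<in> N)"

definition lie_nilradical :: "('a::real_vector \<Rightarrow> 'a \<Rightarrow> 'a) \<Rightarrow> 'a set \<Rightarrow> bool" where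
  "lie_nilradical br N \<longleftrightarrow>
     lie_ideal br N \<and> lie_nilpotent_on br N \<and>
     (\<forall>M. lie_ideal br M \<and> lie_nilpotent_on br M \<and> N \<subseteq> M \<longrightarrow> M = N)"


section \<open>Trace and Killing form\<close>

definition lin_basis :: "'a::real_vector set \<Rightarrow> bool" where
  "lin_basis B \<longleftrightarrow> finite B \<and> independent B \<and> span B = UNIV"

definition lin_trace :: "('a::real_vector \<Rightarrow> 'a) \<Rightarrow> real" where
  "lin_trace T = (let B = (SOME B. lin_basis B) in \<Sum>b\<in>B. representation B (T b) b)"

lemma lin_trace_eq:
  fixes T :: "'a::real_vector \<Rightarrow> 'a"
  assumes T: "linear T" and B: "lin_basis B"
  shows "lin_trace T = (\<Sum>b\<in>B. representation B (T b) b)"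
proof -
  define C :: "'a set" where "C = (SOME C. lin_basis C)"
  have C: "lin_basis C"
    unfolding C_def using B by (rule someI)
  have fin: "finite B" "finite C" and ind: "independent B" "independent C"
    and sp: "span B = UNIV" "span C = UNIV"
    using B C by (auto simp: lin_basis_def)
  have exB: "(\<Sum>b\<in>B. representation B v b *\<^sub>R b) = v" for v
    by (rule real_vector.sum_representation_eq) (use fin ind sp in auto)
  have exC: "(\<Sum>c\<in>C. representation C v c *\<^sub>R c) = v" for v
    by (rule real_vector.sum_representation_eq) (use fin ind sp in auto)
  have lin: "representation D (\<Sum>x\<in>A. f x *\<^sub>R g x) d = (\<Sum>x\<in>A. f x * representation D (g x) d)"
    if "D = B \<or> D = C" for D A d f and g :: "'a \<Rightarrow> 'a"
    using that ind sp
    by (subst real_vector.representation_sum) (auto simp: real_vector.representation_scale)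
  have TB: "T b = (\<Sum>c\<in>C. representation C b c *\<^sub>R T c)" for b
  proof -
    have "T b = T (\<Sum>c\<in>C. representation C b c *\<^sub>R c)"
      by (simp only: exC)
    also have "\<dots> = (\<Sum>c\<in>C. representation C b c *\<^sub>R T c)"
      using T by (simp add: linear_sum linear_scale)
    finally show ?thesis .
  qed
  have "(\<Sum>b\<in>B. representation B (T b) b)
      = (\<Sum>b\<in>B. representation B (\<Sum>c\<in>C. representation C b c *\<^sub>R T c) b)"
    by (rule sum.cong[OF refl]) (simp only: TB[symmetric])
  also have "\<dots> = (\<Sum>b\<in>B. \<Sum>c\<in>C. representation C b c * representation B (T c) b)"
    by (rule sum.cong[OF refl]) (rule lin, simp)
  also have "\<dots> = (\<Sum>c\<in>C. \<Sum>b\<in>B. representation B (T c) b * representation C b c)"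
    by (subst sum.swap) (simp add: mult.commute)
  also have "\<dots> = (\<Sum>c\<in>C. representation C (\<Sum>b\<in>B. representation B (T c) b *\<^sub>R b) c)"
    by (rule sum.cong[OF refl]) (rule lin[symmetric], simp)
  also have "\<dots> = (\<Sum>c\<in>C. representation C (T c) c)"
    by (simp only: exB)
  finally show ?thesis
    by (simp add: lin_trace_def C_def Let_def)
qed

definition killing_form :: "('a::real_vector \<Rightarrow> 'a \<Rightarrow> 'a) \<Rightarrow> 'a \<Rightarrow> 'a \<Rightarrow> real" where
  "killing_form br X Y = lin_trace (br X \<circ> br Y)"


section \<open>Inner products and Ricci curvature\<close>

definition is_inner_product :: "('a::real_vector \<Rightarrow> 'a \<Rightarrow> real) \<Rightarrow> bool" where
  "is_inner_product ip \<longleftrightarrow>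
     bilinear ip \<and> (\<forall>x y. ip x y = ip y x) \<and> (\<forall>x. x \<noteq> 0 \<longrightarrow> ip x x > 0)"

definition orthonormal_basis :: "('a::real_vector \<Rightarrow> 'a \<Rightarrow> real) \<Rightarrow> 'a set \<Rightarrow> bool" where
  "orthonormal_basis ip E \<longleftrightarrow>
     lin_basis E \<and> (\<forall>u\<in>E. \<forall>v\<in>E. ip u v = (if u = v then 1 else 0))"

definition mean_curvature_vector ::
    "('a::real_vector \<Rightarrow> 'a \<Rightarrow> 'a) \<Rightarrow> ('a \<Rightarrow> 'a \<Rightarrow> real) \<Rightarrow> 'a" where
  "mean_curvature_vector br ip = (THE H. \<forall>X. ip H X = lin_trace (br X))"

definition ricci_wrt ::
    "('a::real_vector \<Rightarrow> 'a \<Rightarrow> 'a) \<Rightarrow> ('a \<Rightarrow> 'a \<Rightarrow> real) \<Rightarrow> 'a set \<Rightarrow> 'a \<Rightarrow> real" where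
  "ricci_wrt br ip E X =
     - ip (br (mean_curvature_vector br ip) X) X
     - 1/2 * killing_form br X X
     - 1/2 * (\<Sum>e\<in>E. ip (br X e) (br X e))
     + 1/4 * (\<Sum>e\<in>E. \<Sum>f\<in>E. (ip (br e f) X)\<^sup>2)"

text \<open>The value does not depend on the orthonormal basis; see \<open>ricci_eq\<close> below.\<close>

definition ricci ::
    "('a::real_vector \<Rightarrow> 'a \<Rightarrow> 'a) \<Rightarrow> ('a \<Rightarrow> 'a \<Rightarrow> real) \<Rightarrow> 'a \<Rightarrow> real" where
  "ricci br ip X = ricci_wrt br ip (SOME E. orthonormal_basis ip E) X"

definition negative_ricci ::
    "('a::real_vector \<Rightarrow> 'a \<Rightarrow> 'a) \<Rightarrow> ('a \<Rightarrow> 'a \<Rightarrow> real) \<Rightarrow> bool" where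
  "negative_ricci br ip \<longleftrightarrow> (\<forall>X. X \<noteq> 0 \<longrightarrow> ricci br ip X < 0)"

lemma orthonormal_expand:
  assumes ip: "is_inner_product ip" and E: "orthonormal_basis ip E"
  shows "(\<Sum>e\<in>E. ip e v *\<^sub>R e) = v"
proof -
  have fin: "finite E" and ind: "independent E" and sp: "span E = UNIV"
    and on: "\<And>u v. u \<in> E \<Longrightarrow> v \<in> E \<Longrightarrow> ip u v = (if u = v then 1 else 0)"
    using E by (auto simp: orthonormal_basis_def lin_basis_def)
  have ex: "(\<Sum>b\<in>E. representation E v b *\<^sub>R b) = v"
    by (rule real_vector.sum_representation_eq) (use fin ind sp in auto)
  have "ip e v = representation E v e" if "e \<in> E" for e
  proof -
    have l: "linear (ip e)"
      using ip by (auto simp: is_inner_product_def bilinear_def)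
    have "ip e v = ip e (\<Sum>b\<in>E. representation E v b *\<^sub>R b)"
      by (simp only: ex)
    also have "\<dots> = (\<Sum>b\<in>E. representation E v b * ip e b)"
      using l by (simp add: linear_sum linear_scale)
    also have "\<dots> = (\<Sum>b\<in>E. if b = e then representation E v b else 0)"
      by (rule sum.cong) (use on that in auto)
    finally show ?thesis
      using fin that by simp
  qed
  then show ?thesis
    using ex by (simp cong: sum.cong)
qed

lemma orthonormal_sum_eq:
  assumes ip: "is_inner_product ip" and E: "orthonormal_basis ip E" and F: "orthonormal_basis ip F"
    and b: "bilinear (b :: 'a::real_vector \<Rightarrow> 'a \<Rightarrow> real)"
  shows "(\<Sum>e\<in>E. b e e) = (\<Sum>f\<in>F. b f f)"
proof -
  have lr: "\<And>x. linear (b x)" and ll: "\<And>y. linear (\<lambda>x. b x y)"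
    using b by (auto simp: bilinear_def)
  have sym: "ip x y = ip y x" for x y
    using ip by (simp add: is_inner_product_def)
  have "(\<Sum>e\<in>E. b e e) = (\<Sum>e\<in>E. b e (\<Sum>f\<in>F. ip f e *\<^sub>R f))"
    by (simp only: orthonormal_expand[OF ip F])
  also have "\<dots> = (\<Sum>e\<in>E. \<Sum>f\<in>F. ip f e * b e f)"
    by (simp add: linear_sum[OF lr] linear_scale[OF lr])
  also have "\<dots> = (\<Sum>f\<in>F. \<Sum>e\<in>E. ip e f * b e f)"
    by (subst sum.swap) (simp add: sym)
  also have "\<dots> = (\<Sum>f\<in>F. b (\<Sum>e\<in>E. ip e f *\<^sub>R e) f)"
    by (simp add: linear_sum[OF ll] linear_scale[OF ll])
  also have "\<dots> = (\<Sum>f\<in>F. b f f)"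
    by (simp only: orthonormal_expand[OF ip E])
  finally show ?thesis .
qed

lemma ricci_eq:
  assumes br: "bilinear br" and ip: "is_inner_product ip" and E: "orthonormal_basis ip E"
  shows "ricci br ip X = ricci_wrt br ip E X"
proof -
  define F where "F = (SOME F. orthonormal_basis ip F)"
  have F: "orthonormal_basis ip F"
    unfolding F_def using E by (rule someI)
  have bip: "bilinear ip"
    using ip by (simp add: is_inner_product_def)
  note lb = bilinear_ladd[OF br] bilinear_radd[OF br] bilinear_lmul[OF br] bilinear_rmul[OF br]
  note li = bilinear_ladd[OF bip] bilinear_radd[OF bip] bilinear_lmul[OF bip] bilinear_rmul[OF bip]
  have 1: "(\<Sum>e\<in>E. ip (br X e) (br X e)) = (\<Sum>f\<in>F. ip (br X f) (br X f))"
    by (rule orthonormal_sum_eq[OF ip E F])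
      (simp add: bilinear_def linear_iff lb li)
  have 2: "(\<Sum>e\<in>E. (ip (br u e) X)\<^sup>2) = (\<Sum>f\<in>F. (ip (br u f) X)\<^sup>2)" for u
    unfolding power2_eq_square
    by (rule orthonormal_sum_eq[OF ip E F])
      (simp add: bilinear_def linear_iff lb li algebra_simps)
  have 3: "(\<Sum>e\<in>E. (ip (br e v) X)\<^sup>2) = (\<Sum>f\<in>F. (ip (br f v) X)\<^sup>2)" for v
    unfolding power2_eq_square
    by (rule orthonormal_sum_eq[OF ip E F])
      (simp add: bilinear_def linear_iff lb li algebra_simps)
  have "(\<Sum>e\<in>E. \<Sum>f\<in>E. (ip (br e f) X)\<^sup>2) = (\<Sum>e\<in>E. \<Sum>f\<in>F. (ip (br e f) X)\<^sup>2)"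
    by (simp only: 2)
  also have "\<dots> = (\<Sum>f\<in>F. \<Sum>e\<in>E. (ip (br e f) X)\<^sup>2)"
    by (rule sum.swap)
  also have "\<dots> = (\<Sum>f\<in>F. \<Sum>e\<in>F. (ip (br e f) X)\<^sup>2)"
    by (simp only: 3)
  also have "\<dots> = (\<Sum>e\<in>F. \<Sum>f\<in>F. (ip (br e f) X)\<^sup>2)"
    by (rule sum.swap)
  finally show ?thesis
    by (simp add: ricci_def F_def[symmetric] ricci_wrt_def 1)
qed


section \<open>Complex eigenvalues\<close>

text \<open>
  The complexification of a real vector space consists of the pairs \<open>(x, y)\<close>, standing for
  \<open>x + \<i> y\<close>, and a linear map \<open>T\<close> extends to it as \<open>map_prod T T\<close>.
\<close>

definition complexified_scale :: "complex \<Rightarrow> 'a::real_vector \<times> 'a \<Rightarrow> 'a \<times> 'a" where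
  "complexified_scale c v =
     (Re c *\<^sub>R fst v - Im c *\<^sub>R snd v, Im c *\<^sub>R fst v + Re c *\<^sub>R snd v)"

definition complex_eigenvalue_on :: "'a::real_vector set \<Rightarrow> ('a \<Rightarrow> 'a) \<Rightarrow> complex \<Rightarrow> bool" where
  "complex_eigenvalue_on W T c \<longleftrightarrow>
     (\<exists>v \<in> W \<times> W. v \<noteq> 0 \<and> map_prod T T v = complexified_scale c v)"

end

theory Submission
  imports Defs "HOL-Computational_Algebra.Fundamental_Theorem_Algebra"
begin

text \<open>
  Write \<open>A\<^sub>Z\<close> for the restriction of \<open>ad\<^sub>Z\<close> to the abelian nilradical \<open>N\<close>. Two facts of structure
  theory govern everything: the derived algebra lies in \<open>N\<close>
  (\<open>derived_in_abelian_nilradical\<close>), so the operators \<open>A\<^sub>Z\<close> commute and depend only on \<open>Z\<close> modulo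
  \<open>N\<close>; and \<open>A\<^sub>Z\<close> is nilpotent only for \<open>Z\<close> in \<open>N\<close> (\<open>nilpotent_action_in_nilradical\<close>). The first
  one is a case of Lie's theorem, proved here from scratch; its core is the chain argument
  \<open>commutator_kills_weight_vector\<close>.

  Given an inner product, choose an orthonormal basis \<open>f\<^sub>k\<close> of the orthogonal complement of \<open>N\<close>
  and let \<open>A\<^sub>k\<close> belong to \<open>f\<^sub>k\<close>. On \<open>U\<close> in \<open>N\<close> the Ricci form is
  \<open>- \<langle>A\<^sub>H U, U\<rangle> + 1/2 \<Sum>\<^sub>k (\<bar>A\<^sub>k\<^sup>* U\<bar>\<^sup>2 - \<bar>A\<^sub>k U\<bar>\<^sup>2) + 1/4 \<Sum>\<^sub>k\<^sub>l \<langle>[f\<^sub>k, f\<^sub>l], U\<rangle>\<^sup>2\<close>.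

  Necessity: \<open>Y = H\<close> works. An eigenvalue \<open>c\<close> of \<open>A\<^sub>H\<close> has an eigenvector \<open>x + \<i> y\<close> that is common
  to all \<open>A\<^sub>k\<close>, and on a common eigenvector the adjoint is at least as long as the operator itself
  (\<open>eigenvector_adjoint_inequality\<close>). Hence \<open>ric(x) + ric(y) \<ge> - Re c (\<bar>x\<bar>\<^sup>2 + \<bar>y\<bar>\<^sup>2)\<close>, and
  negativity forces \<open>Re c > 0\<close>.

  Sufficiency: let \<open>\<tau>\<close> be the trace of \<open>ad\<^sub>Y\<close>. The main work is an inner product on \<open>N\<close> for which
  \<open>2 \<tau> \<langle>A\<^sub>Y x, x\<rangle> + \<bar>A\<^sub>Y x\<bar>\<^sup>2 - \<bar>A\<^sub>Y\<^sup>* x\<bar>\<^sup>2\<close> is positive definite and for which \<open>A\<^sub>Z\<close> is skew only if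
  it is nilpotent (\<open>adapted_inner_product\<close>). It exists because the commuting family is block
  triangular with blocks of size one or two; rescaling the blocks makes \<open>A\<^sub>Y\<close> nearly block
  diagonal. Now take \<open>Y\<close> as a unit vector orthogonal to \<open>N\<close> and to the remaining directions \<open>F\<close>,
  which are chosen with trace zero, so that \<open>H = \<tau> Y\<close>. Stretching the metric along \<open>F\<close> suppresses
  the operators \<open>A\<^sub>f\<close> and leaves half of the form above on \<open>N\<close>; on the complement the Ricci form is
  at most minus the squared norm of the symmetric part of \<open>A\<^sub>Z\<close>, which does not vanish by the choice of the
  inner product; and shrinking the metric on \<open>N\<close> suppresses the mixed terms. These three
  rescalings are instances of \<open>perturbed_form_positive\<close>.
\<close>

section \<open>Subspaces of a finite-dimensional real vector space\<close>

lemma subspace_has_finite_basis: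
  fixes V :: "'a::real_vector set"
  assumes B: "lin_basis (B::'a set)" and V: "subspace V"
  obtains S where "finite S" "independent S" "S \<subseteq> V" "span S = V"
proof -
  interpret finite_dimensional_vector_space "scaleR :: real \<Rightarrow> 'a \<Rightarrow> 'a" B
    rewrites "module.dependent (*\<^sub>R) = dependent"
      and "module.subspace (*\<^sub>R) = subspace"
      and "module.span (*\<^sub>R) = span"
      and "vector_space.dim (*\<^sub>R) = dim"
    using B by unfold_locales
      (auto simp: dependent_raw_def subspace_raw_def span_raw_def dim_raw_def lin_basis_def
        real_vector.dependent_def scaleR_add_right scaleR_add_left)
  show ?thesis
    using that basis_subspace_exists[OF V] by metis
qed

lemma dim_strict_subspace:
  fixes V W :: "'a::real_vector set"
  assumes B: "lin_basis (B::'a set)" and "subspace V" "subspace W" "W \<subset> V"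
  shows "dim W < dim V"
proof -
  interpret finite_dimensional_vector_space "scaleR :: real \<Rightarrow> 'a \<Rightarrow> 'a" B
    rewrites "module.dependent (*\<^sub>R) = dependent"
      and "module.subspace (*\<^sub>R) = subspace"
      and "module.span (*\<^sub>R) = span"
      and "vector_space.dim (*\<^sub>R) = dim"
    using B by unfold_locales
      (auto simp: dependent_raw_def subspace_raw_def span_raw_def dim_raw_def lin_basis_def
        real_vector.dependent_def scaleR_add_right scaleR_add_left)
  show ?thesis
    using assms by (metis dim_psubset span_eq_iff)
qed

lemma injective_on_subspace_surj:
  fixes W :: "'a::real_vector set" and T :: "'a \<Rightarrow> 'a"
  assumes B: "lin_basis (B::'a set)" and W: "subspace W" and T: "linear T"
    and TW: "T ` W \<subseteq> W" and inj: "\<And>w. w \<in> W \<Longrightarrow> T w = 0 \<Longrightarrow> w = 0"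
  shows "T ` W = W"
proof (rule ccontr)
  assume "T ` W \<noteq> W"
  then have less: "dim (T ` W) < dim W"
    using dim_strict_subspace[OF B W linear_subspace_image[OF T W]] TW by blast
  obtain S where S: "finite S" "independent S" "S \<subseteq> W" "span S = W"
    using subspace_has_finite_basis[OF B W] .
  have inj': "inj_on T W"
    unfolding real_vector.linear_inj_on_iff_eq_0[OF T W] using inj by blast
  have "independent (T ` S)"
    using linear_independent_injective_image T S inj'
    by (metis real_vector.linear_independent_injective_image)
  moreover have "card (T ` S) = card S"
    using inj' S by (meson card_image inj_on_subset)
  moreover have "span (T ` S) = T ` W"
    using S T by (simp add: linear_span_image)
  ultimately have "dim (T ` W) = dim W"
    using S by (metis dim_eq_card_independent dim_span)
  with less show False by simp
qed

lemma lin_basis_prod: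
  assumes B: "lin_basis (B::'a::real_vector set)"
  shows "\<exists>B' :: ('a \<times> 'a) set. lin_basis B'"
proof -
  let ?S = "(\<lambda>b. (b, 0)) ` B \<union> (\<lambda>b. (0, b)) ` B :: ('a \<times> 'a) set"
  have l1: "linear (\<lambda>b. (b, 0) :: 'a \<times> 'a)" and l2: "linear (\<lambda>b. (0, b) :: 'a \<times> 'a)"
    by (auto simp: linear_iff)
  have "(x, y) \<in> span ?S" for x y
  proof -
    have "(x, 0) \<in> (\<lambda>b. (b, 0)) ` span B" "(0, y) \<in> (\<lambda>b. (0, b)) ` span B"
      using B by (auto simp: lin_basis_def)
    moreover have "span ((\<lambda>b. (b, 0)) ` B) \<subseteq> span ?S" "span ((\<lambda>b. (0, b)) ` B) \<subseteq> span ?S"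
      by (intro span_mono; blast)+
    ultimately have "(x, 0) \<in> span ?S" "(0, y) \<in> span ?S"
      unfolding linear_span_image[OF l1] linear_span_image[OF l2] by blast+
    from span_add[OF this] show ?thesis by simp
  qed
  then have sp: "span ?S = UNIV" by auto
  obtain C where C: "C \<subseteq> ?S" "independent C" "?S \<subseteq> span C"
    using real_vector.maximal_independent_subset by blast
  have "finite C" using C B finite_subset by (fastforce simp: lin_basis_def)
  moreover have "span C = UNIV"
    using C sp by (metis span_mono span_span top.extremum_uniqueI)
  ultimately show ?thesis using C by (auto simp: lin_basis_def)
qed

lemma extend_to_lin_basis:
  fixes E :: "'a::real_vector set"
  assumes B: "lin_basis (B::'a set)" and E: "independent E" and V: "subspace V" "E \<subseteq> V"
  obtains F where "F \<inter> E = {}" "F \<subseteq> V" "finite F" "independent (E \<union> F)" "span (E \<union> F) = V" "finite E"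
proof -
  obtain G where G: "E \<subseteq> G" "G \<subseteq> V" "independent G" "V \<subseteq> span G"
    using real_vector.maximal_independent_subset_extend[OF V(2) E] by blast
  have "finite G"
    using real_vector.independent_span_bound[of B G] B G(3) by (auto simp: lin_basis_def)
  moreover have "span G = V" using G V by (metis span_minimal subset_antisym)
  ultimately show ?thesis
    using G that[of "G - E"] by (auto simp: Un_absorb1 finite_subset)
qed

text \<open>
  The image of such a projection stands for the quotient of \<open>V\<close> by \<open>W\<close>: an induction over quotients
  becomes one over subspaces of a fixed type.
\<close>
lemma complementary_projection:
  fixes V W :: "'a::real_vector set"
  assumes B: "lin_basis (B::'a set)" and V: "subspace V" and W: "subspace W" "W \<subseteq> V"
  obtains P where "linear P" "\<And>v. v \<in> V \<Longrightarrow> P v \<in> V" "\<And>w. w \<in> W \<Longrightarrow> P w = 0"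
    "\<And>v. v \<in> V \<Longrightarrow> v - P v \<in> W" "\<And>v. v \<in> V \<Longrightarrow> P (P v) = P v"
proof -
  obtain E where E: "finite E" "independent E" "E \<subseteq> W" "span E = W"
    using subspace_has_finite_basis[OF B W(1)] .
  obtain F where F: "F \<inter> E = {}" "F \<subseteq> V" "finite F" "independent (E \<union> F)" "span (E \<union> F) = V"
    using extend_to_lin_basis[OF B E(2) V] E W by (metis subset_trans)
  obtain P where P: "linear P" "\<And>x. x \<in> E \<union> F \<Longrightarrow> P x = (if x \<in> E then 0 else x)"
    using real_vector.linear_independent_extend[OF F(4), of "\<lambda>x. if x \<in> E then 0 else x"] by blast
  have PW: "P w = 0" if "w \<in> W" for w
    using linear_eq_0_on_span[OF P(1), of E w] P(2) E that by auto
  have sub: "subspace {v. P v \<in> V \<and> v - P v \<in> W}"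
    using V W P(1)
    by (auto simp: subspace_def linear_0 linear_add linear_cmul algebra_simps
        simp flip: scaleR_diff_right)
      (metis add_diff_add add.assoc add.commute add_diff_eq diff_add_eq)
  have "E \<union> F \<subseteq> {v. P v \<in> V \<and> v - P v \<in> W}"
    using P(2) F(1,2) E W V by (auto simp: subspace_0)
  from span_minimal[OF this sub] have *: "P v \<in> V" "v - P v \<in> W" if "v \<in> V" for v
    using that F(5) by auto
  have "P (P v) = P v" if "v \<in> V" for v
    using PW[OF *(2)[OF that]] P(1) by (simp add: linear_diff)
  then show ?thesis using that P(1) PW * by blast
qed

section \<open>Orthonormal frames of subspaces\<close>

text \<open>
  Positivity is left out on purpose: forms are defined on the whole space but are positive only on a
  subspace.
\<close>
definition symmetric_bilinear :: "('a::real_vector \<Rightarrow> 'a \<Rightarrow> real) \<Rightarrow> bool" where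
  "symmetric_bilinear Q \<longleftrightarrow> bilinear Q \<and> (\<forall>x y. Q x y = Q y x)"

definition on_frame :: "('a::real_vector \<Rightarrow> 'a \<Rightarrow> real) \<Rightarrow> 'a set \<Rightarrow> 'a set \<Rightarrow> bool" where
  "on_frame Q V E \<longleftrightarrow> symmetric_bilinear Q \<and> finite E \<and> span E = V \<and>
     (\<forall>e\<in>E. \<forall>f\<in>E. Q e f = (if e = f then 1 else 0))"

lemmas bilinear_simps = bilinear_ladd bilinear_radd bilinear_lmul bilinear_rmul
  bilinear_lneg bilinear_rneg bilinear_lsub bilinear_rsub bilinear_lzero bilinear_rzero

lemma bilinear_sum_left: "bilinear Q \<Longrightarrow> Q (\<Sum>i\<in>A. f i) y = (\<Sum>i\<in>A. Q (f i) y)"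
  using linear_sum[of "\<lambda>x. Q x y" f A] by (simp add: bilinear_def)

lemma bilinear_sum_right: "bilinear Q \<Longrightarrow> Q y (\<Sum>i\<in>A. f i) = (\<Sum>i\<in>A. Q y (f i))"
  using linear_sum[of "\<lambda>x. Q y x" f A] by (simp add: bilinear_def)

lemma on_frame_expand:
  assumes E: "on_frame Q V E" and x: "x \<in> V"
  shows "(\<Sum>e\<in>E. Q e x *\<^sub>R e) = x"
proof -
  have bl: "bilinear Q" and fin: "finite E" and on: "\<And>e f. e \<in> E \<Longrightarrow> f \<in> E \<Longrightarrow> Q e f = (if e = f then 1 else 0)"
    using E by (auto simp: on_frame_def symmetric_bilinear_def)
  have "x \<in> span E" using E x by (simp add: on_frame_def)
  then obtain u where u: "x = (\<Sum>e\<in>E. u e *\<^sub>R e)"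
    using fin by (auto simp: span_finite)
  have "Q e x = u e" if "e \<in> E" for e
  proof -
    have "Q e x = (\<Sum>f\<in>E. u f * Q e f)"
      by (simp add: u bilinear_sum_right[OF bl] bilinear_rmul[OF bl])
    also have "\<dots> = (\<Sum>f\<in>E. if f = e then u f else 0)"
      by (rule sum.cong) (use on that in auto)
    finally show ?thesis using fin that by simp
  qed
  then show ?thesis by (simp add: u cong: sum.cong)
qed

lemma on_frame_inner:
  assumes E: "on_frame Q V E" and b: "bilinear Q'" and x: "x \<in> V"
  shows "(\<Sum>e\<in>E. Q' y e * Q e x) = Q' y x"
proof -
  have "Q' y x = Q' y (\<Sum>e\<in>E. Q e x *\<^sub>R e)" by (simp add: on_frame_expand[OF E x])
  then show ?thesis by (simp add: bilinear_sum_right[OF b] bilinear_rmul[OF b] mult.commute)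
qed

lemma on_frame_bilinear: "on_frame Q V E \<Longrightarrow> bilinear Q"
  and on_frame_sym: "on_frame Q V E \<Longrightarrow> Q x y = Q y x"
  and on_frame_finite: "on_frame Q V E \<Longrightarrow> finite E"
  and on_frame_span: "on_frame Q V E \<Longrightarrow> span E = V"
  and on_frame_mem: "on_frame Q V E \<Longrightarrow> e \<in> E \<Longrightarrow> e \<in> V"
  and on_frame_orth: "on_frame Q V E \<Longrightarrow> e \<in> E \<Longrightarrow> f \<in> E \<Longrightarrow> Q e f = (if e = f then 1 else 0)"
  and on_frame_subspace: "on_frame Q V E \<Longrightarrow> subspace V"
  by (auto simp: on_frame_def symmetric_bilinear_def intro: span_base)

lemma on_frame_norm:
  assumes E: "on_frame Q V E" and x: "x \<in> V"
  shows "Q x x = (\<Sum>e\<in>E. (Q e x)\<^sup>2)"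
  using on_frame_inner[OF E on_frame_bilinear[OF E] x, of x] on_frame_sym[OF E]
  by (simp add: power2_eq_square)

lemma on_frame_nonneg: "on_frame Q V E \<Longrightarrow> x \<in> V \<Longrightarrow> 0 \<le> Q x x"
  by (simp add: on_frame_norm sum_nonneg)

lemma on_frame_coordinate_le:
  assumes E: "on_frame Q V E" and x: "x \<in> V" and e: "e \<in> E"
  shows "\<bar>Q e x\<bar> \<le> sqrt (Q x x)"
proof -
  have "(Q e x)\<^sup>2 \<le> (\<Sum>e\<in>E. (Q e x)\<^sup>2)"
    using on_frame_finite[OF E] e by (intro member_le_sum) auto
  then show ?thesis by (metis on_frame_norm[OF E x] real_sqrt_abs real_sqrt_le_iff)
qed

lemma on_frame_independent:
  assumes E: "on_frame Q V E" shows "independent E"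
proof -
  have bl: "bilinear Q" using E by (rule on_frame_bilinear)
  have "u e = 0" if "(\<Sum>f\<in>E. u f *\<^sub>R f) = 0" "e \<in> E" for u e
  proof -
    have "0 = Q e (\<Sum>f\<in>E. u f *\<^sub>R f)" by (simp add: that bilinear_rzero[OF bl])
    also have "\<dots> = (\<Sum>f\<in>E. u f * Q e f)"
      by (simp add: bilinear_sum_right[OF bl] bilinear_rmul[OF bl])
    also have "\<dots> = (\<Sum>f\<in>E. if f = e then u f else 0)"
      by (rule sum.cong) (use on_frame_orth[OF E] that in auto)
    finally show ?thesis using that on_frame_finite[OF E] by simp
  qed
  then show ?thesis
    by (simp add: real_vector.independent_if_scalars_zero[OF on_frame_finite[OF E]])
qed

lemma on_frame_representation:
  assumes E: "on_frame Q V E" and x: "x \<in> V" and e: "e \<in> E"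
  shows "representation E x e = Q e x"
proof -
  have "representation E (\<Sum>e\<in>E. Q e x *\<^sub>R e) e = (\<Sum>f\<in>E. Q f x * representation E f e)"
    using on_frame_independent[OF E]
    by (subst real_vector.representation_sum)
      (auto intro!: sum.cong span_base span_scale
        simp: real_vector.representation_scale[OF _ span_base])
  also have "\<dots> = (\<Sum>f\<in>E. if f = e then Q f x else 0)"
    using on_frame_independent[OF E]
    by (intro sum.cong) (auto simp: real_vector.representation_basis)
  finally show ?thesis using e on_frame_finite[OF E] on_frame_expand[OF E x] by simp
qed

text \<open>Gram--Schmidt, started from a given frame.\<close>
lemma on_frame_extend:
  assumes sb: "symmetric_bilinear Q" and V: "subspace V"
    and pos: "\<And>x. x \<in> V \<Longrightarrow> x \<noteq> 0 \<Longrightarrow> 0 < Q x x"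
    and E: "on_frame Q U E" "U \<subseteq> V" and S: "finite S" "S \<subseteq> V"
  obtains F where "on_frame Q (span (U \<union> S)) F" "E \<subseteq> F"
proof -
  have "\<exists>F. on_frame Q (span (U \<union> S)) F \<and> E \<subseteq> F"
    using S
  proof (induction S rule: finite_induct)
    case empty
    then show ?case using E on_frame_span[OF E(1)] span_span by (metis Un_empty_right order_refl)
  next
    case (insert x S)
    then obtain F where F: "on_frame Q (span (U \<union> S)) F" and EF: "E \<subseteq> F" by auto
    have bl: "bilinear Q" by (rule on_frame_bilinear[OF F])
    let ?V = "span (U \<union> S)"
    define p where "p = (\<Sum>e\<in>F. Q e x *\<^sub>R e)"
    define y where "y = x - p"
    have spF: "span F = ?V" by (rule on_frame_span[OF F])
    have p: "p \<in> ?V"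
      unfolding p_def spF[symmetric] by (intro span_sum span_scale span_base)
    have VV: "?V \<subseteq> V" using V E insert.prems by (intro span_minimal) auto
    have orth: "Q e y = 0" if "e \<in> F" for e
    proof -
      have "Q e p = (\<Sum>f\<in>F. if f = e then Q f x else 0)"
        unfolding p_def bilinear_sum_right[OF bl] bilinear_rmul[OF bl]
        by (rule sum.cong) (use on_frame_orth[OF F] that in auto)
      then show ?thesis
        using that on_frame_finite[OF F] by (simp add: y_def bilinear_rsub[OF bl])
    qed
    have sp: "span (U \<union> insert x S) = span (insert y F)"
    proof -
      have "span (U \<union> insert x S) = span (insert x (U \<union> S))" by simp
      also have "\<dots> = span (insert x F)"
        using spF by (metis real_vector.span_insert)
      also have "\<dots> = span (insert y F)"
      proof -
        have "y \<in> span (insert x F)" 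
          unfolding y_def using p spF span_mono[of F "insert x F"]
          by (intro span_diff) (auto intro: span_base)
        moreover have "x \<in> span (insert y F)"
        proof -
          have "y + p \<in> span (insert y F)"
            using p spF span_mono[of F "insert y F"] by (intro span_add) (auto intro: span_base)
          then show ?thesis by (simp add: y_def)
        qed
        ultimately show ?thesis
          by (intro subset_antisym span_minimal) (auto intro: span_base)
      qed
      finally show ?thesis .
    qed
    show ?case
    proof (cases "y = 0")
      case True
      then have "span (U \<union> insert x S) = ?V" using sp spF by simp
      then show ?thesis using F EF by auto
    next
      case False
      have "y \<in> V" using insert.prems p VV V by (auto simp: y_def intro: subspace_diff)
      then have yy: "Q y y > 0" using pos False by auto
      define z where "z = (1 / sqrt (Q y y)) *\<^sub>R y"
      have zz: "Q z z = 1"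
        using yy by (simp add: z_def bilinear_rmul[OF bl] bilinear_lmul[OF bl])
      have zF: "Q e z = 0" "Q z e = 0" if "e \<in> F" for e
        using orth[OF that] on_frame_sym[OF F] by (auto simp: z_def bilinear_rmul[OF bl] bilinear_lmul[OF bl])
      have "span (insert z F) = span (insert y F)"
      proof (intro subset_antisym span_minimal)
        have "sqrt (Q y y) *\<^sub>R z \<in> span (insert z F)" by (intro span_scale span_base) simp
        then show "insert y F \<subseteq> span (insert z F)" using yy by (auto simp: z_def intro: span_base)
        show "insert z F \<subseteq> span (insert y F)"
          unfolding z_def using span_superset[of "insert y F"] by (simp add: span_scale span_base subset_iff)
      qed auto
      then have "on_frame Q (span (U \<union> insert x S)) (insert z F)"
        using F zz zF sp by (auto simp: on_frame_def)
      then show ?thesis using EF by blast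
    qed
  qed
  then show ?thesis using that by blast
qed

lemma on_frame_exists:
  fixes V :: "'a::real_vector set"
  assumes B: "lin_basis (B::'a set)" and sb: "symmetric_bilinear Q" and V: "subspace V"
    and pos: "\<And>x. x \<in> V \<Longrightarrow> x \<noteq> 0 \<Longrightarrow> 0 < Q x x"
  obtains E where "on_frame Q V E"
proof -
  obtain S where S: "finite S" "S \<subseteq> V" "span S = V" using subspace_has_finite_basis[OF B V] by metis
  have "on_frame Q {0} {}" using sb by (simp add: on_frame_def)
  from on_frame_extend[OF sb V pos this _ S(1,2)] obtain E where "on_frame Q (span ({0} \<union> S)) E"
    using V by (auto simp: subspace_0)
  then show ?thesis using that S by simp
qed

lemma on_frame_of_independent:
  fixes E :: "'a::real_vector set"
  assumes B: "lin_basis (B::'a set)" and E: "independent E"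
  obtains Q where "on_frame Q (span E) E"
proof -
  obtain F where "F \<inter> E = {}" "F \<subseteq> UNIV" and
    F: "finite F" "independent (E \<union> F)" "span (E \<union> F) = UNIV" "finite E"
    using extend_to_lin_basis[OF B E subspace_UNIV subset_UNIV] .
  let ?G = "E \<union> F"
  define Q where "Q x y = (\<Sum>g\<in>?G. representation ?G x g * representation ?G y g)" for x y
  have l: "representation ?G (x + y) g = representation ?G x g + representation ?G y g"
    "representation ?G (c *\<^sub>R x) g = c * representation ?G x g" for x y g c
    using F by (simp_all add: real_vector.representation_add real_vector.representation_scale)
  have "bilinear Q"
    by (simp add: bilinear_def linear_iff Q_def l algebra_simps sum.distrib sum_distrib_left)
  moreover have "Q x y = Q y x" for x y by (simp add: Q_def mult.commute)
  moreover have "Q e f = (if e = f then 1 else 0)" if "e \<in> E" "f \<in> E" for e f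
  proof -
    have "Q e f = (\<Sum>g\<in>?G. (if g = e then if g = f then 1 else 0 else 0))"
      unfolding Q_def using that by (intro sum.cong) (auto simp: real_vector.representation_basis[OF F(2)])
    then show ?thesis using that F by simp
  qed
  ultimately have "on_frame Q (span E) E" using F by (auto simp: on_frame_def symmetric_bilinear_def)
  then show ?thesis using that by blast
qed

lemma lin_trace_into:
  assumes B: "lin_basis (B::'a::real_vector set)" and E: "on_frame Q V E"
    and T: "linear T" "\<And>x. T x \<in> (V::'a set)"
  shows "lin_trace T = (\<Sum>e\<in>E. Q (T e) e)"
proof -
  have ind: "independent E" by (rule on_frame_independent[OF E])
  obtain F where F: "F \<inter> E = {}" "F \<subseteq> UNIV" "finite F" "independent (E \<union> F)" "span (E \<union> F) = UNIV" "finite E"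
    using extend_to_lin_basis[OF B ind subspace_UNIV subset_UNIV] .
  have rep: "representation (E \<union> F) (T x) = representation E (T x)" for x
    using F(4) T(2)[of x] on_frame_span[OF E] by (intro real_vector.representation_extend) auto
  have "lin_trace T = (\<Sum>b\<in>E \<union> F. representation (E \<union> F) (T b) b)"
    using F by (intro lin_trace_eq[OF T(1)]) (auto simp: lin_basis_def)
  also have "\<dots> = (\<Sum>b\<in>E. representation E (T b) b) + (\<Sum>b\<in>F. representation E (T b) b)"
    unfolding rep using F by (intro sum.union_disjoint) auto
  also have "(\<Sum>b\<in>F. representation E (T b) b) = 0"
    using F(1) real_vector.representation_ne_zero by (intro sum.neutral) blast
  also have "(\<Sum>b\<in>E. representation E (T b) b) = (\<Sum>e\<in>E. Q (T e) e)"
    by (intro sum.cong) (auto simp: on_frame_representation[OF E T(2)] on_frame_sym[OF E])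
  finally show ?thesis by simp
qed

text \<open>
  This replaces compactness in every passage to a limit of metrics. In orthonormal frames for \<open>f\<close> and \<open>g\<close>, the
  coordinates are bounded by the norms, so \<open>b\<close> is at most a multiple of the geometric mean of \<open>f\<close>
  and \<open>g\<close>, and \<open>h\<close> at most a multiple of \<open>f\<close>; for large \<open>s\<close> both are absorbed.
\<close>
lemma perturbed_form_positive:
  fixes f g h :: "'a::real_vector \<Rightarrow> 'a \<Rightarrow> real"
  assumes B: "lin_basis (B::'a set)" and W: "subspace W" and C: "subspace C"
    and f: "symmetric_bilinear f" "\<And>x. x \<in> W \<Longrightarrow> x \<noteq> 0 \<Longrightarrow> 0 < f x x"
    and g: "symmetric_bilinear g" "\<And>x. x \<in> C \<Longrightarrow> x \<noteq> 0 \<Longrightarrow> 0 < g x x"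
    and b: "bilinear b" and h: "bilinear h"
  shows "\<exists>s>0. \<forall>w\<in>W. \<forall>c\<in>C. w \<noteq> 0 \<or> c \<noteq> 0 \<longrightarrow> f w w + s * g c c + b w c - h w w / s > 0"
proof -
  obtain E where E: "on_frame f W E" using on_frame_exists[OF B f(1) W f(2)] .
  obtain F where F: "on_frame g C F" using on_frame_exists[OF B g(1) C g(2)] .
  define K where "K = (\<Sum>e\<in>E. \<Sum>c\<in>F. \<bar>b e c\<bar>)"
  define L where "L = (\<Sum>e\<in>E. \<Sum>e'\<in>E. \<bar>h e e'\<bar>)"
  have Kb: "\<bar>b w c\<bar> \<le> K * (sqrt (f w w) * sqrt (g c c))" if "w \<in> W" "c \<in> C" for w c
  proof -
    have "b w c = b (\<Sum>e\<in>E. f e w *\<^sub>R e) (\<Sum>e\<in>F. g e c *\<^sub>R e)"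
      by (simp add: on_frame_expand[OF E] on_frame_expand[OF F] that)
    also have "\<dots> = (\<Sum>e\<in>E. \<Sum>e'\<in>F. f e w * g e' c * b e e')"
      unfolding bilinear_sum_left[OF b] bilinear_sum_right[OF b] bilinear_lmul[OF b]
          bilinear_rmul[OF b] by (subst sum.swap) (simp add: sum_distrib_left ac_simps)
    also have "\<bar>\<dots>\<bar> \<le> (\<Sum>e\<in>E. \<Sum>e'\<in>F. \<bar>f e w * g e' c * b e e'\<bar>)"
      by (rule order_trans[OF sum_abs sum_mono]) (rule sum_abs)
    also have "\<dots> \<le> (\<Sum>e\<in>E. \<Sum>e'\<in>F. sqrt (f w w) * sqrt (g c c) * \<bar>b e e'\<bar>)"
      unfolding abs_mult
      by (intro sum_mono mult_mono on_frame_coordinate_le[OF E] on_frame_coordinate_le[OF F] that)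
        (auto simp: on_frame_nonneg[OF E] on_frame_nonneg[OF F] that)
    finally have "\<bar>b w c\<bar> \<le> sqrt (f w w) * sqrt (g c c) * K"
      by (simp only: K_def sum_distrib_left)
    then show ?thesis by (simp only: mult.commute)
  qed
  have Lb: "\<bar>h w w\<bar> \<le> L * f w w" if "w \<in> W" for w
  proof -
    have "h w w = h (\<Sum>e\<in>E. f e w *\<^sub>R e) (\<Sum>e\<in>E. f e w *\<^sub>R e)"
      by (simp add: on_frame_expand[OF E] that)
    also have "\<dots> = (\<Sum>e\<in>E. \<Sum>e'\<in>E. f e w * f e' w * h e e')"
      unfolding bilinear_sum_left[OF h] bilinear_sum_right[OF h] bilinear_lmul[OF h]
          bilinear_rmul[OF h] by (subst sum.swap) (simp add: sum_distrib_left ac_simps)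
    also have "\<bar>\<dots>\<bar> \<le> (\<Sum>e\<in>E. \<Sum>e'\<in>E. \<bar>f e w * f e' w * h e e'\<bar>)"
      by (rule order_trans[OF sum_abs sum_mono]) (rule sum_abs)
    also have "\<dots> \<le> (\<Sum>e\<in>E. \<Sum>e'\<in>E. sqrt (f w w) * sqrt (f w w) * \<bar>h e e'\<bar>)"
      unfolding abs_mult
      by (intro sum_mono mult_mono on_frame_coordinate_le[OF E] that)
        (auto simp: on_frame_nonneg[OF E] that)
    finally have "\<bar>h w w\<bar> \<le> sqrt (f w w) * sqrt (f w w) * L"
      by (simp only: L_def sum_distrib_left)
    then show ?thesis by (simp add: on_frame_nonneg[OF E that] mult.commute)
  qed
  have L0: "L \<ge> 0" by (simp add: L_def sum_nonneg)
  define s where "s = K\<^sup>2 + 4 * L + 1"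
  have s: "s > 0" using L0 by (simp add: s_def add_nonneg_pos)
  show ?thesis
  proof (intro exI conjI ballI impI)
    show "s > 0" by fact
    fix w c assume w: "w \<in> W" and c: "c \<in> C" and nz: "w \<noteq> 0 \<or> c \<noteq> 0"
    have fw: "f w w \<ge> 0" and gc: "g c c \<ge> 0"
      by (simp_all add: on_frame_nonneg[OF E w] on_frame_nonneg[OF F c])
    have 1: "- b w c \<le> f w w / 2 + K\<^sup>2 / 2 * g c c"
    proof -
      have "0 \<le> (sqrt (f w w) - K * sqrt (g c c))\<^sup>2" by simp
      also have "\<dots> = f w w + K\<^sup>2 * g c c - 2 * (K * (sqrt (f w w) * sqrt (g c c)))"
        using fw gc by (simp add: power2_diff power_mult_distrib)
      finally show ?thesis using Kb[OF w c] by linarith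
    qed
    have 2: "h w w / s \<le> f w w / 4"
    proof -
      have "h w w \<le> L * f w w" using Lb[OF w] by linarith
      also have "\<dots> \<le> s / 4 * f w w"
        using fw L0 by (intro mult_right_mono) (auto simp: s_def)
      finally show ?thesis using s by (simp add: field_simps)
    qed
    have 3: "s * g c c \<ge> K\<^sup>2 / 2 * g c c + g c c"
    proof -
      have "(K\<^sup>2 / 2 + 1) * g c c \<le> s * g c c"
        using L0 gc by (intro mult_right_mono) (auto simp: s_def)
      then show ?thesis by (simp add: algebra_simps)
    qed
    have "f w w > 0 \<or> g c c > 0" using nz f(2) g(2) w c by auto
    then show "f w w + s * g c c + b w c - h w w / s > 0"
      using 1 2 3 fw gc by linarith
  qed
qed

section \<open>Eigenvectors in the complexification\<close>

abbreviation cmap :: "('a \<Rightarrow> 'a) \<Rightarrow> 'a \<times> 'a \<Rightarrow> 'a \<times> 'a" where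
  "cmap T \<equiv> map_prod T T"

interpretation cx: vector_space "complexified_scale :: complex \<Rightarrow> 'a::real_vector \<times> 'a \<Rightarrow> 'a \<times> 'a"
  by unfold_locales
    (auto simp: complexified_scale_def algebra_simps)

lemma cmap_add: "linear T \<Longrightarrow> cmap T (x + y) = cmap T x + cmap T y"
  by (cases x; cases y) (simp add: linear_add)

lemma cmap_diff: "linear T \<Longrightarrow> cmap T (x - y) = cmap T x - cmap T y"
  by (cases x; cases y) (simp add: linear_diff)

lemma cmap_0: "linear T \<Longrightarrow> cmap T 0 = 0"
  by (simp add: linear_0 zero_prod_def)

lemma cmap_scale: "linear T \<Longrightarrow> cmap T (complexified_scale c x) = complexified_scale c (cmap T x)"
  by (cases x) (simp add: complexified_scale_def linear_add linear_diff linear_cmul)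

lemmas cmap_simps = cmap_add cmap_diff cmap_0 cmap_scale

lemma cspan_superset_span: "span S \<subseteq> cx.span S"
proof (rule span_minimal)
  show "subspace (cx.span S)"
  proof -
    have "c *\<^sub>R x = complexified_scale (of_real c) x" for c and x :: "'a \<times> 'a"
      by (cases x) (simp add: complexified_scale_def)
    then show ?thesis
      by (auto simp: subspace_def cx.span_zero cx.span_add cx.span_scale)
  qed
qed (rule cx.span_superset)

text \<open>
  Otherwise the iterates would be linearly independent, and there are more of them than the
  dimension admits.
\<close>
lemma krylov_dependent:
  assumes B: "lin_basis (B::'b::real_vector set)"
  shows "\<exists>j. ((T::'b \<Rightarrow> 'b) ^^ j) v \<in> span ((\<lambda>i. (T ^^ i) v) ` {..<j})"
proof (rule ccontr)
  assume "\<not> ?thesis"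
  then have *: "(T ^^ j) v \<notin> span ((\<lambda>i. (T ^^ i) v) ` {..<j})" for j by blast
  have "independent ((\<lambda>i. (T ^^ i) v) ` {..<j}) \<and> card ((\<lambda>i. (T ^^ i) v) ` {..<j}) = j" for j
  proof (induction j)
    case (Suc j)
    have "(T ^^ j) v \<notin> (\<lambda>i. (T ^^ i) v) ` {..<j}" using *[of j] span_base by metis
    then show ?case using Suc *[of j]
      by (simp add: lessThan_Suc real_vector.independent_insert)
  qed (simp add: real_vector.independent_empty)
  from this[of "Suc (card B)"] show False
    using real_vector.independent_span_bound[of B "(\<lambda>i. (T ^^ i) v) ` {..<Suc (card B)}"] B
    by (auto simp: lin_basis_def simp del: lessThan_Suc)
qed

lemma complex_krylov_dependent:
  assumes "lin_basis (B::'a::real_vector set)"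
  shows "\<exists>j. ((X :: 'a \<times> 'a \<Rightarrow> 'a \<times> 'a) ^^ j) v \<in> cx.span ((\<lambda>i. (X ^^ i) v) ` {..<j})"
proof -
  obtain B' :: "('a \<times> 'a) set" where "lin_basis B'" using lin_basis_prod[OF assms] by blast
  from krylov_dependent[OF this, of X v] show ?thesis using cspan_superset_span by blast
qed

text \<open>Horner's scheme for \<open>p(T) v\<close>.\<close>
definition poly_apply :: "('a::real_vector \<Rightarrow> 'a) \<Rightarrow> 'a \<times> 'a \<Rightarrow> complex poly \<Rightarrow> 'a \<times> 'a" where
  "poly_apply T v p = fold_coeffs (\<lambda>a w. complexified_scale a v + cmap T w) p 0"

lemma poly_apply_0 [simp]: "poly_apply T v 0 = 0"
  by (simp add: poly_apply_def)

lemma poly_apply_pCons [simp]: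
  "linear T \<Longrightarrow> poly_apply T v (pCons a p) = complexified_scale a v + cmap T (poly_apply T v p)"
  by (cases "p = 0"; cases "a = 0") (auto simp: poly_apply_def cmap_0)

lemma poly_apply_add: "linear T \<Longrightarrow> poly_apply T v (p + q) = poly_apply T v p + poly_apply T v q"
  by (induction p q rule: poly_induct2) (auto simp: cmap_add cx.scale_left_distrib)

lemma poly_apply_smult: "linear T \<Longrightarrow> poly_apply T v (smult c p) = complexified_scale c (poly_apply T v p)"
  by (induction p) (auto simp: cmap_scale cx.scale_right_distrib)

lemma poly_apply_monom: "linear T \<Longrightarrow> poly_apply T v (monom 1 j) = (cmap T ^^ j) v"
  by (induction j) (auto simp: monom_0 monom_Suc cmap_0)

lemma poly_apply_in:
  assumes "linear T" "cx.subspace U" "\<And>u. u \<in> U \<Longrightarrow> cmap T u \<in> U" "v \<in> U"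
  shows "poly_apply T v p \<in> U"
  using assms by (induction p) (auto simp: cx.subspace_0 cx.subspace_add cx.subspace_scale)

text \<open>
  Split a root off \<open>p\<close>: either the cofactor still annihilates \<open>v\<close>, or it maps \<open>v\<close> to an eigenvector.
\<close>
lemma eigenvector_from_annihilator:
  assumes T: "linear T" and U: "cx.subspace U" "\<And>u. u \<in> U \<Longrightarrow> cmap T u \<in> U"
    and "v \<in> U" "v \<noteq> 0" "p \<noteq> 0" "poly_apply T v p = 0"
  shows "\<exists>c. \<exists>u\<in>U. u \<noteq> 0 \<and> cmap T u = complexified_scale c u"
  using assms(6,7)
proof (induction "degree p" arbitrary: p rule: less_induct)
  case less
  show ?case
  proof (cases "degree p = 0")
    case True
    then obtain a where "p = [:a:]" by (metis degree_eq_zeroE)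
    then show ?thesis using less.prems \<open>v \<noteq> 0\<close> T by (simp add: cmap_0)
  next
    case False
    then obtain c where "poly p c = 0"
      using fundamental_theorem_of_algebra constant_degree by metis
    then obtain q where q: "p = [:-c, 1:] * q" by (metis dvdE poly_eq_0_iff_dvd)
    have "q \<noteq> 0" and deg: "degree q < degree p"
      using q less.prems(1) by (auto simp: degree_mult_eq degree_pCons_eq simp del: mult_pCons_left)
    have "p = smult (-c) q + pCons 0 q" by (simp add: q)
    then have "poly_apply T v (smult (-c) q + pCons 0 q) = 0" using less.prems(2) by simp
    then have *: "cmap T (poly_apply T v q) = complexified_scale c (poly_apply T v q)"
      unfolding poly_apply_add[OF T] poly_apply_smult[OF T] poly_apply_pCons[OF T] by simp
    show ?thesis
    proof (cases "poly_apply T v q = 0")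
      case True
      then show ?thesis using less.hyps deg \<open>q \<noteq> 0\<close> by blast
    next
      case False
      then show ?thesis using * poly_apply_in[OF T U \<open>v \<in> U\<close>] by blast
    qed
  qed
qed

lemma complex_eigenvector_exists:
  assumes B: "lin_basis (B::'a::real_vector set)" and T: "linear (T::'a \<Rightarrow> 'a)"
    and U: "cx.subspace U" "\<And>u. u \<in> U \<Longrightarrow> cmap T u \<in> U" and v: "v \<in> U" "v \<noteq> 0"
  shows "\<exists>c. \<exists>u\<in>U. u \<noteq> 0 \<and> cmap T u = complexified_scale c u"
proof -
  obtain j where j: "(cmap T ^^ j) v \<in> cx.span ((\<lambda>i. (cmap T ^^ i) v) ` {..<j})"
    using complex_krylov_dependent[OF B] by blast
  then have "\<exists>p. (\<forall>i\<ge>j. coeff p i = 0) \<and> (cmap T ^^ j) v = poly_apply T v p"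
  proof (induction rule: cx.span_induct_alt)
    case base
    show ?case by (rule exI[of _ 0]) simp
  next
    case (step c x y)
    then obtain i p where "i < j" "x = (cmap T ^^ i) v" "\<forall>i\<ge>j. coeff p i = 0" "y = poly_apply T v p"
      by blast
    then show ?case using T
      by (intro exI[of _ "smult c (monom 1 i) + p"])
        (auto simp: poly_apply_add poly_apply_smult poly_apply_monom)
  qed
  then obtain p where p: "\<forall>i\<ge>j. coeff p i = 0" "(cmap T ^^ j) v = poly_apply T v p" by blast
  let ?q = "monom 1 j + smult (-1) p"
  have "coeff ?q j = 1" using p(1) by simp
  then have "?q \<noteq> 0" by (metis coeff_0 zero_neq_one)
  moreover have "poly_apply T v ?q = 0"
    using T p(2) by (simp only: poly_apply_add poly_apply_smult poly_apply_monom) simp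
  ultimately show ?thesis using eigenvector_from_annihilator[OF T U v] by blast
qed

lemma csubspace_subspace:
  assumes "cx.subspace U" shows "subspace U"
proof -
  have "c *\<^sub>R x = complexified_scale (of_real c) x" for c and x :: "'a \<times> 'a"
    by (cases x) (simp add: complexified_scale_def)
  then show ?thesis using assms by (auto simp: subspace_def cx.subspace_def)
qed

text \<open>
  In a nonzero invariant subspace of least dimension, every eigenspace of a member of the family is
  invariant and hence everything, so each member acts there as a scalar.
\<close>
lemma common_eigenvector:
  fixes \<S> :: "('a::real_vector \<Rightarrow> 'a) set"
  assumes B: "lin_basis (B::'a set)" and lin: "\<And>T. T \<in> \<S> \<Longrightarrow> linear T"
    and U: "cx.subspace U" "\<And>T u. T \<in> \<S> \<Longrightarrow> u \<in> U \<Longrightarrow> cmap T u \<in> U"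
    and comm: "\<And>S T u. S \<in> \<S> \<Longrightarrow> T \<in> \<S> \<Longrightarrow> u \<in> U \<Longrightarrow> cmap S (cmap T u) = cmap T (cmap S u)"
    and v: "v \<in> U" "v \<noteq> 0"
  obtains u where "u \<in> U" "u \<noteq> 0" "\<And>T. T \<in> \<S> \<Longrightarrow> \<exists>c. cmap T u = complexified_scale c u"
proof -
  obtain B' :: "('a \<times> 'a) set" where B': "lin_basis B'" using lin_basis_prod[OF B] by blast
  define P where "P U' \<longleftrightarrow> cx.subspace U' \<and> U' \<subseteq> U \<and> (\<forall>T\<in>\<S>. \<forall>u\<in>U'. cmap T u \<in> U') \<and> (\<exists>u\<in>U'. u \<noteq> 0)" for U'
  have "P U" using U v by (auto simp: P_def)
  then obtain U' where U': "P U'" and min: "\<And>U''. P U'' \<Longrightarrow> dim U' \<le> dim U''"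
    using ex_has_least_nat[of P U dim] by blast
  have "\<exists>c. \<forall>u\<in>U'. cmap T u = complexified_scale c u" if T: "T \<in> \<S>" for T
  proof -
    obtain c u where cu: "u \<in> U'" "u \<noteq> 0" "cmap T u = complexified_scale c u"
      using complex_eigenvector_exists[OF B lin[OF T], of U'] U' T unfolding P_def by metis
    let ?E = "{u \<in> U'. cmap T u = complexified_scale c u}"
    have "P ?E"
      unfolding P_def
    proof (intro conjI ballI)
      show "cx.subspace ?E" using U' lin[OF T]
        by (auto simp: P_def cx.subspace_def cmap_simps cx.scale_right_distrib mult.commute)
      show "?E \<subseteq> U" using U' by (auto simp: P_def)
      show "\<exists>u\<in>?E. u \<noteq> 0" using cu by blast
      fix S u assume S: "S \<in> \<S>" and u: "u \<in> ?E"
      then have "u \<in> U" using U' by (auto simp: P_def)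
      from comm[OF T S this] have "cmap T (cmap S u) = cmap S (cmap T u)" .
      then show "cmap S u \<in> ?E" using u S U' lin[OF S] by (auto simp: P_def cmap_scale)
    qed
    then have "dim U' \<le> dim ?E" "subspace ?E" "subspace U'"
      using min U' by (auto simp: P_def intro!: csubspace_subspace)
    then have "?E = U'" using dim_strict_subspace[OF B', of U' ?E] by fastforce
    then show ?thesis by blast
  qed
  moreover obtain u where "u \<in> U'" "u \<noteq> 0" "u \<in> U" using U' by (auto simp: P_def)
  ultimately show ?thesis using that by meson
qed

lemma csubspace_Times: "subspace V \<Longrightarrow> cx.subspace (V \<times> V)"
  by (auto simp: cx.subspace_def subspace_def complexified_scale_def zero_prod_def
      simp flip: scaleR_minus_left diff_conv_add_uminus)
    (metis diff_conv_add_uminus scaleR_minus_left)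

lemma add_diff_regroup: "a - b - c + (d + e) = a - c + d - (b - (e::'c::ab_group_add))"
  by (simp add: algebra_simps)

text \<open>
  The heart of Lie's theorem. Let \<open>x\<^sub>i = X\<^sup>i v\<close> and let \<open>K\<^sub>j\<close> be the span of the \<open>x\<^sub>i\<close> with \<open>i < j\<close>. By
  induction \<open>T x\<^sub>i\<close> is \<open>\<lambda>(T) x\<^sub>i - i \<lambda>(T') x\<^sub>i\<^sub>-\<^sub>1\<close> modulo \<open>K\<^sub>i\<^sub>-\<^sub>1\<close>, where \<open>T' = [X, T]\<close>. For the first
  \<open>j\<close> with \<open>x\<^sub>j\<close> in \<open>K\<^sub>j\<close>, the map \<open>T - \<lambda>(T)\<close> sends \<open>K\<^sub>j\<close> to \<open>K\<^sub>j\<^sub>-\<^sub>1\<close>, and therefore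
  \<open>j \<lambda>(T') x\<^sub>j\<^sub>-\<^sub>1\<close> lies in \<open>K\<^sub>j\<^sub>-\<^sub>1\<close>. Minimality of \<open>j\<close> gives \<open>\<lambda>(T') = 0\<close>. This replaces the usual
  trace argument.
\<close>
lemma commutator_kills_weight_vector:
  fixes \<S> :: "('a::real_vector \<Rightarrow> 'a) set" and X :: "'a \<Rightarrow> 'a"
  assumes B: "lin_basis (B::'a set)" and lin: "\<And>T. T \<in> \<S> \<Longrightarrow> linear T" and X: "linear X"
    and U: "\<And>u. u \<in> U \<Longrightarrow> cmap X u \<in> U"
    and stable: "\<And>T. T \<in> \<S> \<Longrightarrow> \<exists>T'\<in>\<S>. \<forall>u\<in>U. cmap T' u = cmap X (cmap T u) - cmap T (cmap X u)"
    and v: "v \<in> U" "v \<noteq> 0" and weight: "\<And>T. T \<in> \<S> \<Longrightarrow> \<exists>c. cmap T v = complexified_scale c v"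
    and T: "T \<in> \<S>" and T': "T' \<in> \<S>" "\<And>u. u \<in> U \<Longrightarrow> cmap T' u = cmap X (cmap T u) - cmap T (cmap X u)"
  shows "cmap T' v = 0"
proof -
  define x where "x i = (cmap X ^^ i) v" for i
  define K where "K j = cx.span (x ` {..<j})" for j
  obtain wt where wt: "cmap T v = complexified_scale (wt T) v" if "T \<in> \<S>" for T
    using weight by metis
  have x0: "x 0 = v" and xS: "x (Suc i) = cmap X (x i)" for i by (simp_all add: x_def)
  have xU: "x i \<in> U" for i by (induction i) (use v U in \<open>auto simp: x0 xS\<close>)
  have mono: "i \<le> j \<Longrightarrow> K i \<subseteq> K j" for i j unfolding K_def by (intro cx.span_mono) auto
  have xK: "i < j \<Longrightarrow> x i \<in> K j" for i j unfolding K_def by (intro cx.span_base) auto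
  have KX: "cmap X u \<in> K (Suc j)" if "u \<in> K j" for u j
    using that unfolding K_def
  proof (induction rule: cx.span_induct_alt)
    case (step c y z)
    then obtain i where "i < j" "y = x i" by blast
    then have "cmap X y \<in> cx.span (x ` {..<Suc j})"
      unfolding xS[symmetric] by (auto simp: xS[symmetric] intro: cx.span_base)
    then show ?case using X step unfolding cmap_simps[OF X] by (intro cx.span_add cx.span_scale)
  qed (simp add: cmap_0 X cx.span_zero)
  have K_add: "a + b \<in> K j" and K_diff: "a - b \<in> K j" if "a \<in> K j" "b \<in> K j" for a b j
    using that unfolding K_def by (rule cx.span_add, rule cx.span_diff)
  have K_scale: "complexified_scale c a \<in> K j" if "a \<in> K j" for a c j
    using that unfolding K_def by (rule cx.span_scale)
  have step: "cmap S (x (Suc i)) = cmap X (cmap S (x i)) - cmap S' (x i)"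
    if "\<forall>u\<in>U. cmap S' u = cmap X (cmap S u) - cmap S (cmap X u)" for S S' i
    using that xU[of i] by (simp add: xS)
  have tri: "\<forall>S\<in>\<S>. cmap S (x i) - complexified_scale (wt S) (x i) \<in> K i" for i
  proof (induction i)
    case 0
    then show ?case by (simp add: x0 wt K_def cx.span_zero)
  next
    case (Suc i)
    show ?case
    proof
      fix S assume S: "S \<in> \<S>"
      then obtain S' where S': "S' \<in> \<S>" "\<forall>u\<in>U. cmap S' u = cmap X (cmap S u) - cmap S (cmap X u)"
        using stable by blast
      have eq: "cmap S (x (Suc i)) - complexified_scale (wt S) (x (Suc i))
        = cmap X (cmap S (x i) - complexified_scale (wt S) (x i))
          - ((cmap S' (x i) - complexified_scale (wt S') (x i)) + complexified_scale (wt S') (x i))"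
        using X by (simp add: step[OF S'(2)] cmap_simps xS[symmetric] algebra_simps)
      have "cmap X (cmap S (x i) - complexified_scale (wt S) (x i)) \<in> K (Suc i)"
        using Suc S KX by blast
      moreover have "cmap S' (x i) - complexified_scale (wt S') (x i) \<in> K (Suc i)"
        using Suc S' mono[of i "Suc i"] by auto
      moreover have "x i \<in> K (Suc i)" by (rule xK) simp
      ultimately show "cmap S (x (Suc i)) - complexified_scale (wt S) (x (Suc i)) \<in> K (Suc i)"
        unfolding eq by (rule K_diff[OF _ K_add[OF _ K_scale]])
    qed
  qed
  have T'': "\<forall>u\<in>U. cmap T' u = cmap X (cmap T u) - cmap T (cmap X u)" using T' by blast
  have sub: "cmap T (x (Suc i)) - complexified_scale (wt T) (x (Suc i))
      + complexified_scale (of_nat (Suc i) * wt T') (x i) \<in> K i" for i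
  proof (induction i)
    case 0
    have "cmap T (x (Suc 0)) - complexified_scale (wt T) (x (Suc 0))
      + complexified_scale (of_nat (Suc 0) * wt T') (x 0) = 0"
      unfolding step[OF T''] using X by (simp add: x0 xS wt T T' cmap_simps)
    then show ?case by (simp add: K_def cx.span_zero)
  next
    case (Suc i)
    let ?u = "cmap T (x (Suc i)) - complexified_scale (wt T) (x (Suc i))
      + complexified_scale (of_nat (Suc i) * wt T') (x i)"
    have Xu: "cmap X ?u = cmap X (cmap T (x (Suc i))) - complexified_scale (wt T) (x (Suc (Suc i)))
      + complexified_scale (of_nat (Suc i) * wt T') (x (Suc i))"
      by (simp only: cmap_add[OF X] cmap_diff[OF X] cmap_scale[OF X] xS)
    have coeff: "complexified_scale (of_nat (Suc (Suc i)) * wt T') y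
      = complexified_scale (of_nat (Suc i) * wt T') y + complexified_scale (wt T') y" for y :: "'a \<times> 'a"
      unfolding cx.scale_left_distrib[symmetric] by (simp add: distrib_right)
    have eq: "cmap T (x (Suc (Suc i))) - complexified_scale (wt T) (x (Suc (Suc i)))
      + complexified_scale (of_nat (Suc (Suc i)) * wt T') (x (Suc i))
      = cmap X ?u - (cmap T' (x (Suc i)) - complexified_scale (wt T') (x (Suc i)))"
      unfolding step[OF T'', of "Suc i"] coeff Xu by (rule add_diff_regroup)
    have "cmap X ?u \<in> K (Suc i)" by (rule KX[OF Suc])
    moreover have "cmap T' (x (Suc i)) - complexified_scale (wt T') (x (Suc i)) \<in> K (Suc i)"
      using tri T'(1) by blast
    ultimately show ?case unfolding eq by (rule K_diff)
  qed
  have "\<exists>j. x j \<in> K j" using complex_krylov_dependent[OF B, of "cmap X" v] by (simp add: x_def K_def)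
  then obtain j where j: "x j \<in> K j" "\<And>i. i < j \<Longrightarrow> x i \<notin> K i" using exists_least_iff[of "\<lambda>j. x j \<in> K j"] by blast
  have "j \<noteq> 0" using j v by (intro notI) (simp add: K_def x0)
  then obtain m where m: "j = Suc m" by (cases j) auto
  have "cmap T u - complexified_scale (wt T) u \<in> K m" if "u \<in> K (Suc m)" for u
    using that unfolding K_def
  proof (induction rule: cx.span_induct_alt)
    case base
    then show ?case by (simp add: cmap_0 lin T cx.span_zero)
  next
    case (step c y z)
    then obtain i where "i < Suc m" and i2: "y = x i" by blast
    then have i: "i \<le> m" "y = x i" by simp_all
    have "cmap T y - complexified_scale (wt T) y \<in> cx.span (x ` {..<m})"
      using tri[of i] T i mono[of i m] by (auto simp: K_def)
    then have "complexified_scale c (cmap T y - complexified_scale (wt T) y)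
        + (cmap T z - complexified_scale (wt T) z) \<in> cx.span (x ` {..<m})"
      using step by (intro cx.span_add cx.span_scale)
    then show ?case using lin[OF T]
      by (simp add: cmap_simps cx.scale_right_distrib cx.scale_right_diff_distrib algebra_simps)
  qed
  then have "cmap T (x (Suc m)) - complexified_scale (wt T) (x (Suc m)) \<in> K m"
    using j m by simp
  define c where "c = of_nat (Suc m) * wt T'"
  from \<open>cmap T (x (Suc m)) - _ \<in> K m\<close> have *: "complexified_scale c (x m) \<in> K m"
    unfolding c_def using K_diff[OF sub[of m]] by (metis add_diff_cancel_left')
  have "wt T' = 0"
  proof (rule ccontr)
    assume nz: "wt T' \<noteq> 0"
    then have "c \<noteq> 0" unfolding c_def by (simp del: of_nat_Suc)
    then have "complexified_scale (inverse c) (complexified_scale c (x m)) = x m" by simp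
    then have "x m \<in> K m" using K_scale[OF *] by metis
    then show False using j m by blast
  qed
  then show ?thesis using wt[OF T'(1)] by simp
qed

section \<open>Ideals and the derived series\<close>

lemma lie_bilinear: "finite_dim_lie_algebra br \<Longrightarrow> bilinear br"
  by (simp add: finite_dim_lie_algebra_def)

lemma lie_lin_basis:
  fixes br :: "'a::real_vector \<Rightarrow> 'a \<Rightarrow> 'a"
  assumes "finite_dim_lie_algebra br"
  obtains B :: "'a set" where "lin_basis B"
proof -
  obtain S :: "'a set" where S: "finite S" "span S = UNIV"
    using assms by (auto simp: finite_dim_lie_algebra_def)
  obtain C where C: "C \<subseteq> S" "independent C" "S \<subseteq> span C"
    using real_vector.maximal_independent_subset by blast
  have "span C = UNIV" using C S by (metis span_mono span_span top.extremum_uniqueI)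
  then show ?thesis using that[of C] C(2) finite_subset[OF C(1) S(1)] by (simp add: lin_basis_def)
qed

lemma lie_antisym:
  assumes "finite_dim_lie_algebra br" shows "br x y = - br y x"
proof -
  have "br (x + y) (x + y) = 0" "br x x = 0" "br y y = 0"
    using assms by (auto simp: finite_dim_lie_algebra_def)
  then have "br x y + br y x = 0"
    using lie_bilinear[OF assms] by (simp add: bilinear_simps add.commute)
  then show ?thesis by (simp add: eq_neg_iff_add_eq_0)
qed

lemma lie_jacobi:
  assumes "finite_dim_lie_algebra br"
  shows "br (br x y) z = br x (br y z) - br y (br x z)"
proof -
  have "br x (br y z) + br y (br z x) + br z (br x y) = 0"
    using assms by (simp add: finite_dim_lie_algebra_def)
  moreover have "br y (br z x) = - br y (br x z)" "br z (br x y) = - br (br x y) z"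
    using lie_antisym[OF assms, of z x] lie_antisym[OF assms, of z "br x y"] lie_bilinear[OF assms]
    by (simp_all add: bilinear_simps)
  ultimately show ?thesis by (simp add: algebra_simps eq_neg_iff_add_eq_0)
qed

lemma lie_ad_linear:
  assumes "finite_dim_lie_algebra br" shows "linear (br x)" "linear (\<lambda>y. br y x)"
  using lie_bilinear[OF assms] by (auto simp: bilinear_def)

lemma lie_ideal_right:
  assumes "finite_dim_lie_algebra br" "lie_ideal br I" "x \<in> I" shows "br x y \<in> I"
  using assms lie_antisym[OF assms(1), of x y] by (auto simp: lie_ideal_def subspace_neg)

lemma lie_product_ideal:
  assumes L: "finite_dim_lie_algebra br" and U: "lie_ideal br U" and V: "lie_ideal br V"
  shows "lie_ideal br (lie_product br U V)"
proof -
  have "br z y \<in> lie_product br U V" if "y \<in> lie_product br U V" for y z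
    using that unfolding lie_product_def
  proof (induction rule: span_induct_alt)
    case base
    then show ?case by (simp add: linear_0[OF lie_ad_linear(1)[OF L]] span_zero)
  next
    case (step c x y)
    then obtain u v where uv: "u \<in> U" "v \<in> V" "x = br u v" by blast
    have eq: "br z x = br (br z u) v + br u (br z v)"
      by (simp add: uv lie_jacobi[OF L])
    have "br (br z u) v \<in> span {br u v |u v. u \<in> U \<and> v \<in> V}"
      using uv U by (intro span_base) (auto simp: lie_ideal_def)
    moreover have "br u (br z v) \<in> span {br u v |u v. u \<in> U \<and> v \<in> V}"
      using uv V by (intro span_base) (auto simp: lie_ideal_def)
    ultimately have "br z x \<in> span {br u v |u v. u \<in> U \<and> v \<in> V}"
      unfolding eq by (rule span_add)
    then show ?case
      using step by (simp add: bilinear_simps[OF lie_bilinear[OF L]] span_add span_scale)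
  qed
  then show ?thesis by (simp add: lie_ideal_def lie_product_def)
qed

lemma lie_derived_series_ideal:
  assumes L: "finite_dim_lie_algebra br" shows "lie_ideal br (lie_derived_series br k)"
proof (induction k)
  case 0
  show ?case by (simp add: lie_ideal_def)
next
  case (Suc k)
  show ?case unfolding lie_derived_series.simps by (rule lie_product_ideal[OF L Suc Suc])
qed

lemma lie_derived_series_bracket:
  "x \<in> lie_derived_series br k \<Longrightarrow> y \<in> lie_derived_series br k \<Longrightarrow> br x y \<in> lie_derived_series br (Suc k)"
  unfolding lie_derived_series.simps lie_product_def by (rule span_base) blast

lemma lie_derived_series_Suc_subset:
  assumes L: "finite_dim_lie_algebra br"
  shows "lie_derived_series br (Suc k) \<subseteq> lie_derived_series br k"
  unfolding lie_derived_series.simps lie_product_def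
  using lie_derived_series_ideal[OF L, of k] by (intro span_minimal) (auto simp: lie_ideal_def)

lemma lie_derived_series_antimono:
  assumes L: "finite_dim_lie_algebra br" and "j \<le> k"
  shows "lie_derived_series br k \<subseteq> lie_derived_series br j"
  using assms(2)
proof (induction rule: dec_induct)
  case (step n)
  show ?case using lie_derived_series_Suc_subset[OF L, of n] step(3) by (rule subset_trans)
qed (rule order_refl)

section \<open>Representations of solvable Lie algebras\<close>

text \<open>
  Only the values on \<open>V\<close> matter; the operators are linear on the whole space so that they can be
  composed with projections.
\<close>
definition lie_rep :: "('a::real_vector \<Rightarrow> 'a \<Rightarrow> 'a) \<Rightarrow> ('a \<Rightarrow> 'b::real_vector \<Rightarrow> 'b) \<Rightarrow> 'b set \<Rightarrow> bool" where
  "lie_rep br \<rho> V \<longleftrightarrow> subspace V \<and> (\<forall>x. linear (\<rho> x)) \<and> (\<forall>v\<in>V. linear (\<lambda>x. \<rho> x v)) \<and>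
     (\<forall>x. \<forall>v\<in>V. \<rho> x v \<in> V) \<and>
     (\<forall>x y. \<forall>v\<in>V. \<rho> (br x y) v = \<rho> x (\<rho> y v) - \<rho> y (\<rho> x v))"

lemma subspace_common_kernel:
  assumes "subspace V" "\<And>i. i \<in> I \<Longrightarrow> linear (f i)"
  shows "subspace {v \<in> V. \<forall>i\<in>I. f i v = 0}"
  using assms by (auto simp: subspace_def linear_0 linear_add linear_cmul)

text \<open>
  Descend along the derived series. If the \<open>(k+2)\<close>-nd term acts trivially, the operators of the
  \<open>(k+1)\<close>-st term commute and have a common weight vector, which by the chain argument is killed by
  all \<open>[X, T]\<close> with \<open>T\<close> from that term. The common kernel of these commutators is invariant, so they
  vanish: the term acts by central operators. Then the chain argument, applied to a single
  commutator \<open>[P, Q]\<close> of elements of the \<open>k\<close>-th term, shows that this central operator has a kernel,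
  hence is zero.
\<close>
lemma irreducible_rep_derived_zero:
  assumes B: "lin_basis (B::'b::real_vector set)"
    and L: "finite_dim_lie_algebra br" and sol: "lie_solvable br"
    and rep: "lie_rep br \<rho> (V::'b set)" and nz: "v0 \<in> V" "v0 \<noteq> 0"
    and irred: "\<And>W. subspace W \<Longrightarrow> W \<subseteq> V \<Longrightarrow> (\<forall>x. \<forall>w\<in>W. \<rho> x w \<in> W) \<Longrightarrow> W \<noteq> {0} \<Longrightarrow> W = V"
    and x: "x \<in> lie_derived_series br 1" and v: "v \<in> V"
  shows "\<rho> x v = 0"
proof -
  have V: "subspace V" and lin: "\<And>x. linear (\<rho> x)" and linx: "\<And>v. v \<in> V \<Longrightarrow> linear (\<lambda>x. \<rho> x v)"
    and inv: "\<And>x v. v \<in> V \<Longrightarrow> \<rho> x v \<in> V"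
    and br: "\<And>x y v. v \<in> V \<Longrightarrow> \<rho> (br x y) v = \<rho> x (\<rho> y v) - \<rho> y (\<rho> x v)"
    using rep by (auto simp: lie_rep_def)
  define triv where "triv k \<longleftrightarrow> (\<forall>x\<in>lie_derived_series br k. \<forall>v\<in>V. \<rho> x v = 0)" for k
  have VV: "cx.subspace (V \<times> V)" by (rule csubspace_Times[OF V])
  have nz': "(v0, v0) \<in> V \<times> V" "(v0, v0) \<noteq> 0" using nz by (auto simp: zero_prod_def)
  have invVV: "cmap (\<rho> x) u \<in> V \<times> V" if "u \<in> V \<times> V" for x u using that inv by auto
  have brVV: "cmap (\<rho> (br x y)) u = cmap (\<rho> x) (cmap (\<rho> y) u) - cmap (\<rho> y) (cmap (\<rho> x) u)"
    if "u \<in> V \<times> V" for x y u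
    using that by (auto simp: br)
  have kernel: "T v = 0"
    if T: "T \<in> \<T>" and v: "v \<in> V" and lT: "\<And>T. T \<in> \<T> \<Longrightarrow> linear T"
      and u: "u \<in> V \<times> V" "u \<noteq> 0" "\<And>T. T \<in> \<T> \<Longrightarrow> cmap T u = 0"
      and stable: "\<And>x T v. T \<in> \<T> \<Longrightarrow> v \<in> V \<Longrightarrow> (\<forall>T\<in>\<T>. T v = 0) \<Longrightarrow> T (\<rho> x v) = 0" for T \<T> v u
  proof -
    let ?W = "{v \<in> V. \<forall>T\<in>\<T>. T v = 0}"
    have "?W = V"
    proof (rule irred)
      show "subspace ?W" by (rule subspace_common_kernel[OF V lT])
      show "\<forall>x. \<forall>w\<in>?W. \<rho> x w \<in> ?W" using stable inv by auto
      obtain p q where u': "u = (p, q)" by (cases u)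
      then have "p \<in> ?W" "q \<in> ?W" using u by (auto simp: zero_prod_def)
      then show "?W \<noteq> {0}" using u u' by (auto simp: zero_prod_def)
    qed auto
    then show ?thesis using T v by blast
  qed
  have step: "triv (Suc k)" if triv: "triv (Suc (Suc k))" for k
  proof -
    let ?a = "lie_derived_series br (Suc k)"
    have ideal: "\<And>x y. y \<in> ?a \<Longrightarrow> br x y \<in> ?a" "\<And>x y. y \<in> ?a \<Longrightarrow> br y x \<in> ?a"
      using lie_derived_series_ideal[OF L, of "Suc k"] lie_ideal_right[OF L]
      unfolding lie_ideal_def by blast+
    have comm: "\<rho> x (\<rho> y v) = \<rho> y (\<rho> x v)" if "x \<in> ?a" "y \<in> ?a" "v \<in> V" for x y v
      using triv lie_derived_series_bracket[OF that(1,2)] br[OF that(3), of x y] that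
      unfolding triv_def by (metis eq_iff_diff_eq_0)
    have commVV: "cmap (\<rho> x) (cmap (\<rho> y) u) = cmap (\<rho> y) (cmap (\<rho> x) u)"
      if "x \<in> ?a" "y \<in> ?a" "u \<in> V \<times> V" for x y u using that comm by auto
    obtain u where u: "u \<in> V \<times> V" "u \<noteq> 0"
      and wt: "\<And>T. T \<in> \<rho> ` ?a \<Longrightarrow> \<exists>c. cmap T u = complexified_scale c u"
    proof (rule common_eigenvector[OF B, of "\<rho> ` ?a" "V \<times> V" "(v0, v0)"])
    qed (use VV nz' lin invVV commVV in auto)
    have kills: "cmap (\<rho> (br x t)) u = 0" if t: "t \<in> ?a" for x t
    proof (rule commutator_kills_weight_vector[OF B, of "\<rho> ` ?a" "\<rho> x" "V \<times> V" u "\<rho> t"])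
      fix T assume "T \<in> \<rho> ` ?a"
      then obtain t' where "t' \<in> ?a" "T = \<rho> t'" by blast
      then show "\<exists>T'\<in>\<rho> ` ?a. \<forall>u\<in>V \<times> V. cmap T' u = cmap (\<rho> x) (cmap T u) - cmap T (cmap (\<rho> x) u)"
        using brVV ideal(1) by (intro bexI[of _ "\<rho> (br x t')"]) blast+
    next
      show "\<rho> (br x t) \<in> \<rho> ` ?a" using t ideal by blast
    qed (use lin invVV u wt t brVV in auto)
    \<comment> \<open>the real and imaginary parts of \<open>u\<close> lie in the common kernel of all these commutators\<close>
    have central: "\<rho> (br x t) v = 0" if "t \<in> ?a" "v \<in> V" for x t v
    proof (rule kernel[of "\<rho> (br x t)" "{\<rho> (br x t) | x t. t \<in> ?a}" v u])
      fix z T v assume T: "T \<in> {\<rho> (br x t) | x t. t \<in> ?a}" and v: "v \<in> V"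
        and T0: "\<forall>T\<in>{\<rho> (br x t) | x t. t \<in> ?a}. T v = 0"
      then obtain x t where t: "t \<in> ?a" "T = \<rho> (br x t)" by blast
      have "\<rho> (br z (br x t)) v = 0" "\<rho> (br x t) v = 0" using T0 t ideal by blast+
      then show "T (\<rho> z v) = 0" using br[OF v, of z "br x t"] t lin by (simp add: linear_0)
    qed (use that lin u kills in auto)
    have pq: "\<rho> (br p q) v = 0"
      if p: "p \<in> lie_derived_series br k" and q: "q \<in> lie_derived_series br k" and v: "v \<in> V" for p q v
    proof -
      let ?t = "br p q"
      have t: "?t \<in> ?a" by (rule lie_derived_series_bracket[OF p q])
      have tc: "\<rho> ?t (\<rho> x v) = \<rho> x (\<rho> ?t v)" if "v \<in> V" for x v
        using central[OF t that, of x] br[OF that, of x ?t] by simp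
      have tcVV: "cmap (\<rho> ?t) (cmap (\<rho> x) u) = cmap (\<rho> x) (cmap (\<rho> ?t) u)" if "u \<in> V \<times> V" for x u
        using that tc by auto
      let ?S = "{\<rho> q, \<rho> ?t, \<lambda>_. 0}"
      have lS: "\<And>T. T \<in> ?S \<Longrightarrow> linear T" using lin by (auto simp: linear_zero)
      obtain u where u: "u \<in> V \<times> V" "u \<noteq> 0"
        and wt: "\<And>T. T \<in> ?S \<Longrightarrow> \<exists>c. cmap T u = complexified_scale c u"
      proof (rule common_eigenvector[OF B lS VV, where v="(v0, v0)"])
        show "cmap T u \<in> V \<times> V" if "T \<in> ?S" "u \<in> V \<times> V" for T u
          using that invVV subspace_0[OF V] by auto
        show "cmap S (cmap T u) = cmap T (cmap S u)" if "S \<in> ?S" "T \<in> ?S" "u \<in> V \<times> V" for S T u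
          using that tc lin by (auto simp: linear_0)
      qed (use nz' in auto)
      have "cmap (\<rho> ?t) u = 0"
      proof (rule commutator_kills_weight_vector[OF B, of ?S "\<rho> p" "V \<times> V" u "\<rho> q"])
        fix T assume "T \<in> ?S"
        then consider "T = \<rho> q" | "T = \<rho> ?t" | "T = (\<lambda>_. 0)" by blast
        then show "\<exists>T'\<in>?S. \<forall>u\<in>V \<times> V. cmap T' u = cmap (\<rho> p) (cmap T u) - cmap T (cmap (\<rho> p) u)"
        proof cases
          case 1
          then show ?thesis using brVV by (intro bexI[of _ "\<rho> ?t"]) auto
        next
          case 2
          then show ?thesis using tcVV by (intro bexI[of _ "\<lambda>_. 0"]) (auto simp: zero_prod_def)
        next
          case 3
          then show ?thesis using lin by (intro bexI[of _ "\<lambda>_. 0"]) (auto simp: zero_prod_def linear_0)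
        qed
      qed (use lS lin invVV u wt brVV in auto)
      then show ?thesis
        using kernel[of "\<rho> ?t" "{\<rho> ?t}" v u] u v tc lin by (auto simp: linear_0)
    qed
    have "\<rho> x v = 0" if "x \<in> ?a" "v \<in> V" for x v
    proof -
      have "x \<in> span {br p q |p q. p \<in> lie_derived_series br k \<and> q \<in> lie_derived_series br k}"
        using that by (simp add: lie_product_def)
      moreover have "\<rho> y v = 0"
        if "y \<in> {br p q |p q. p \<in> lie_derived_series br k \<and> q \<in> lie_derived_series br k}" for y
        using that pq \<open>v \<in> V\<close> by auto
      ultimately show ?thesis
        by (rule linear_eq_0_on_span[OF linx[OF that(2)], rotated])
    qed
    then show ?thesis by (simp add: triv_def)
  qed
  obtain k where "lie_derived_series br k = {0}" using sol by (auto simp: lie_solvable_def)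
  then have "lie_derived_series br (Suc k) \<subseteq> {0}" using lie_derived_series_Suc_subset[OF L, of k] by simp
  then have "triv (Suc k)" using linear_0[OF linx] unfolding triv_def by blast
  then have "triv (Suc 0)"
  proof (induction k)
    case (Suc k)
    from Suc.IH[OF step[OF Suc.prems]] show ?case .
  qed
  then show ?thesis using x v by (simp add: triv_def)
qed

text \<open>
  This is the quotient representation on \<open>V\<close> modulo \<open>W\<close>, transported to the complement that \<open>P\<close>
  projects onto.
\<close>
lemma compressed_rep:
  assumes rep: "lie_rep br \<rho> V" and P: "linear P" "\<And>v. v \<in> V \<Longrightarrow> P v \<in> V" "\<And>w. w \<in> W \<Longrightarrow> P w = 0"
    "\<And>v. v \<in> V \<Longrightarrow> v - P v \<in> W" "\<And>v. v \<in> V \<Longrightarrow> P (P v) = P v"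
    and W: "\<And>x w. w \<in> W \<Longrightarrow> \<rho> x w \<in> W"
  shows "lie_rep br (\<lambda>x. P \<circ> \<rho> x) (P ` V)"
    and "\<And>x v. v \<in> V \<Longrightarrow> P (\<rho> x (P v)) = P (\<rho> x v)"
proof -
  have V: "subspace V" and lin: "\<And>x. linear (\<rho> x)" and linx: "\<And>v. v \<in> V \<Longrightarrow> linear (\<lambda>x. \<rho> x v)"
    and inv: "\<And>x v. v \<in> V \<Longrightarrow> \<rho> x v \<in> V"
    and br: "\<And>x y v. v \<in> V \<Longrightarrow> \<rho> (br x y) v = \<rho> x (\<rho> y v) - \<rho> y (\<rho> x v)"
    using rep by (auto simp: lie_rep_def)
  show *: "P (\<rho> x (P v)) = P (\<rho> x v)" if "v \<in> V" for x v
    using P(3)[OF W[OF P(4)[OF that]], of x] P(1) lin by (simp add: linear_diff)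
  have 1: "subspace (P ` V)" using P(1) V by (rule linear_subspace_image)
  have 2: "linear (P \<circ> \<rho> x)" for x using lin P(1) by (rule linear_compose)
  have 3: "linear (\<lambda>x. (P \<circ> \<rho> x) v)" if "v \<in> P ` V" for v
    using linear_compose[OF linx[of v] P(1)] that P(2) by (auto simp: o_def)
  have 4: "(P \<circ> \<rho> x) v \<in> P ` V" if "v \<in> P ` V" for x v using that P(2) inv by auto
  have 5: "(P \<circ> \<rho> (br x y)) v = (P \<circ> \<rho> x) ((P \<circ> \<rho> y) v) - (P \<circ> \<rho> y) ((P \<circ> \<rho> x) v)"
    if "v \<in> P ` V" for x y v
  proof -
    have "v \<in> V" using that P(2) by auto
    then show ?thesis using P(1) br * inv by (simp add: linear_diff)
  qed
  show "lie_rep br (\<lambda>x. P \<circ> \<rho> x) (P ` V)"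
    unfolding lie_rep_def using 1 2 3 4 5 by blast
qed

lemma complement_dim_less:
  assumes B: "lin_basis (B::'b::real_vector set)" and V: "subspace (V::'b set)"
    and P: "linear P" "\<And>v. v \<in> V \<Longrightarrow> P v \<in> V" "\<And>v. v \<in> V \<Longrightarrow> P (P v) = P v"
    and w: "w \<in> V" "w \<noteq> 0" "P w = 0"
  shows "dim (P ` V) < dim V"
proof (rule dim_strict_subspace[OF B V linear_subspace_image[OF P(1) V]])
  have "w \<notin> P ` V" using w P(3) by fastforce
  then show "P ` V \<subset> V" using w P(2) by blast
qed

text \<open>
  A minimal invariant subspace is killed by the derived algebra; words of a fixed length vanish on
  the quotient by induction, so one more letter kills everything.
\<close>
lemma derived_words_nilpotent:
  assumes B: "lin_basis (B::'b::real_vector set)"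
    and L: "finite_dim_lie_algebra br" and sol: "lie_solvable br"
    and rep: "lie_rep br \<rho> (V::'b set)"
  shows "\<exists>k. \<forall>xs. length xs = k \<longrightarrow> set xs \<subseteq> lie_derived_series br 1 \<longrightarrow> (\<forall>v\<in>V. fold \<rho> xs v = 0)"
  using rep
proof (induction "dim V" arbitrary: V \<rho> rule: less_induct)
  case (less V \<rho>)
  have V: "subspace V" and inv: "\<And>x v. v \<in> V \<Longrightarrow> \<rho> x v \<in> V"
    and lin: "\<And>x. linear (\<rho> x)"
    using less.prems by (auto simp: lie_rep_def)
  show ?case
  proof (cases "V = {0}")
    case True
    then show ?thesis by (intro exI[of _ 0]) auto
  next
    case False
    define I where "I W \<longleftrightarrow> subspace W \<and> W \<subseteq> V \<and> (\<forall>x. \<forall>w\<in>W. \<rho> x w \<in> W) \<and> W \<noteq> {0}" for W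
    have "I V" using False V inv by (auto simp: I_def)
    then obtain W where W: "I W" and min: "\<And>W'. I W' \<Longrightarrow> dim W \<le> dim W'"
      using ex_has_least_nat[of I V dim] by blast
    have Ws: "subspace W" "W \<subseteq> V" and Winv: "\<And>x w. w \<in> W \<Longrightarrow> \<rho> x w \<in> W"
      using W by (auto simp: I_def)
    obtain w0 where w0: "w0 \<in> W" "w0 \<noteq> 0" using W subspace_0 unfolding I_def by blast
    have repW: "lie_rep br \<rho> W" using less.prems Ws Winv by (auto simp: lie_rep_def)
    have W0: "\<rho> x w = 0" if "x \<in> lie_derived_series br 1" "w \<in> W" for x w
    proof (rule irreducible_rep_derived_zero[OF B L sol repW w0 _ that])
      fix W' assume W': "subspace W'" "W' \<subseteq> W" "\<forall>x. \<forall>w\<in>W'. \<rho> x w \<in> W'" "W' \<noteq> {0}"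
      then have "I W'" using Ws by (auto simp: I_def)
      then show "W' = W" using min dim_strict_subspace[OF B Ws(1) W'(1)] W'(2) by fastforce
    qed
    obtain P where P: "linear P" "\<And>v. v \<in> V \<Longrightarrow> P v \<in> V" "\<And>w. w \<in> W \<Longrightarrow> P w = 0"
      "\<And>v. v \<in> V \<Longrightarrow> v - P v \<in> W" "\<And>v. v \<in> V \<Longrightarrow> P (P v) = P v"
      using complementary_projection[OF B V Ws] by blast
    note cr = compressed_rep[OF less.prems P Winv]
    have "dim (P ` V) < dim V"
      using complement_dim_less[OF B V P(1,2,5)] w0 Ws P(3) by blast
    from less.hyps[OF this cr(1)] obtain k where k: "\<And>xs v. length xs = k \<Longrightarrow>
        set xs \<subseteq> lie_derived_series br 1 \<Longrightarrow> v \<in> P ` V \<Longrightarrow> fold (\<lambda>x. P \<circ> \<rho> x) xs v = 0" by blast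
    have comp: "v \<in> V \<Longrightarrow> fold \<rho> xs v \<in> V \<and> P (fold \<rho> xs v) = fold (\<lambda>x. P \<circ> \<rho> x) xs (P v)" for xs v
      by (induction xs arbitrary: v) (simp_all add: inv cr(2))
    have "fold \<rho> xs v = 0" if xs: "length xs = Suc k" "set xs \<subseteq> lie_derived_series br 1" and v: "v \<in> V" for xs v
    proof -
      obtain ys y where ys: "xs = ys @ [y]" "length ys = k" using xs(1) by (metis length_Suc_conv_rev)
      have "P (fold \<rho> ys v) = 0" using comp[OF v, of ys] k[of ys "P v"] xs ys v by auto
      then have "fold \<rho> ys v \<in> W" using P(4)[of "fold \<rho> ys v"] comp[OF v, of ys] by simp
      then show ?thesis using W0 xs ys by simp
    qed
    then show ?thesis by blast
  qed
qed

section \<open>Position of an abelian nilradical\<close>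

text \<open>
  From the second step on, the lower central series of \<open>I\<close> is spanned by words in \<open>I\<close> applied
  to elements of \<open>N\<close>. So \<open>I\<close> is a nilpotent ideal, and \<open>N\<close> is maximal among these.
\<close>
lemma nilpotent_ideal_in_nilradical:
  assumes L: "finite_dim_lie_algebra br" and N: "lie_nilradical br N" and I: "lie_ideal br I" "N \<subseteq> I"
    and II: "\<And>x y. x \<in> I \<Longrightarrow> y \<in> I \<Longrightarrow> br x y \<in> N"
    and k: "\<And>xs v. length xs = k \<Longrightarrow> set xs \<subseteq> I \<Longrightarrow> v \<in> N \<Longrightarrow> fold br xs v = 0"
  shows "I = N"
proof -
  have Nid: "lie_ideal br N" using N by (simp add: lie_nilradical_def)
  define D where "D j = span {fold br xs v | xs v. length xs = j \<and> set xs \<subseteq> I \<and> v \<in> N}" for j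
  have "lie_lower_central br I (Suc j) \<subseteq> D j" for j
  proof (induction j)
    case 0
    have "{br u v |u v. u \<in> I \<and> v \<in> I} \<subseteq> D 0"
      unfolding D_def using II by (auto intro!: span_base)
    then show ?case by (simp add: lie_product_def span_minimal D_def)
  next
    case (Suc j)
    have *: "br u d \<in> D (Suc j)" if "u \<in> I" "d \<in> D j" for u d
      using that(2) unfolding D_def
    proof (induction rule: span_induct_alt)
      case base
      then show ?case by (simp add: linear_0[OF lie_ad_linear(1)[OF L]] span_zero)
    next
      case (step c x y)
      then obtain xs v where xs: "x = fold br xs v" "length xs = j" "set xs \<subseteq> I" "v \<in> N" by blast
      then have "br u x = fold br (xs @ [u]) v" by simp
      then have "br u x \<in> span {fold br xs v |xs v. length xs = Suc j \<and> set xs \<subseteq> I \<and> v \<in> N}"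
        using xs that(1) by (intro span_base) (auto intro!: exI[of _ "xs @ [u]"] exI[of _ v])
      then show ?case using step
        by (simp add: bilinear_simps[OF lie_bilinear[OF L]] span_add span_scale)
    qed
    show ?case
      unfolding lie_lower_central.simps(2)[of br I "Suc j"] lie_product_def
      using Suc * by (intro span_minimal) (auto simp: D_def)
  qed
  from this[of k] have "lie_lower_central br I (Suc k) \<subseteq> D k" .
  moreover have "D k \<subseteq> span {0}"
    unfolding D_def by (rule span_mono) (use k in blast)
  moreover have "0 \<in> lie_lower_central br I (Suc k)" by (simp add: lie_product_def span_zero)
  ultimately have "lie_lower_central br I (Suc k) = {0}" by auto
  then have "lie_nilpotent_on br I" unfolding lie_nilpotent_on_def by blast
  then show ?thesis using N I by (simp add: lie_nilradical_def)
qed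

text \<open>
  Descend along the derived series: if a term lies in \<open>N\<close>, the sum of \<open>N\<close> and the preceding term is
  an ideal with brackets in \<open>N\<close>. Its elements act on \<open>N\<close> as elements of the derived algebra do,
  because \<open>N\<close> is abelian, hence nilpotently.
\<close>
lemma derived_in_abelian_nilradical:
  assumes L: "finite_dim_lie_algebra br" and sol: "lie_solvable br"
    and N: "lie_nilradical br N" and ab: "lie_abelian_on br N"
  shows "br x y \<in> N"
proof -
  obtain B :: "'a set" where B: "lin_basis B" using lie_lin_basis[OF L] .
  have Nid: "lie_ideal br N" and Ns: "subspace N" using N by (auto simp: lie_nilradical_def lie_ideal_def)
  have Ninv: "\<And>x y. y \<in> N \<Longrightarrow> br x y \<in> N" using Nid by (auto simp: lie_ideal_def)
  have "lie_rep br br N"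
    using Ns Ninv lie_ad_linear[OF L] lie_jacobi[OF L] by (auto simp: lie_rep_def)
  from derived_words_nilpotent[OF B L sol this] obtain k where
    k: "\<And>xs v. length xs = k \<Longrightarrow> set xs \<subseteq> lie_derived_series br 1 \<Longrightarrow> v \<in> N \<Longrightarrow> fold br xs v = 0" by blast
  have step: "lie_derived_series br (Suc j) \<subseteq> N" if j: "lie_derived_series br (Suc (Suc j)) \<subseteq> N" for j
  proof -
    let ?D = "lie_derived_series br (Suc j)"
    let ?I = "{x + u | x u. x \<in> ?D \<and> u \<in> N}"
    have Did: "lie_ideal br ?D" and Ds: "subspace ?D"
      using lie_derived_series_ideal[OF L, of "Suc j"] by (auto simp: lie_ideal_def)
    have "?I = N"
    proof (rule nilpotent_ideal_in_nilradical[OF L N])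
      have "subspace ?I" by (rule subspace_sums[OF Ds Ns])
      moreover have "br z y \<in> ?I" if y: "y \<in> ?I" for y z
      proof -
        obtain x u where xu: "y = x + u" "x \<in> ?D" "u \<in> N" using y by blast
        have "br z y = br z x + br z u" by (simp add: xu bilinear_simps[OF lie_bilinear[OF L]])
        moreover have "br z x \<in> ?D" "br z u \<in> N" using xu Did Ninv by (auto simp only: lie_ideal_def)
        ultimately show ?thesis by blast
      qed
      ultimately show "lie_ideal br ?I" unfolding lie_ideal_def by blast
      show "N \<subseteq> ?I" using subspace_0[OF Ds] by force
      show "br x y \<in> N" if x: "x \<in> ?I" and y: "y \<in> ?I" for x y
      proof -
        obtain x' u where xu: "x = x' + u" "x' \<in> ?D" "u \<in> N" using x by blast
        obtain y' w where yw: "y = y' + w" "y' \<in> ?D" "w \<in> N" using y by blast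
        have "br x y = br x' y' + (br x' w + br u y)"
          by (simp add: xu yw bilinear_simps[OF lie_bilinear[OF L]] algebra_simps)
        moreover have "br x' y' \<in> N"
          using j lie_derived_series_bracket[OF xu(2) yw(2)] by blast
        moreover have "br x' w \<in> N" "br u y \<in> N"
          using Ninv lie_ideal_right[OF L Nid] xu yw by auto
        ultimately show ?thesis using Ns by (simp add: subspace_add)
      qed
      have *: "\<exists>ys. length ys = length xs \<and> set ys \<subseteq> lie_derived_series br 1 \<and> (\<forall>v\<in>N. fold br xs v = fold br ys v)"
        if "set xs \<subseteq> ?I" for xs
        using that
      proof (induction xs)
        case Nil
        then show ?case by simp
      next
        case (Cons x xs)
        then obtain ys where ys: "length ys = length xs" "set ys \<subseteq> lie_derived_series br 1"
          "\<forall>v\<in>N. fold br xs v = fold br ys v" by auto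
        obtain x' u where xu: "x = x' + u" "x' \<in> ?D" "u \<in> N" using Cons.prems by auto
        have "br x v = br x' v" if "v \<in> N" for v
          using ab that xu by (simp add: lie_abelian_on_def bilinear_simps[OF lie_bilinear[OF L]])
        moreover have "x' \<in> lie_derived_series br 1"
          using lie_derived_series_antimono[OF L, of 1 "Suc j"] xu by auto
        ultimately show ?case using ys Ninv by (intro exI[of _ "x' # ys"]) auto
      qed
      show "fold br xs v = 0" if "length xs = k" "set xs \<subseteq> ?I" "v \<in> N" for xs v
        using *[OF that(2)] k that by metis
    qed
    then show ?thesis using subspace_0[OF Ns] by force
  qed
  obtain k' where "lie_derived_series br k' = {0}" using sol by (auto simp: lie_solvable_def)
  then have "lie_derived_series br (Suc k') \<subseteq> {0}"
    using lie_derived_series_Suc_subset[OF L, of k'] by simp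
  moreover have "{0} \<subseteq> N" using subspace_0[OF Ns] by simp
  ultimately have "lie_derived_series br (Suc k') \<subseteq> N" by (rule subset_trans)
  then have "lie_derived_series br (Suc 0) \<subseteq> N"
  proof (induction k')
    case (Suc k)
    from Suc.IH[OF step[OF Suc.prems]] show ?case .
  qed
  moreover have "br x y \<in> lie_derived_series br (Suc 0)"
    by (rule lie_derived_series_bracket) simp_all
  ultimately show ?thesis by blast
qed

text \<open>Otherwise \<open>N\<close> and \<open>z\<close> would span a larger nilpotent ideal.\<close>
lemma nilpotent_action_in_nilradical:
  assumes L: "finite_dim_lie_algebra br" and sol: "lie_solvable br"
    and N: "lie_nilradical br N" and ab: "lie_abelian_on br N"
    and k: "\<And>v. v \<in> N \<Longrightarrow> (br z ^^ k) v = 0"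
  shows "z \<in> N"
proof -
  have Nid: "lie_ideal br N" and Ns: "subspace N" using N by (auto simp: lie_nilradical_def lie_ideal_def)
  have Ninv: "\<And>x y. y \<in> N \<Longrightarrow> br x y \<in> N" using Nid by (auto simp: lie_ideal_def)
  let ?I = "{x + u | x u. x \<in> span {z} \<and> u \<in> N}"
  have sub: "subspace ?I" by (rule subspace_sums[OF subspace_span Ns])
  have NI: "N \<subseteq> ?I" using span_zero by force
  have I: "lie_ideal br ?I"
    unfolding lie_ideal_def using sub derived_in_abelian_nilradical[OF L sol N ab] NI by blast
  have *: "\<exists>c. \<forall>v\<in>N. fold br xs v = c *\<^sub>R (br z ^^ length xs) v" if "set xs \<subseteq> ?I" for xs
    using that
  proof (induction xs)
    case Nil
    then show ?case by (intro exI[of _ 1]) simp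
  next
    case (Cons x xs)
    then obtain c where c: "\<forall>v\<in>N. fold br xs v = c *\<^sub>R (br z ^^ length xs) v" by auto
    obtain a u where xu: "x = a *\<^sub>R z + u" "u \<in> N" using Cons.prems by (auto simp: span_singleton)
    have "br x v = a *\<^sub>R br z v" if "v \<in> N" for v
      using ab that xu by (simp add: lie_abelian_on_def bilinear_simps[OF lie_bilinear[OF L]])
    moreover have "(br z ^^ n) (a *\<^sub>R w) = a *\<^sub>R (br z ^^ n) w" for n w
      by (induction n) (simp_all add: bilinear_simps[OF lie_bilinear[OF L]])
    ultimately have "\<forall>v\<in>N. fold br (x # xs) v = (c * a) *\<^sub>R (br z ^^ length (x # xs)) v"
      using c Ninv Ns by (simp add: subspace_scale funpow_swap1)
    then show ?case by blast
  qed
  have "fold br xs v = 0" if "length xs = k" "set xs \<subseteq> ?I" "v \<in> N" for xs v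
    using *[OF that(2)] k[OF that(3)] that by force
  from nilpotent_ideal_in_nilradical[OF L N I NI _ this] have "?I = N"
    using derived_in_abelian_nilradical[OF L sol N ab] by blast
  moreover have "z + 0 \<in> ?I" using span_base[of z "{z}"] subspace_0[OF Ns] by blast
  ultimately show ?thesis by simp
qed

section \<open>An inner product on the nilradical\<close>

text \<open>
  Up to a factor \<open>- 1/2\<close>, this is the Ricci form on \<open>N\<close> of the extension of \<open>N\<close> by a single unit
  vector that acts by \<open>A\<close> and has trace \<open>\<tau>\<close>. The sum over the frame \<open>E\<close> is \<open>\<langle>A\<^sup>* x, A\<^sup>* y\<rangle>\<close>;
  keeping \<open>\<tau>\<close> independent of \<open>A\<close> makes inductions over invariant
  subspaces possible.
\<close>
definition ricci_form ::
    "real \<Rightarrow> ('a::real_vector \<Rightarrow> 'a) \<Rightarrow> ('a \<Rightarrow> 'a \<Rightarrow> real) \<Rightarrow> 'a set \<Rightarrow> 'a \<Rightarrow> 'a \<Rightarrow> real" where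
  "ricci_form \<tau> A Q E x y =
     \<tau> * (Q (A x) y + Q (A y) x) + Q (A x) (A y) - (\<Sum>e\<in>E. Q (A e) x * Q (A e) y)"

lemma symmetric_bilinear_ricci_form:
  assumes Q: "symmetric_bilinear Q" and A: "linear A"
  shows "symmetric_bilinear (ricci_form \<tau> A Q E)"
proof -
  have bl: "bilinear Q" and sym: "\<And>x y. Q x y = Q y x" using Q by (auto simp: symmetric_bilinear_def)
  have s: "ricci_form \<tau> A Q E x y = ricci_form \<tau> A Q E y x" for x y
    by (simp add: ricci_form_def sym[of "A x" "A y"] mult.commute add.commute)
  have l: "linear (\<lambda>x. ricci_form \<tau> A Q E x y)" for y
    by (simp add: linear_iff ricci_form_def bilinear_simps[OF bl] linear_add[OF A] linear_cmul[OF A]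
        algebra_simps sum.distrib sum_distrib_left)
  have "linear (\<lambda>y. ricci_form \<tau> A Q E x y)" for x using l[of x] by (simp add: s[of x])
  with l s show ?thesis by (auto simp: symmetric_bilinear_def bilinear_def)
qed

lemma real_eigenvector_block:
  fixes A :: "'i \<Rightarrow> 'b::real_vector \<Rightarrow> 'b"
  assumes B: "lin_basis (B::'b set)" and w: "w \<noteq> 0" and lin: "\<And>i. linear (A i)"
    and eig: "\<And>i. A i w = a i *\<^sub>R w" and pos: "0 < a j" "0 < \<tau>"
  shows "\<exists>Q E. on_frame Q (span {w}) E \<and> (\<forall>u\<in>span {w}. u \<noteq> 0 \<longrightarrow> 0 < ricci_form \<tau> (A j) Q E u u) \<and>
    (\<forall>i. (\<forall>u\<in>span {w}. Q (A i u) u = 0) \<longrightarrow> (\<forall>u\<in>span {w}. A i u = 0))"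
proof -
  have "independent {w}" using w by simp
  from on_frame_of_independent[OF B this] obtain Q where Q: "on_frame Q (span {w}) {w}" .
  note bl = on_frame_bilinear[OF Q]
  have ww: "Q w w = 1" using on_frame_orth[OF Q, of w w] by simp
  show ?thesis
  proof (intro exI conjI ballI allI impI, rule Q)
    fix u assume "u \<in> span {w}" "u \<noteq> 0"
    then obtain c where c: "u = c *\<^sub>R w" "c \<noteq> 0" by (auto simp: span_singleton)
    have "ricci_form \<tau> (A j) Q {w} u u = 2 * \<tau> * a j * c\<^sup>2"
      by (simp add: ricci_form_def c linear_cmul[OF lin] eig bilinear_simps[OF bl] ww power2_eq_square algebra_simps)
    then show "0 < ricci_form \<tau> (A j) Q {w} u u" using pos c by simp
  next
    fix i u assume "\<forall>u\<in>span {w}. Q (A i u) u = 0" and u: "u \<in> span {w}"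
    then have "a i = 0" using ww by (auto simp: eig bilinear_simps[OF bl] dest: bspec[of _ _ w] intro: span_base)
    then show "A i u = 0" using u by (auto simp: span_singleton linear_cmul[OF lin] eig)
  qed
qed

text \<open>
  If \<open>{x, y}\<close> were made orthonormal, the operators would be normal, which suits the Ricci form, but
  those with purely imaginary eigenvalues would be skew. So \<open>y\<close> is stretched by a factor \<open>r > 1\<close>:
  then a skew operator of the family vanishes on the block, and for \<open>r\<close> close to one the form stays positive.
\<close>
lemma complex_eigenvector_block:
  fixes A :: "'i \<Rightarrow> 'b::real_vector \<Rightarrow> 'b"
  assumes B: "lin_basis (B::'b set)" and ind: "independent {x, y}" "x \<noteq> y" and lin: "\<And>i. linear (A i)"
    and eig: "\<And>i. A i x = a i *\<^sub>R x - b i *\<^sub>R y" "\<And>i. A i y = b i *\<^sub>R x + a i *\<^sub>R y"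
    and pos: "0 < a j" "0 < \<tau>"
  shows "\<exists>Q E. on_frame Q (span {x, y}) E \<and> (\<forall>u\<in>span {x, y}. u \<noteq> 0 \<longrightarrow> 0 < ricci_form \<tau> (A j) Q E u u) \<and>
    (\<forall>i. (\<forall>u\<in>span {x, y}. Q (A i u) u = 0) \<longrightarrow> (\<forall>u\<in>span {x, y}. A i u = 0))"
proof -
  define b' where "b' = b j"
  have "((\<lambda>r. \<tau> * \<bar>b'\<bar> * (r - 1 / r) + b'\<^sup>2 * (r\<^sup>2 - (1 / r)\<^sup>2)) \<longlongrightarrow> 0) (at_right (1::real))"
    by (auto intro!: tendsto_eq_intros)
  then have "eventually (\<lambda>r. \<tau> * \<bar>b'\<bar> * (r - 1 / r) + b'\<^sup>2 * (r\<^sup>2 - (1 / r)\<^sup>2) < 2 * \<tau> * a j) (at_right (1::real))"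
    using pos by (intro order_tendstoD(2)) auto
  then have "eventually (\<lambda>r. 1 < r \<and> \<tau> * \<bar>b'\<bar> * (r - 1 / r) + b'\<^sup>2 * (r\<^sup>2 - (1 / r)\<^sup>2) < 2 * \<tau> * a j) (at_right (1::real))"
    using eventually_at_right_less by (rule eventually_conj[rotated])
  then obtain r :: real where r: "1 < r"
    and small: "\<tau> * \<bar>b'\<bar> * (r - 1 / r) + b'\<^sup>2 * (r\<^sup>2 - (1 / r)\<^sup>2) < 2 * \<tau> * a j"
    using eventually_happens'[OF trivial_limit_at_right_real] by blast
  define t where "t = 1 / r"
  have rt: "r * t = 1" "0 < t" "t < 1" using r by (auto simp: t_def)
  then have tr: "t < r" using r by linarith
  define z where "z = r *\<^sub>R y"
  have y: "y = t *\<^sub>R z" using rt by (simp add: z_def mult.commute)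
  have x0: "x \<noteq> 0" using ind real_vector.dependent_zero by blast
  have y_not: "y \<notin> span {x}"
    using ind by (metis insert_commute real_vector.independent_insert singletonD)
  have "z \<notin> span {x}" using y_not y span_scale by metis
  then have zx: "z \<noteq> x" and indz: "independent {x, z}"
    using x0 real_vector.independent_insert[of z "{x}"] by (auto simp: insert_commute intro: span_base)
  have sp: "span {x, z} = span {x, y}"
  proof (intro subset_antisym span_minimal)
    show "{x, z} \<subseteq> span {x, y}" by (auto simp: z_def intro: span_base span_scale)
    have "t *\<^sub>R z \<in> span {x, z}" by (intro span_scale span_base) simp
    then show "{x, y} \<subseteq> span {x, z}" by (auto simp: y intro: span_base)
  qed auto
  from on_frame_of_independent[OF B indz] obtain Q where Q: "on_frame Q (span {x, z}) {x, z}" .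
  note bl = on_frame_bilinear[OF Q]
  have q: "Q x x = 1" "Q z z = 1" "Q x z = 0" "Q z x = 0"
    using on_frame_orth[OF Q] zx by auto
  have Ax: "A i x = a i *\<^sub>R x - (t * b i) *\<^sub>R z" for i by (simp add: eig y mult.commute)
  have Az: "A i z = (r * b i) *\<^sub>R x + a i *\<^sub>R z" for i
    by (simp add: z_def linear_cmul[OF lin] eig scaleR_add_right mult.commute)
  have eq: "span {x, y} = {p *\<^sub>R x + q *\<^sub>R z | p q. True}"
    unfolding sp[symmetric] by (auto simp: span_insert span_singleton) (metis add_diff_cancel_left' diff_add_cancel add.commute)+
  show ?thesis
  proof (intro exI conjI ballI allI impI)
    show "on_frame Q (span {x, y}) {x, z}" using Q sp by simp
    fix u assume u: "u \<in> span {x, y}" "u \<noteq> 0"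
    then obtain p q where pq: "u = p *\<^sub>R x + q *\<^sub>R z" unfolding eq by auto
    let ?S = "p\<^sup>2 + q\<^sup>2"
    have S: "0 < ?S" using u pq by (auto simp: sum_power2_gt_zero_iff)
    have "ricci_form \<tau> (A j) Q {x, z} u u
      = 2 * \<tau> * a j * ?S + \<tau> * b' * (r - t) * (2 * (p * q)) + b'\<^sup>2 * (r\<^sup>2 - t\<^sup>2) * (q\<^sup>2 - p\<^sup>2)"
      using zx by (simp add: ricci_form_def pq linear_add[OF lin] linear_cmul[OF lin] Ax Az bilinear_simps[OF bl] q
          b'_def power2_eq_square algebra_simps)
    moreover have "- (\<tau> * \<bar>b'\<bar> * (r - t) * ?S) \<le> \<tau> * b' * (r - t) * (2 * (p * q))"
    proof -
      have "\<bar>2 * (p * q)\<bar> \<le> ?S"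
        using sum_squares_bound[of p q] sum_squares_bound[of p "-q"] by (auto simp: abs_le_iff)
      then have "\<tau> * \<bar>b'\<bar> * (r - t) * \<bar>2 * (p * q)\<bar> \<le> \<tau> * \<bar>b'\<bar> * (r - t) * ?S"
        using pos rt tr by (intro mult_left_mono) auto
      moreover have "\<bar>\<tau> * b' * (r - t) * (2 * (p * q))\<bar> = \<tau> * \<bar>b'\<bar> * (r - t) * \<bar>2 * (p * q)\<bar>"
        using pos rt tr by (simp add: abs_mult)
      ultimately show ?thesis by linarith
    qed
    moreover have "- (b'\<^sup>2 * (r\<^sup>2 - t\<^sup>2) * ?S) \<le> b'\<^sup>2 * (r\<^sup>2 - t\<^sup>2) * (q\<^sup>2 - p\<^sup>2)"
    proof -
      have "0 \<le> b'\<^sup>2 * (r\<^sup>2 - t\<^sup>2)" using rt tr by (intro mult_nonneg_nonneg) (auto intro: power_mono)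
      then have "b'\<^sup>2 * (r\<^sup>2 - t\<^sup>2) * (- ?S) \<le> b'\<^sup>2 * (r\<^sup>2 - t\<^sup>2) * (q\<^sup>2 - p\<^sup>2)"
        by (intro mult_left_mono) auto
      then show ?thesis by (simp only: mult_minus_right)
    qed
    moreover have "(\<tau> * \<bar>b'\<bar> * (r - t) + b'\<^sup>2 * (r\<^sup>2 - t\<^sup>2)) * ?S < 2 * \<tau> * a j * ?S"
      using small S by (intro mult_strict_right_mono) (auto simp: t_def)
    ultimately show "0 < ricci_form \<tau> (A j) Q {x, z} u u" by (simp add: distrib_right)
  next
    fix i u assume 0: "\<forall>u\<in>span {x, y}. Q (A i u) u = 0" and u: "u \<in> span {x, y}"
    have "x \<in> span {x, z}" "x + z \<in> span {x, z}" by (auto intro: span_base span_add)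
    then have "Q (A i x) x = 0" "Q (A i (x + z)) (x + z) = 0" using 0 sp by auto
    then have a0: "a i = 0" and "b i * (r - t) = 0"
      by (simp_all add: Ax Az linear_add[OF lin] bilinear_simps[OF bl] q algebra_simps)
    then have "b i = 0" using tr by simp
    then show "A i u = 0" using u a0 unfolding eq
      by (auto simp: linear_add[OF lin] linear_cmul[OF lin] Ax Az)
  qed
qed

lemma eigenvector_block:
  fixes A :: "'i \<Rightarrow> 'b::real_vector \<Rightarrow> 'b"
  assumes B: "lin_basis (B::'b set)" and nz: "(x, y) \<noteq> 0" and lin: "\<And>i. linear (A i)"
    and eig: "\<And>i. cmap (A i) (x, y) = complexified_scale (\<alpha> i) (x, y)"
    and pos: "0 < Re (\<alpha> j)" "0 < \<tau>"
  shows "\<exists>Q E. on_frame Q (span {x, y}) E \<and> (\<forall>u\<in>span {x, y}. u \<noteq> 0 \<longrightarrow> 0 < ricci_form \<tau> (A j) Q E u u) \<and>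
    (\<forall>i. (\<forall>u\<in>span {x, y}. Q (A i u) u = 0) \<longrightarrow> (\<forall>u\<in>span {x, y}. A i u = 0))"
proof (cases "independent {x, y} \<and> x \<noteq> y")
  case True
  then show ?thesis
    using complex_eigenvector_block[OF B, where A=A and a="\<lambda>i. Re (\<alpha> i)" and b="\<lambda>i. Im (\<alpha> i)"] eig lin pos
    by (auto simp: complexified_scale_def)
next
  case False
  have "\<exists>w p q. x = p *\<^sub>R w \<and> y = q *\<^sub>R w"
  proof (cases "x = 0")
    case True
    then show ?thesis by (intro exI[of _ y] exI[of _ 0] exI[of _ 1]) simp
  next
    case x0: False
    then have "y \<in> span {x}"
      using False real_vector.independent_insert[of y "{x}"] span_base[of x "{x}"]
      by (auto simp: insert_commute split: if_splits)
    then obtain q where "y = q *\<^sub>R x" by (auto simp: span_singleton)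
    then show ?thesis by (intro exI[of _ x] exI[of _ 1] exI[of _ q]) simp
  qed
  then obtain w p q where w: "x = p *\<^sub>R w" "y = q *\<^sub>R w" by blast
  have w0: "w \<noteq> 0" using nz w by (auto simp: zero_prod_def)
  have S: "p\<^sup>2 + q\<^sup>2 \<noteq> 0"
  proof
    assume "p\<^sup>2 + q\<^sup>2 = 0"
    then have "p = 0" "q = 0" by (simp_all add: sum_power2_eq_zero_iff)
    then show False using nz w by (simp add: zero_prod_def)
  qed
  have Aw: "A i w = Re (\<alpha> i) *\<^sub>R w" for i
  proof -
    have "p *\<^sub>R A i w = Re (\<alpha> i) *\<^sub>R x - Im (\<alpha> i) *\<^sub>R y" "q *\<^sub>R A i w = Im (\<alpha> i) *\<^sub>R x + Re (\<alpha> i) *\<^sub>R y"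
      using eig[of i] w by (auto simp: complexified_scale_def linear_cmul[OF lin])
    then have "p *\<^sub>R p *\<^sub>R A i w + q *\<^sub>R q *\<^sub>R A i w
      = p *\<^sub>R (Re (\<alpha> i) *\<^sub>R x - Im (\<alpha> i) *\<^sub>R y) + q *\<^sub>R (Im (\<alpha> i) *\<^sub>R x + Re (\<alpha> i) *\<^sub>R y)" by simp
    then have "(p\<^sup>2 + q\<^sup>2) *\<^sub>R A i w = (p\<^sup>2 + q\<^sup>2) *\<^sub>R (Re (\<alpha> i) *\<^sub>R w)"
      unfolding w by (simp add: algebra_simps power2_eq_square)
    then show ?thesis using S real_vector.scale_cancel_left by blast
  qed
  have "span {x, y} = span {w}"
  proof (intro subset_antisym span_minimal)
    show "{x, y} \<subseteq> span {w}" using w by (auto intro: span_scale span_base)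
    have "(1 / (p\<^sup>2 + q\<^sup>2)) *\<^sub>R (p *\<^sub>R x + q *\<^sub>R y) = ((1 / (p\<^sup>2 + q\<^sup>2)) * (p\<^sup>2 + q\<^sup>2)) *\<^sub>R w"
      unfolding w by (simp add: scaleR_add_right scaleR_add_left power2_eq_square distrib_left)
    also have "\<dots> = w" by (simp only: times_divide_eq_left mult_1 divide_self[OF S] scaleR_one)
    finally have *: "(1 / (p\<^sup>2 + q\<^sup>2)) *\<^sub>R (p *\<^sub>R x + q *\<^sub>R y) = w" .
    have "(1 / (p\<^sup>2 + q\<^sup>2)) *\<^sub>R (p *\<^sub>R x + q *\<^sub>R y) \<in> span {x, y}"
      by (intro span_scale span_add span_base) auto
    then show "{w} \<subseteq> span {x, y}" by (simp add: *)
  qed auto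
  then show ?thesis using real_eigenvector_block[OF B w0, where A=A and a="\<lambda>i. Re (\<alpha> i)", OF lin Aw pos] by simp
qed

text \<open>
  If \<open>A - c\<close> is injective on \<open>V\<close>, it is bijective on the invariant subspace \<open>W\<close>, so it remains
  injective on the quotient of \<open>V\<close> by \<open>W\<close>.
\<close>
lemma compressed_eigenvalue:
  assumes B: "lin_basis (B::'b::real_vector set)" and W: "subspace (W::'b set)" "W \<subseteq> V" and V: "subspace V"
    and A: "linear A" "\<And>w. w \<in> W \<Longrightarrow> A w \<in> W" "\<And>v. v \<in> V \<Longrightarrow> A v \<in> V"
    and P: "linear P" "\<And>v. v \<in> V \<Longrightarrow> P v \<in> V" "\<And>w. w \<in> W \<Longrightarrow> P w = 0"
      "\<And>v. v \<in> V \<Longrightarrow> v - P v \<in> W" "\<And>v. v \<in> V \<Longrightarrow> P (P v) = P v"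
    and eig: "complex_eigenvalue_on (P ` V) (P \<circ> A) c"
  shows "complex_eigenvalue_on V A c"
proof (rule ccontr)
  assume no: "\<not> complex_eigenvalue_on V A c"
  obtain B' :: "('b \<times> 'b) set" where B': "lin_basis B'" using lin_basis_prod[OF B] by blast
  define T where "T u = cmap A u - complexified_scale c u" for u
  have T: "linear T"
    unfolding T_def[abs_def] linear_iff
    by (auto simp: complexified_scale_def linear_add[OF A(1)] linear_cmul[OF A(1)] algebra_simps)
  have inj: "u = 0" if "u \<in> V \<times> V" "T u = 0" for u
  proof (rule ccontr)
    assume "u \<noteq> 0"
    moreover have "cmap A u = complexified_scale c u" using that(2) by (simp add: T_def)
    ultimately show False using no that(1) unfolding complex_eigenvalue_on_def by blast
  qed
  have TW: "T u \<in> W \<times> W" if "u \<in> W \<times> W" for u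
  proof -
    have "cx.subspace (W \<times> W)" by (rule csubspace_Times[OF W(1)])
    moreover have "cmap A u \<in> W \<times> W" using that A(2) by auto
    ultimately show ?thesis using that unfolding T_def
      by (intro cx.subspace_diff cx.subspace_scale)
  qed
  have "subspace (W \<times> W)" using W(1) by (rule subspace_Times[OF _ W(1)])
  then have surj: "T ` (W \<times> W) = W \<times> W"
    using injective_on_subspace_surj[OF B' _ T] TW inj W(2) by blast
  obtain u where u: "u \<in> P ` V \<times> P ` V" "u \<noteq> 0" and eu: "cmap (P \<circ> A) u = complexified_scale c u"
    using eig unfolding complex_eigenvalue_on_def by blast
  have uV: "u \<in> V \<times> V" using u P(2) by auto
  have Pu: "cmap P u = u" using u P(5) by auto
  have "cmap A u - cmap (P \<circ> A) u \<in> W \<times> W" using uV A(3) P(4) by auto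
  then have "T u \<in> W \<times> W" unfolding eu T_def .
  then obtain w where w: "w \<in> W \<times> W" "T w = T u" using surj by (metis imageE)
  have "u - w \<in> V \<times> V" using uV w(1) W(2) subspace_diff[OF subspace_Times[OF V V]] by blast
  moreover have "T (u - w) = 0" using w(2) T by (simp add: linear_diff)
  ultimately have "u = w" using inj by fastforce
  then have "cmap P u = 0" using w(1) P(3) by (auto simp: zero_prod_def)
  then show False using Pu u by simp
qed

text \<open>
  With respect to the splitting into \<open>W\<close> and \<open>C\<close>, the operator \<open>A\<close> is block triangular with
  off-diagonal block \<open>D\<close>. Scaling the inner product of \<open>C\<close> by \<open>s\<close> leaves only the diagonal
  blocks at leading order; the identity displays the remainder in the shape treated by
  \<open>perturbed_form_positive\<close>, apart from one nonnegative term.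
\<close>
lemma block_ricci_form:
  fixes A P :: "'b::real_vector \<Rightarrow> 'b" and s :: real
  assumes EW: "on_frame QW W EW" and EC: "on_frame QC C EC" and s: "0 < s"
    and P: "linear P" "\<forall>w\<in>W. P w = 0" "\<forall>v\<in>C. P v = v"
    and A: "linear A" "\<forall>w\<in>W. A w \<in> W"
    and Q: "Q = (\<lambda>x y. QW (x - P x) (y - P y) + s * QC (P x) (P y))"
    and E: "E = EW \<union> (\<lambda>c. (1 / sqrt s) *\<^sub>R c) ` EC"
    and D: "\<And>v. D v = A v - P (A v)"
  shows "on_frame Q (span (W \<union> C)) E"
    and "\<And>w c. w \<in> W \<Longrightarrow> c \<in> C \<Longrightarrow> ricci_form \<tau> A Q E (w + c) (w + c) =
      ricci_form \<tau> A QW EW w w + s * ricci_form \<tau> (P \<circ> A) QC EC c c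
      + (2 * \<tau> * QW (D c) w + 2 * QW (A w) (D c) - 2 * (\<Sum>e\<in>EC. QW (D e) w * QC (P (A e)) c))
      + QW (D c) (D c) - (\<Sum>e\<in>EC. QW (D e) w * QW (D e) w) / s"
proof -
  let ?f = "\<lambda>c. (1 / sqrt s) *\<^sub>R c :: 'b"
  note bW = on_frame_bilinear[OF EW] and bC = on_frame_bilinear[OF EC]
  note P_simps = linear_add[OF P(1)] linear_diff[OF P(1)] linear_cmul[OF P(1)] linear_0[OF P(1)]
  note A_simps = linear_add[OF A(1)] linear_diff[OF A(1)] linear_cmul[OF A(1)] linear_0[OF A(1)]
  have sb: "symmetric_bilinear Q"
  proof -
    have "Q x y = Q y x" for x y
      by (simp add: Q on_frame_sym[OF EW, of "x - P x"] on_frame_sym[OF EC, of "P x"])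
    moreover have "bilinear Q"
      by (simp add: bilinear_def linear_iff Q bilinear_simps[OF bW] bilinear_simps[OF bC] P_simps algebra_simps)
    ultimately show ?thesis by (simp add: symmetric_bilinear_def)
  qed
  have EWP: "P e = 0" "e \<in> W" if "e \<in> EW" for e using P(2) on_frame_mem[OF EW that] by auto
  have ECP: "P e = e" "e \<in> C" if "e \<in> EC" for e using P(3) on_frame_mem[OF EC that] by auto
  have s': "sqrt s * sqrt s = s" "sqrt s \<noteq> 0" using s by auto
  have inj: "inj_on ?f EC" using s by (auto simp: inj_on_def)
  have onEC: "Q (?f e) (?f f) = (if e = f then 1 else 0)" if "e \<in> EC" "f \<in> EC" for e f
    using that s s' on_frame_orth[OF EC that]
    by (simp add: Q P_simps ECP bilinear_simps[OF bW] bilinear_simps[OF bC])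
  have mixed: "Q e (?f f) = 0" "Q (?f f) e = 0" if "e \<in> EW" "f \<in> EC" for e f
    using that by (simp_all add: Q P_simps ECP EWP bilinear_simps[OF bW] bilinear_simps[OF bC])
  have onEW: "Q e f = (if e = f then 1 else 0)" if "e \<in> EW" "f \<in> EW" for e f
    using that on_frame_orth[OF EW that] by (simp add: Q EWP bilinear_simps[OF bC])
  have disj: "EW \<inter> ?f ` EC = {}"
  proof (rule ccontr)
    assume "EW \<inter> ?f ` EC \<noteq> {}"
    then obtain f where f: "f \<in> EC" "?f f \<in> EW" by blast
    then show False using mixed(1)[OF f(2,1)] onEC[OF f(1) f(1)] by simp
  qed
  have sp: "span E = span (W \<union> C)"
  proof (rule subset_antisym; rule span_minimal)
    show "E \<subseteq> span (W \<union> C)" using EWP(2) ECP(2) by (auto simp: E intro!: span_scale intro: span_base)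
    have "EC \<subseteq> span E"
    proof
      fix c assume "c \<in> EC"
      then have "sqrt s *\<^sub>R ?f c \<in> span E" unfolding E by (intro span_scale span_base) blast
      then show "c \<in> span E" using s' by simp
    qed
    then have "C \<subseteq> span E" using on_frame_span[OF EC] span_minimal by (metis subspace_span)
    moreover have "W \<subseteq> span E" using on_frame_span[OF EW] span_mono[of EW E] by (auto simp: E)
    ultimately show "W \<union> C \<subseteq> span E" by simp
  qed auto
  have fin: "finite EW" "finite EC" using on_frame_finite EW EC by auto
  show "on_frame Q (span (W \<union> C)) E"
    unfolding on_frame_def
  proof (intro conjI ballI)
    show "symmetric_bilinear Q" by (rule sb)
    show "finite E" using fin by (simp add: E)
    show "span E = span (W \<union> C)" by (rule sp)
    fix e f assume ef: "e \<in> E" "f \<in> E"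
    consider "e \<in> EW" "f \<in> EW" | f' where "e \<in> EW" "f' \<in> EC" "f = ?f f'"
      | e' where "e' \<in> EC" "e = ?f e'" "f \<in> EW" | e' f' where "e' \<in> EC" "e = ?f e'" "f' \<in> EC" "f = ?f f'"
      using ef unfolding E by blast
    then show "Q e f = (if e = f then 1 else 0)"
    proof cases
      case 1 then show ?thesis using onEW by simp
    next
      case 2 
      then have "e \<noteq> f" using disj by blast
      then show ?thesis using mixed 2 by simp
    next
      case 3
      then have "e \<noteq> f" using disj by blast
      then show ?thesis using mixed 3 by simp
    next
      case 4 
      then have "(e = f) = (e' = f')" using inj by (auto simp: inj_on_def)
      then show ?thesis using onEC 4 by simp
    qed
  qed
  fix w c assume w: "w \<in> W" and c: "c \<in> C"
  have Px: "P (w + c) = c" "w + c - P (w + c) = w" using w c P by (simp_all add: P_simps)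
  have PAx: "P (A (w + c)) = P (A c)" "A (w + c) - P (A c) = A w + D c"
    using w c A(2) P(2) by (simp_all add: A_simps P_simps D)
  have 1: "Q (A (w + c)) (w + c) = QW (A w) w + QW (D c) w + s * QC (P (A c)) c"
    unfolding Q Px PAx by (simp add: bilinear_simps[OF bW])
  have 2: "Q (A (w + c)) (A (w + c)) = QW (A w) (A w) + 2 * QW (A w) (D c) + QW (D c) (D c) + s * QC (P (A c)) (P (A c))"
    unfolding Q Px PAx by (simp add: bilinear_simps[OF bW] on_frame_sym[OF EW, of "D c" "A w"])
  have 3: "Q (A e) (w + c) = QW (A e) w" if "e \<in> EW" for e
  proof -
    have "P (A e) = 0" using P(2) A(2) EWP(2)[OF that] by blast
    then show ?thesis unfolding Q Px by (simp add: bilinear_simps[OF bC])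
  qed
  have 4: "Q (A (?f e)) (w + c) * Q (A (?f e)) (w + c)
     = QW (D e) w * QW (D e) w / s + 2 * (QW (D e) w * QC (P (A e)) c) + s * (QC (P (A e)) c * QC (P (A e)) c)" for e
  proof -
    have eq: "A (?f e) - ?f (P (A e)) = ?f (D e)" "P (A (?f e)) = ?f (P (A e))"
      by (simp_all add: A_simps P_simps D scaleR_diff_right)
    have "Q (A (?f e)) (w + c) = (1 / sqrt s) * (QW (D e) w + s * QC (P (A e)) c)"
      unfolding Q Px eq by (simp add: bilinear_simps[OF bW] bilinear_simps[OF bC] distrib_left)
    then have "Q (A (?f e)) (w + c) * Q (A (?f e)) (w + c)
      = (1 / (sqrt s * sqrt s)) * ((QW (D e) w + s * QC (P (A e)) c) * (QW (D e) w + s * QC (P (A e)) c))"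
      by simp
    also have "\<dots> = (1 / s) * ((QW (D e) w + s * QC (P (A e)) c) * (QW (D e) w + s * QC (P (A e)) c))"
      by (simp only: s'(1))
    finally show ?thesis using s by (simp add: field_simps)
  qed
  have "(\<Sum>e\<in>E. Q (A e) (w + c) * Q (A e) (w + c))
     = (\<Sum>e\<in>EW. QW (A e) w * QW (A e) w) + (\<Sum>e\<in>EC. Q (A (?f e)) (w + c) * Q (A (?f e)) (w + c))"
    unfolding E using fin disj by (subst sum.union_disjoint) (auto simp: sum.reindex[OF inj] 3)
  also have "(\<Sum>e\<in>EC. Q (A (?f e)) (w + c) * Q (A (?f e)) (w + c))
     = (\<Sum>e\<in>EC. QW (D e) w * QW (D e) w) / s + 2 * (\<Sum>e\<in>EC. QW (D e) w * QC (P (A e)) c)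
       + s * (\<Sum>e\<in>EC. QC (P (A e)) c * QC (P (A e)) c)"
    unfolding 4 by (simp add: sum.distrib sum_divide_distrib sum_distrib_left)
  finally show "ricci_form \<tau> A Q E (w + c) (w + c) =
      ricci_form \<tau> A QW EW w w + s * ricci_form \<tau> (P \<circ> A) QC EC c c
      + (2 * \<tau> * QW (D c) w + 2 * QW (A w) (D c) - 2 * (\<Sum>e\<in>EC. QW (D e) w * QC (P (A e)) c))
      + QW (D c) (D c) - (\<Sum>e\<in>EC. QW (D e) w * QW (D e) w) / s"
    unfolding ricci_form_def 1 2 by (simp add: algebra_simps)
qed

text \<open>
  Induction on the dimension. A common eigenvector spans, with its real and imaginary parts, an
  invariant subspace \<open>W\<close> of dimension one or two, on which a suitable inner product is explicit. A
  complement, standing for the quotient, carries one by induction; the two are combined with a large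
  weight on the complement. A skew operator is skew on both parts, hence zero on \<open>W\<close> and nilpotent
  on the quotient.
\<close>
lemma adapted_inner_product:
  fixes A :: "'i \<Rightarrow> 'b::real_vector \<Rightarrow> 'b"
  assumes B: "lin_basis (B::'b set)" and V: "subspace V" and \<tau>: "0 < \<tau>"
    and lin: "\<And>i. linear (A i)" and inv: "\<And>i v. v \<in> V \<Longrightarrow> A i v \<in> V"
    and comm: "\<And>i k v. v \<in> V \<Longrightarrow> A i (A k v) = A k (A i v)"
    and eig: "\<And>c. complex_eigenvalue_on V (A j) c \<Longrightarrow> 0 < Re c"
  shows "\<exists>Q E. on_frame Q V E \<and> (\<forall>x\<in>V. x \<noteq> 0 \<longrightarrow> 0 < ricci_form \<tau> (A j) Q E x x) \<and>
     (\<forall>i. (\<forall>x\<in>V. Q (A i x) x = 0) \<longrightarrow> (\<exists>k. \<forall>x\<in>V. (A i ^^ k) x = 0))"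
  using V lin inv comm eig
proof (induction "dim V" arbitrary: V A rule: less_induct)
  case (less V A)
  note V = less.prems(1) and lin = less.prems(2) and inv = less.prems(3) and comm = less.prems(4)
    and eig = less.prems(5)
  show ?case
  proof (cases "V = {0}")
    case True
    have "on_frame (\<lambda>_ _. 0) {0::'b} {}"
      by (simp add: on_frame_def symmetric_bilinear_def bilinear_def linear_zero)
    then show ?thesis using True by (intro exI[of _ "\<lambda>_ _. 0"] exI[of _ "{}"]) (auto intro: exI[of _ 0])
  next
    case False
    then obtain v0 where v0: "v0 \<in> V" "v0 \<noteq> 0" using subspace_0[OF V] by blast
    have VV: "cx.subspace (V \<times> V)" by (rule csubspace_Times[OF V])
    obtain u where u: "u \<in> V \<times> V" "u \<noteq> 0"
      and wt: "\<And>T. T \<in> range A \<Longrightarrow> \<exists>c. cmap T u = complexified_scale c u"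
    proof (rule common_eigenvector[OF B _ VV, of "range A" "(v0, v0)"])
      show "cmap T u \<in> V \<times> V" if "T \<in> range A" "u \<in> V \<times> V" for T u using that inv by auto
      show "cmap S (cmap T u) = cmap T (cmap S u)" if "S \<in> range A" "T \<in> range A" "u \<in> V \<times> V" for S T u
        using that comm by auto
    qed (use v0 lin in \<open>auto simp: zero_prod_def\<close>)
    have "\<forall>i. \<exists>c. cmap (A i) u = complexified_scale c u" using wt by blast
    then obtain \<alpha> where \<alpha>: "\<And>i. cmap (A i) u = complexified_scale (\<alpha> i) u" by metis
    have pos: "0 < Re (\<alpha> j)"
      using u \<alpha> by (intro eig) (auto simp only: complex_eigenvalue_on_def)
    obtain x y where xy: "u = (x, y)" by (cases u)
    define W where "W = span {x, y}"
    have W: "subspace W" "W \<subseteq> V" using u xy V by (auto simp: W_def span_minimal)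
    have AW: "A i w \<in> W" if "w \<in> W" for i w
    proof -
      have "A i x \<in> W" "A i y \<in> W" using \<alpha>[of i] xy
        by (auto simp: W_def complexified_scale_def intro!: span_add span_diff span_scale intro: span_base)
      then have "A i ` W \<subseteq> W"
        unfolding W_def linear_span_image[OF lin, symmetric]
        by (intro span_minimal) (auto simp: W_def)
      then show ?thesis using that by blast
    qed
    obtain QW EW where EW: "on_frame QW W EW" and posW: "\<And>x. x \<in> W \<Longrightarrow> x \<noteq> 0 \<Longrightarrow> 0 < ricci_form \<tau> (A j) QW EW x x"
      and skewW: "\<And>i w. (\<forall>x\<in>W. QW (A i x) x = 0) \<Longrightarrow> w \<in> W \<Longrightarrow> A i w = 0"
      using eigenvector_block[of B x y A \<alpha> j \<tau>] B u xy lin \<alpha> pos \<tau> unfolding W_def by metis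
    obtain P where P: "linear P" "\<And>v. v \<in> V \<Longrightarrow> P v \<in> V" "\<And>w. w \<in> W \<Longrightarrow> P w = 0"
      "\<And>v. v \<in> V \<Longrightarrow> v - P v \<in> W" "\<And>v. v \<in> V \<Longrightarrow> P (P v) = P v"
      using complementary_projection[OF B V W] by blast
    define C where "C = P ` V"
    have C: "subspace C" unfolding C_def by (rule linear_subspace_image[OF P(1) V])
    have CV: "C \<subseteq> V" and PC: "\<And>v. v \<in> C \<Longrightarrow> P v = v" using P(2,5) by (auto simp: C_def)
    have PAP: "P (A i (P v)) = P (A i v)" if "v \<in> V" for i v
      using P(3)[OF AW[OF P(4)[OF that]], of i] P(1) lin by (simp add: linear_diff)
    have "\<exists>w\<in>V. w \<noteq> 0 \<and> P w = 0"
      using u xy P(3) by (auto simp: W_def zero_prod_def intro: span_base)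
    then have dimC: "dim C < dim V" unfolding C_def using complement_dim_less[OF B V P(1,2,5)] by blast
    have "\<exists>Q E. on_frame Q C E \<and> (\<forall>x\<in>C. x \<noteq> 0 \<longrightarrow> 0 < ricci_form \<tau> (P \<circ> A j) Q E x x) \<and>
     (\<forall>i. (\<forall>x\<in>C. Q ((P \<circ> A i) x) x = 0) \<longrightarrow> (\<exists>k. \<forall>x\<in>C. ((P \<circ> A i) ^^ k) x = 0))"
    proof (rule less.hyps[OF dimC C])
      show "linear (P \<circ> A i)" for i using lin P(1) by (rule linear_compose)
      show "(P \<circ> A i) v \<in> C" if "v \<in> C" for i v using that CV inv by (auto simp: C_def)
      show "(P \<circ> A i) ((P \<circ> A k) v) = (P \<circ> A k) ((P \<circ> A i) v)" if "v \<in> C" for i k v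
        using that CV PAP inv comm by (auto simp: subset_iff)
      show "0 < Re c" if "complex_eigenvalue_on C (P \<circ> A j) c" for c
        by (rule eig, rule compressed_eigenvalue[OF B W V lin AW inv P]) (use that in \<open>simp_all add: C_def\<close>)
    qed
    then obtain QC EC where EC: "on_frame QC C EC"
      and posC: "\<And>x. x \<in> C \<Longrightarrow> x \<noteq> 0 \<Longrightarrow> 0 < ricci_form \<tau> (P \<circ> A j) QC EC x x"
      and skewC: "\<And>i. (\<forall>x\<in>C. QC ((P \<circ> A i) x) x = 0) \<Longrightarrow> (\<exists>k. \<forall>x\<in>C. ((P \<circ> A i) ^^ k) x = 0)"
      by blast
    define D where "D v = A j v - P (A j v)" for v
    have linD: "linear D"
      by (simp add: linear_iff D_def linear_add[OF lin] linear_cmul[OF lin] linear_add[OF P(1)] linear_cmul[OF P(1)]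
          scaleR_diff_right)
    note bW = on_frame_bilinear[OF EW] and bC = on_frame_bilinear[OF EC]
    have b: "bilinear (\<lambda>w c. 2 * \<tau> * QW (D c) w + 2 * QW (A j w) (D c) - 2 * (\<Sum>e\<in>EC. QW (D e) w * QC (P (A j e)) c))"
      by (simp add: bilinear_def linear_iff linear_add[OF linD] linear_cmul[OF linD] linear_add[OF lin]
          linear_cmul[OF lin] bilinear_simps[OF bW] bilinear_simps[OF bC] algebra_simps sum.distrib sum_distrib_left)
    have h: "bilinear (\<lambda>w w'. \<Sum>e\<in>EC. QW (D e) w * QW (D e) w')"
      by (simp add: bilinear_def linear_iff bilinear_simps[OF bW] algebra_simps sum.distrib sum_distrib_left)
    have sbW: "symmetric_bilinear (ricci_form \<tau> (A j) QW EW)"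
      using EW lin by (intro symmetric_bilinear_ricci_form) (auto simp: on_frame_def)
    have sbC: "symmetric_bilinear (ricci_form \<tau> (P \<circ> A j) QC EC)"
      using EC linear_compose[OF lin P(1)] by (intro symmetric_bilinear_ricci_form) (auto simp: on_frame_def)
    have "\<exists>s>0. \<forall>w\<in>W. \<forall>c\<in>C. w \<noteq> 0 \<or> c \<noteq> 0 \<longrightarrow>
       0 < ricci_form \<tau> (A j) QW EW w w + s * ricci_form \<tau> (P \<circ> A j) QC EC c c
         + (2 * \<tau> * QW (D c) w + 2 * QW (A j w) (D c) - 2 * (\<Sum>e\<in>EC. QW (D e) w * QC (P (A j e)) c))
         - (\<Sum>e\<in>EC. QW (D e) w * QW (D e) w) / s"
      by (rule perturbed_form_positive[OF B W(1) C sbW posW sbC posC b h])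
    then obtain s where s: "0 < s" and spos: "\<forall>w\<in>W. \<forall>c\<in>C. w \<noteq> 0 \<or> c \<noteq> 0 \<longrightarrow>
       0 < ricci_form \<tau> (A j) QW EW w w + s * ricci_form \<tau> (P \<circ> A j) QC EC c c
         + (2 * \<tau> * QW (D c) w + 2 * QW (A j w) (D c) - 2 * (\<Sum>e\<in>EC. QW (D e) w * QC (P (A j e)) c))
         - (\<Sum>e\<in>EC. QW (D e) w * QW (D e) w) / s"
      by (elim exE conjE)
    define Q where "Q = (\<lambda>x y. QW (x - P x) (y - P y) + s * QC (P x) (P y))"
    define E where "E = EW \<union> (\<lambda>c. (1 / sqrt s) *\<^sub>R c) ` EC"
    have "\<forall>w\<in>W. P w = 0" "\<forall>v\<in>C. P v = v" "\<forall>w\<in>W. A j w \<in> W" using P(3) PC AW by blast+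
    note blk = block_ricci_form[OF EW EC s P(1) this(1,2) lin this(3) Q_def E_def D_def]
    have spV: "span (W \<union> C) = V"
    proof (rule subset_antisym)
      show "span (W \<union> C) \<subseteq> V" using W CV V by (intro span_minimal) auto
      show "V \<subseteq> span (W \<union> C)"
      proof
        fix v assume v: "v \<in> V"
        have "(v - P v) + P v \<in> span (W \<union> C)"
          using v P(4) by (intro span_add) (auto simp: C_def intro: span_base)
        then show "v \<in> span (W \<union> C)" by simp
      qed
    qed
    show ?thesis
    proof (intro exI[of _ Q] exI[of _ E] conjI ballI allI impI)
      show "on_frame Q V E" using blk(1) spV by simp
      fix v assume v: "v \<in> V" "v \<noteq> 0"
      have wc: "v - P v \<in> W" "P v \<in> C" "v - P v \<noteq> 0 \<or> P v \<noteq> 0" using v P(4) by (auto simp: C_def)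
      have "0 \<le> QW (D (P v)) (D (P v))"
        using wc(2) CV inv P(4) by (intro on_frame_nonneg[OF EW]) (auto simp: D_def)
      then show "0 < ricci_form \<tau> (A j) Q E v v" using blk(2)[OF wc(1,2), of \<tau>] spos[rule_format, OF wc] by simp
    next
      fix i assume skew: "\<forall>x\<in>V. Q (A i x) x = 0"
      have "QW (A i w) w = 0" if "w \<in> W" for w
        using skew[rule_format, of w] that W(2) P(3) AW by (auto simp: Q_def bilinear_simps[OF bC])
      then have W0: "\<And>w. w \<in> W \<Longrightarrow> A i w = 0" using skewW by blast
      have "QC ((P \<circ> A i) c) c = 0" if "c \<in> C" for c
        using skew[rule_format, of c] that CV PC s by (auto simp: Q_def bilinear_simps[OF bW])
      then obtain k where k: "\<forall>x\<in>C. ((P \<circ> A i) ^^ k) x = 0" using skewC by blast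
      have pow: "(A i ^^ n) v \<in> V \<and> P ((A i ^^ n) v) = ((P \<circ> A i) ^^ n) (P v)" if "v \<in> V" for n v
      proof (induction n)
        case (Suc n)
        then show ?case using inv PAP[of "(A i ^^ n) v" i] by simp
      qed (use that in simp)
      have "(A i ^^ Suc k) v = 0" if "v \<in> V" for v
      proof -
        have "P ((A i ^^ k) v) = 0" using pow[OF that, of k] k that by (simp add: C_def)
        then have "(A i ^^ k) v \<in> W" using P(4)[of "(A i ^^ k) v"] pow[OF that, of k] by simp
        then show ?thesis using W0 by simp
      qed
      then show "\<exists>k. \<forall>x\<in>V. (A i ^^ k) x = 0" by blast
    qed
  qed
qed

section \<open>Negative Ricci curvature forces positive real parts\<close>

text \<open>
  For the eigenvalue \<open>a + \<i> b\<close> of \<open>x + \<i> y\<close>, the vectors \<open>u\<close> and \<open>v\<close> in the proof are the real and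
  imaginary parts of its conjugate times \<open>x + \<i> y\<close>, which is what the adjoint would give for a normal
  operator. The deviation of the adjoint from this has a nonnegative square norm, and expanding it
  yields the claim.
\<close>
lemma eigenvector_adjoint_inequality:
  assumes E: "on_frame Q V E" and A: "linear A" 
    and xy: "x \<in> V" "y \<in> V" "A x = a *\<^sub>R x - b *\<^sub>R y" "A y = b *\<^sub>R x + a *\<^sub>R y"
  shows "Q (A x) (A x) + Q (A y) (A y) \<le> (\<Sum>e\<in>E. (Q (A e) x)\<^sup>2) + (\<Sum>e\<in>E. (Q (A e) y)\<^sup>2)"
proof -
  note bl = on_frame_bilinear[OF E]
  have V: "subspace V" by (rule on_frame_subspace[OF E])
  have b': "bilinear (\<lambda>z w. Q (A w) z)"
    by (simp add: bilinear_def linear_iff linear_add[OF A] linear_cmul[OF A] bilinear_simps[OF bl])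
  have cross: "(\<Sum>e\<in>E. Q (A e) z * Q e u) = Q (A u) z" if "u \<in> V" for z u
    using on_frame_inner[OF E b' that] .
  define u where "u = a *\<^sub>R x + b *\<^sub>R y"
  define v where "v = a *\<^sub>R y - b *\<^sub>R x"
  have uv: "u \<in> V" "v \<in> V" using xy V by (auto simp: u_def v_def subspace_add subspace_diff subspace_scale)
  have expand: "(\<Sum>e\<in>E. (Q (A e) z - Q e w)\<^sup>2) = (\<Sum>e\<in>E. (Q (A e) z)\<^sup>2) - 2 * Q (A w) z + Q w w"
    if "w \<in> V" for z w
    unfolding cross[OF that, symmetric] on_frame_norm[OF E that]
    by (simp add: power2_diff sum.distrib sum_subtractf sum_distrib_left mult.assoc)
  have "0 \<le> (\<Sum>e\<in>E. (Q (A e) x - Q e u)\<^sup>2) + (\<Sum>e\<in>E. (Q (A e) y - Q e v)\<^sup>2)"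
    by (intro add_nonneg_nonneg sum_nonneg) auto
  moreover have "A u = (a\<^sup>2 + b\<^sup>2) *\<^sub>R x" "A v = (a\<^sup>2 + b\<^sup>2) *\<^sub>R y"
    by (simp_all add: u_def v_def linear_add[OF A] linear_diff[OF A] linear_cmul[OF A] xy
        algebra_simps power2_eq_square)
  moreover have "Q u u + Q v v = (a\<^sup>2 + b\<^sup>2) * (Q x x + Q y y)"
    by (simp add: u_def v_def bilinear_simps[OF bl] algebra_simps power2_eq_square)
  moreover have "Q (A x) (A x) + Q (A y) (A y) = (a\<^sup>2 + b\<^sup>2) * (Q x x + Q y y)"
    by (simp add: xy bilinear_simps[OF bl] algebra_simps power2_eq_square)
  ultimately show ?thesis
    unfolding expand[OF uv(1)] expand[OF uv(2)] by (simp add: bilinear_simps[OF bl] algebra_simps)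
qed

text \<open>
  On the nilradical the Killing form vanishes. In the double sum of the Ricci curvature the pairs
  with one index in \<open>E\<close> occur twice, and the pairs outside \<open>E\<close> contribute nonnegative terms, which
  are dropped.
\<close>
lemma ricci_nilradical_lower_bound:
  assumes L: "finite_dim_lie_algebra br" and sol: "lie_solvable br"
    and N: "lie_nilradical br N" and ab: "lie_abelian_on br N"
    and ip: "is_inner_product ip" and G: "on_frame ip UNIV G" and E: "on_frame ip N E" "E \<subseteq> G" and X: "X \<in> N"
  shows "- ip (br (mean_curvature_vector br ip) X) X
     + 1/2 * (\<Sum>g\<in>G. (\<Sum>e\<in>E. (ip (br g e) X)\<^sup>2) - ip (br g X) (br g X)) \<le> ricci br ip X"
proof -
  note bl = lie_bilinear[OF L] and bip = on_frame_bilinear[OF E(1)]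
  have der: "br x y \<in> N" for x y by (rule derived_in_abelian_nilradical[OF L sol N ab])
  have fin: "finite G" by (rule on_frame_finite[OF G])
  have on: "orthonormal_basis ip G"
    using on_frame_independent[OF G] fin on_frame_span[OF G] on_frame_orth[OF G]
    by (auto simp: orthonormal_basis_def lin_basis_def)
  have "(br X \<circ> br X) = (\<lambda>_. 0)"
    using ab X der by (auto simp: lie_abelian_on_def)
  then have K: "killing_form br X X = 0"
    using lin_trace_eq[of "\<lambda>_. 0" G] on
    by (simp add: killing_form_def orthonormal_basis_def linear_zero real_vector.representation_zero)
  have anti: "ip (br X g) (br X g) = ip (br g X) (br g X)" for g
    using lie_antisym[OF L, of X g] by (simp add: bilinear_simps[OF bip])
  let ?q = "\<lambda>g e. (ip (br g e) X)\<^sup>2"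
  have q_sym: "?q g e = ?q e g" for g e
    using lie_antisym[OF L, of g e] by (simp add: bilinear_simps[OF bip])
  have q0: "?q g e = 0" if "g \<in> E" "e \<in> E" for g e
    using ab on_frame_mem[OF E(1)] that by (simp add: lie_abelian_on_def bilinear_simps[OF bip])
  have split: "(\<Sum>g\<in>G. h g) = (\<Sum>g\<in>E. h g) + (\<Sum>g\<in>G - E. h g)" for h :: "'a \<Rightarrow> real"
    using fin E(2) by (simp add: sum.subset_diff)
  have "(\<Sum>g\<in>G. \<Sum>e\<in>E. ?q g e) = (\<Sum>g\<in>G - E. \<Sum>e\<in>E. ?q g e)"
    by (simp add: split q0)
  also have "\<dots> = (\<Sum>g\<in>E. \<Sum>e\<in>G - E. ?q g e)"
    by (subst sum.swap) (simp add: q_sym)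
  also have "\<dots> \<le> (\<Sum>g\<in>G. \<Sum>e\<in>G - E. ?q g e)"
    using fin E(2) by (intro sum_mono2) (auto intro: sum_nonneg)
  also have "\<dots> = (\<Sum>g\<in>G. \<Sum>e\<in>G. ?q g e) - (\<Sum>g\<in>G. \<Sum>e\<in>E. ?q g e)"
    unfolding split[of "\<lambda>e. ?q _ e"] by (simp add: sum.distrib)
  finally have "2 * (\<Sum>g\<in>G. \<Sum>e\<in>E. ?q g e) \<le> (\<Sum>g\<in>G. \<Sum>e\<in>G. ?q g e)" by simp
  then show ?thesis
    unfolding ricci_eq[OF bl ip on] ricci_wrt_def K anti by (simp add: sum_subtractf right_diff_distrib)
qed

lemma negative_ricci_imp_positive_eigenvalues:
  assumes L: "finite_dim_lie_algebra br" and sol: "lie_solvable br"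
    and N: "lie_nilradical br N" and ab: "lie_abelian_on br N"
    and ip: "is_inner_product ip" and neg: "negative_ricci br ip"
    and c: "complex_eigenvalue_on N (br (mean_curvature_vector br ip)) c"
  shows "0 < Re c"
proof -
  let ?H = "mean_curvature_vector br ip"
  obtain B :: "'a set" where B: "lin_basis B" using lie_lin_basis[OF L] .
  have Ns: "subspace N" and Ninv: "\<And>x y. y \<in> N \<Longrightarrow> br x y \<in> N"
    using N by (auto simp: lie_nilradical_def lie_ideal_def)
  have sb: "symmetric_bilinear ip" and pos: "\<And>x. x \<noteq> 0 \<Longrightarrow> 0 < ip x x"
    using ip by (auto simp: is_inner_product_def symmetric_bilinear_def)
  note lin = lie_ad_linear(1)[OF L]
  have der: "br x y \<in> N" for x y by (rule derived_in_abelian_nilradical[OF L sol N ab])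
  obtain E where E: "on_frame ip N E" using on_frame_exists[OF B sb Ns pos] .
  have finB: "finite B" using B by (simp add: lin_basis_def)
  have "\<exists>G. on_frame ip (span (N \<union> B)) G \<and> E \<subseteq> G"
  proof (rule on_frame_extend[OF sb subspace_UNIV _ E subset_UNIV finB subset_UNIV])
    show "0 < ip x x" if "x \<noteq> 0" for x using pos that .
    show ?thesis if "on_frame ip (span (N \<union> B)) F" "E \<subseteq> F" for F using that by blast
  qed
  then obtain G where "on_frame ip (span (N \<union> B)) G" and EG: "E \<subseteq> G" by blast
  moreover have "span (N \<union> B) = UNIV" using B span_mono[of B "N \<union> B"] by (auto simp: lin_basis_def)
  ultimately have G: "on_frame ip UNIV G" by simp
  \<comment> \<open>all operators commute with that of \<open>H\<close>, so they preserve its eigenspace for \<open>c\<close>\<close>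
  define U where "U = {u \<in> N \<times> N. cmap (br ?H) u = complexified_scale c u}"
  have comm: "br x (br y v) = br y (br x v)" if "v \<in> N" for x y v
    using lie_jacobi[OF L, of x y v] ab der[of x y] that by (simp add: lie_abelian_on_def)
  have csub: "cx.subspace U"
    using csubspace_Times[OF Ns] unfolding U_def cx.subspace_def
    by (auto simp del: map_prod_simp simp: cmap_0[OF lin] cmap_add[OF lin] cmap_scale[OF lin] cx.scale_right_distrib mult.commute)
  obtain v where v: "v \<in> U" "v \<noteq> 0" using c unfolding complex_eigenvalue_on_def U_def by blast
  have NN: "cmap (br x) u \<in> N \<times> N" if "u \<in> N \<times> N" for x u using that Ninv by auto
  have commNN: "cmap (br x) (cmap (br y) u) = cmap (br y) (cmap (br x) u)" if "u \<in> N \<times> N" for x y u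
    using that comm by auto
  obtain u where u: "u \<in> U" "u \<noteq> 0"
    and wt: "\<And>T. T \<in> range br \<Longrightarrow> \<exists>c. cmap T u = complexified_scale c u"
  proof (rule common_eigenvector[OF B _ csub _ _ v, of "range br"])
    fix T u assume "T \<in> range br" "u \<in> U"
    then obtain x where x: "T = br x" and u: "u \<in> N \<times> N" "cmap (br ?H) u = complexified_scale c u"
      unfolding U_def by blast
    have "cmap (br ?H) (cmap (br x) u) = complexified_scale c (cmap (br x) u)"
      unfolding commNN[OF u(1), of ?H x] u(2) by (rule cmap_scale[OF lin])
    then show "cmap T u \<in> U" unfolding U_def x using NN[OF u(1)] by blast
  next
    fix S T u assume "S \<in> range br" "T \<in> range br" "u \<in> U"
    then show "cmap S (cmap T u) = cmap T (cmap S u)" using commNN unfolding U_def by blast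
  qed (use lin in auto)
  have "\<forall>x. \<exists>c. cmap (br x) u = complexified_scale c u" using wt by blast
  then obtain \<alpha> where \<alpha>: "\<And>x. cmap (br x) u = complexified_scale (\<alpha> x) u" by metis
  obtain x y where xy: "u = (x, y)" by (cases u)
  have xyN: "x \<in> N" "y \<in> N" and H: "br ?H x = Re c *\<^sub>R x - Im c *\<^sub>R y" "br ?H y = Im c *\<^sub>R x + Re c *\<^sub>R y"
    using u(1) xy by (auto simp: U_def complexified_scale_def)
  define l where "l X = - ip (br ?H X) X
     + 1/2 * (\<Sum>g\<in>G. (\<Sum>e\<in>E. (ip (br g e) X)\<^sup>2) - ip (br g X) (br g X))" for X
  note bip = on_frame_bilinear[OF E] and bl = lie_bilinear[OF L]
  have l: "l X < 0" if "X \<in> N" "X \<noteq> 0" for X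
    using ricci_nilradical_lower_bound[OF L sol N ab ip G E EG that(1)] neg that(2)
    unfolding l_def negative_ricci_def by (meson le_less_trans)
  have l0: "l 0 = 0" by (simp add: l_def bilinear_simps[OF bip] bilinear_simps[OF bl])
  have "x \<noteq> 0 \<or> y \<noteq> 0" using u xy by (auto simp: zero_prod_def)
  then have "l x + l y < 0" using l[of x] l[of y] l0 xyN by (cases "x = 0"; cases "y = 0") auto
  moreover have "0 \<le> (\<Sum>g\<in>G. (\<Sum>e\<in>E. (ip (br g e) x)\<^sup>2) - ip (br g x) (br g x))
      + (\<Sum>g\<in>G. (\<Sum>e\<in>E. (ip (br g e) y)\<^sup>2) - ip (br g y) (br g y))"
    unfolding sum.distrib[symmetric]
  proof (rule sum_nonneg)
    fix g
    have "br g x = Re (\<alpha> g) *\<^sub>R x - Im (\<alpha> g) *\<^sub>R y" "br g y = Im (\<alpha> g) *\<^sub>R x + Re (\<alpha> g) *\<^sub>R y"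
      using \<alpha>[of g] xy by (auto simp: complexified_scale_def)
    from eigenvector_adjoint_inequality[OF E lin xyN this]
    show "0 \<le> (\<Sum>e\<in>E. (ip (br g e) x)\<^sup>2) - ip (br g x) (br g x)
      + ((\<Sum>e\<in>E. (ip (br g e) y)\<^sup>2) - ip (br g y) (br g y))" by simp
  qed
  ultimately have "0 < ip (br ?H x) x + ip (br ?H y) y" unfolding l_def by linarith
  also have "\<dots> = Re c * (ip x x + ip y y)"
    unfolding H by (simp add: bilinear_simps[OF bip] algebra_simps on_frame_sym[OF E, of y x])
  finally show ?thesis
    using on_frame_nonneg[OF E xyN(1)] on_frame_nonneg[OF E xyN(2)]
    by (simp add: zero_less_mult_iff)
qed

section \<open>Ricci curvature of a rescaled metric\<close>

text \<open>The left-hand side is the trace of \<open>T\<^sup>2 + T\<^sup>* T\<close>, half the squared norm of \<open>T + T\<^sup>*\<close>.\<close>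
lemma symmetric_part_norm:
  assumes E: "on_frame Q V E" and T: "linear T" "\<And>x. x \<in> V \<Longrightarrow> T x \<in> V"
  shows "(\<Sum>e\<in>E. Q (T (T e)) e + Q (T e) (T e)) = 1/2 * (\<Sum>e\<in>E. \<Sum>f\<in>E. (Q (T e) f + Q (T f) e)\<^sup>2)"
    and "(\<Sum>e\<in>E. Q (T (T e)) e + Q (T e) (T e)) = 0 \<Longrightarrow> x \<in> V \<Longrightarrow> Q (T x) x = 0"
proof -
  note bl = on_frame_bilinear[OF E]
  let ?m = "\<lambda>e f. Q (T e) f"
  have b': "bilinear (\<lambda>z w. Q (T w) z)"
    by (simp add: bilinear_def linear_iff linear_add[OF T(1)] linear_cmul[OF T(1)] bilinear_simps[OF bl])
  have TE: "T e \<in> V" if "e \<in> E" for e using T(2) on_frame_mem[OF E that] .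
  have 1: "Q (T (T e)) e = (\<Sum>f\<in>E. ?m f e * ?m e f)" if "e \<in> E" for e
    using on_frame_inner[OF E b' TE[OF that], of e] by (simp add: on_frame_sym[OF E])
  have 2: "Q (T e) (T e) = (\<Sum>f\<in>E. (?m e f)\<^sup>2)" if "e \<in> E" for e
    using on_frame_norm[OF E TE[OF that]] by (simp add: on_frame_sym[OF E])
  have "(\<Sum>e\<in>E. \<Sum>f\<in>E. (?m f e)\<^sup>2) = (\<Sum>e\<in>E. \<Sum>f\<in>E. (?m e f)\<^sup>2)" by (rule sum.swap)
  then have "(\<Sum>e\<in>E. \<Sum>f\<in>E. (?m e f + ?m f e)\<^sup>2)
    = 2 * (\<Sum>e\<in>E. \<Sum>f\<in>E. ?m f e * ?m e f) + 2 * (\<Sum>e\<in>E. \<Sum>f\<in>E. (?m e f)\<^sup>2)"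
    by (simp add: power2_sum sum.distrib sum_distrib_left mult_ac)
  then show *: "(\<Sum>e\<in>E. Q (T (T e)) e + Q (T e) (T e)) = 1/2 * (\<Sum>e\<in>E. \<Sum>f\<in>E. (?m e f + ?m f e)\<^sup>2)"
    by (simp add: 1 2 sum.distrib)
  assume 0: "(\<Sum>e\<in>E. Q (T (T e)) e + Q (T e) (T e)) = 0" and x: "x \<in> V"
  have fin: "finite E" by (rule on_frame_finite[OF E])
  have "(\<Sum>e\<in>E. \<Sum>f\<in>E. (?m e f + ?m f e)\<^sup>2) = 0" using * 0 by simp
  then have skew: "?m e f = - ?m f e" if "e \<in> E" "f \<in> E" for e f
    using that fin by (simp add: sum_nonneg_eq_0_iff sum_nonneg eq_neg_iff_add_eq_0)
  let ?c = "\<lambda>e. Q e x"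
  have "Q (T x) x = Q (T (\<Sum>e\<in>E. ?c e *\<^sub>R e)) (\<Sum>e\<in>E. ?c e *\<^sub>R e)"
    by (simp add: on_frame_expand[OF E x])
  also have "\<dots> = (\<Sum>e\<in>E. \<Sum>f\<in>E. ?c e * ?c f * ?m e f)"
    unfolding linear_sum[OF T(1)] linear_cmul[OF T(1)] bilinear_sum_left[OF bl] bilinear_sum_right[OF bl]
      bilinear_lmul[OF bl] bilinear_rmul[OF bl]
    by (subst sum.swap) (simp add: sum_distrib_left mult_ac)
  finally have q: "Q (T x) x = (\<Sum>e\<in>E. \<Sum>f\<in>E. ?c e * ?c f * ?m e f)" .
  have "?c e * ?c f * ?m e f = - (?c f * ?c e * ?m f e)" if "e \<in> E" "f \<in> E" for e f
    by (subst skew[OF that]) simp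
  then have "(\<Sum>e\<in>E. \<Sum>f\<in>E. ?c e * ?c f * ?m e f) = (\<Sum>e\<in>E. \<Sum>f\<in>E. - (?c f * ?c e * ?m f e))"
    by (intro sum.cong refl)
  also have "\<dots> = - (\<Sum>e\<in>E. \<Sum>f\<in>E. ?c e * ?c f * ?m e f)"
    by (subst sum.swap) (simp only: sum_negf)
  finally show "Q (T x) x = 0" using q by simp
qed

text \<open>
  Rescaling a basis to unit length turns the weights into denominators, so the Ricci curvature of
  a whole family of metrics can be read off from one fixed basis.
\<close>
lemma weighted_inner_product:
  fixes wt :: "'a::real_vector \<Rightarrow> real"
  assumes br: "bilinear br" and G: "lin_basis G" and wt: "\<And>b. b \<in> G \<Longrightarrow> 0 < wt b"
    and ip: "\<And>x y. ip x y = (\<Sum>b\<in>G. wt b * representation G x b * representation G y b)"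
  shows "is_inner_product ip"
    and "ricci br ip X = - ip (br (\<Sum>b\<in>G. (lin_trace (br b) / wt b) *\<^sub>R b) X) X - 1/2 * killing_form br X X
      - 1/2 * (\<Sum>b\<in>G. ip (br X b) (br X b) / wt b)
      + 1/4 * (\<Sum>b\<in>G. \<Sum>c\<in>G. (ip (br b c) X)\<^sup>2 / (wt b * wt c))"
proof -
  have fin: "finite G" and ind: "independent G" and sp: "span G = UNIV"
    using G by (auto simp: lin_basis_def)
  have rep: "representation G (x + y) b = representation G x b + representation G y b"
    "representation G (c *\<^sub>R x) b = c * representation G x b" for x y b c
    using ind sp by (simp_all add: real_vector.representation_add real_vector.representation_scale)
  have repb: "representation G b c = (if c = b then 1 else 0)" if "b \<in> G" for b c
    using that by (simp add: real_vector.representation_basis[OF ind])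
  have expand: "(\<Sum>b\<in>G. representation G x b *\<^sub>R b) = x" for x
    by (rule real_vector.sum_representation_eq) (use fin ind sp in auto)
  have bip: "bilinear ip"
    by (simp add: bilinear_def linear_iff ip rep algebra_simps sum.distrib sum_distrib_left)
  have sym: "ip x y = ip y x" for x y unfolding ip by (intro sum.cong refl) simp
  have pos: "0 < ip x x" if "x \<noteq> 0" for x
  proof -
    have "\<exists>b\<in>G. representation G x b \<noteq> 0"
    proof (rule ccontr)
      assume "\<not> ?thesis"
      then have "(\<Sum>b\<in>G. representation G x b *\<^sub>R b) = 0" by (intro sum.neutral) simp
      then show False using expand that by simp
    qed
    then obtain b where b: "b \<in> G" "representation G x b \<noteq> 0" by blast
    have "0 < wt b * (representation G x b)\<^sup>2" using wt b by simp
    also have "\<dots> \<le> (\<Sum>b\<in>G. wt b * (representation G x b)\<^sup>2)"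
      by (rule member_le_sum) (use b fin wt in \<open>auto intro!: mult_nonneg_nonneg dest: less_imp_le\<close>)
    finally show ?thesis by (simp add: ip power2_eq_square mult.assoc)
  qed
  show isip: "is_inner_product ip" using bip sym pos by (simp add: is_inner_product_def)
  let ?f = "\<lambda>b. (1 / sqrt (wt b)) *\<^sub>R b"
  have ipb: "ip b x = wt b * representation G x b" if "b \<in> G" for b x
  proof -
    have "ip b x = (\<Sum>c\<in>G. if c = b then wt c * representation G x c else 0)"
      unfolding ip by (intro sum.cong refl) (use repb[OF that] in auto)
    then show ?thesis using that fin by simp
  qed
  have on: "ip (?f b) (?f c) = (if b = c then 1 else 0)" if "b \<in> G" "c \<in> G" for b c
  proof -
    have "sqrt (wt b) * sqrt (wt b) = wt b" "0 < wt b" using wt[OF that(1)] by simp_all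
    then show ?thesis
      using that repb[OF that(2), of b] by (auto simp: bilinear_simps[OF bip] ipb)
  qed
  have inj: "inj_on ?f G"
  proof (rule inj_onI)
    fix b c assume bc: "b \<in> G" "c \<in> G" "?f b = ?f c"
    have "ip (?f b) (?f c) = 1" unfolding bc(3)[symmetric] using on[OF bc(1,1)] by simp
    then show "b = c" using on[OF bc(1,2)] by (simp split: if_splits)
  qed
  have "on_frame ip UNIV (?f ` G)"
    unfolding on_frame_def
  proof (intro conjI ballI)
    show "symmetric_bilinear ip" using bip sym by (simp add: symmetric_bilinear_def)
    show "finite (?f ` G)" using fin by simp
    have "G \<subseteq> span (?f ` G)"
    proof
      fix b assume b: "b \<in> G"
      then have "sqrt (wt b) *\<^sub>R ?f b \<in> span (?f ` G)" by (intro span_scale span_base) blast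
      then show "b \<in> span (?f ` G)" using wt[OF b] by simp
    qed
    then have "span G \<subseteq> span (?f ` G)" by (rule span_minimal) (rule subspace_span)
    then show "span (?f ` G) = UNIV" using sp by auto
    fix e f assume "e \<in> ?f ` G" "f \<in> ?f ` G"
    then obtain b c where bc: "b \<in> G" "c \<in> G" "e = ?f b" "f = ?f c" by blast
    have "(e = f) = (b = c)" using inj bc by (auto simp: inj_on_def)
    then show "ip e f = (if e = f then 1 else 0)" using on[OF bc(1,2)] bc by simp
  qed
  from on_frame_independent[OF this] on_frame_finite[OF this] on_frame_span[OF this] on_frame_orth[OF this]
  have onb: "orthonormal_basis ip (?f ` G)" by (simp add: orthonormal_basis_def lin_basis_def)
  define H where "H = (\<Sum>b\<in>G. (lin_trace (br b) / wt b) *\<^sub>R b)"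
  have linbr: "linear (br x)" for x using br by (simp add: bilinear_def)
  have tr: "lin_trace (br x) = (\<Sum>b\<in>G. representation G (br x b) b)" for x
    by (rule lin_trace_eq[OF linbr G])
  have lintr: "linear (\<lambda>x. lin_trace (br x))"
    by (simp add: linear_iff tr bilinear_simps[OF br] rep sum.distrib sum_distrib_left)
  have HX: "ip H X = lin_trace (br X)" for X
  proof -
    have "ip H X = (\<Sum>b\<in>G. lin_trace (br b) / wt b * ip b X)"
      by (simp add: H_def bilinear_sum_left[OF bip] bilinear_lmul[OF bip])
    also have "\<dots> = (\<Sum>b\<in>G. representation G X b * lin_trace (br b))"
      by (intro sum.cong refl) (use wt in \<open>simp add: ipb\<close>, metis less_irrefl)
    also have "\<dots> = lin_trace (br (\<Sum>b\<in>G. representation G X b *\<^sub>R b))"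
      using linear_sum[OF lintr, of "\<lambda>b. representation G X b *\<^sub>R b" G] linear_cmul[OF lintr] by simp
    finally show ?thesis by (simp add: expand)
  qed
  have "mean_curvature_vector br ip = H"
    unfolding mean_curvature_vector_def
  proof (rule the_equality)
    show "\<forall>X. ip H X = lin_trace (br X)" using HX by blast
    fix H' assume H': "\<forall>X. ip H' X = lin_trace (br X)"
    then have "ip (H' - H) (H' - H) = 0" using HX by (simp add: bilinear_lsub[OF bip])
    then show "H' = H" using pos[of "H' - H"] by force
  qed
  then have "ricci br ip X = - ip (br H X) X - 1/2 * killing_form br X X
     - 1/2 * (\<Sum>b\<in>G. ip (br X (?f b)) (br X (?f b)))
     + 1/4 * (\<Sum>b\<in>G. \<Sum>c\<in>G. (ip (br (?f b) (?f c)) X)\<^sup>2)"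
    unfolding ricci_eq[OF br isip onb] ricci_wrt_def by (simp add: sum.reindex[OF inj])
  moreover have "ip (br X (?f b)) (br X (?f b)) = ip (br X b) (br X b) / wt b" if "b \<in> G" for b
    using wt[OF that] by (simp add: bilinear_simps[OF br] bilinear_simps[OF bip])
  moreover have "(ip (br (?f b) (?f c)) X)\<^sup>2 = (ip (br b c) X)\<^sup>2 / (wt b * wt c)" if "b \<in> G" "c \<in> G" for b c
    using wt that by (simp add: bilinear_simps[OF br] bilinear_simps[OF bip] power_divide power_mult_distrib less_imp_le)
  ultimately show "ricci br ip X = - ip (br (\<Sum>b\<in>G. (lin_trace (br b) / wt b) *\<^sub>R b) X) X - 1/2 * killing_form br X X
      - 1/2 * (\<Sum>b\<in>G. ip (br X b) (br X b) / wt b)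
      + 1/4 * (\<Sum>b\<in>G. \<Sum>c\<in>G. (ip (br b c) X)\<^sup>2 / (wt b * wt c))"
    by (simp add: H_def cong: sum.cong)
qed

text \<open>
  The metric has weight \<open>r\<close> on a frame \<open>E\<close> of \<open>N\<close>, weight \<open>1\<close> on \<open>Y\<close>, and weight \<open>s\<close> on \<open>F\<close>. For
  \<open>X = U + Z\<close> with \<open>U\<close> in \<open>N\<close> and \<open>Z\<close> in the complement \<open>C\<close>, doubling and negating the Ricci form
  gives \<open>r (fs U + g Z / r + b(U, Z) - r h(U))\<close> up to nonnegative terms. First \<open>s\<close> is taken so large
  that \<open>fs\<close> is positive on \<open>N\<close>, then \<open>r\<close> so small that the whole is positive.
\<close>
lemma positive_eigenvalues_imp_negative_ricci:
  fixes br :: "'a::real_vector \<Rightarrow> 'a \<Rightarrow> 'a"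
  assumes L: "finite_dim_lie_algebra br" and sol: "lie_solvable br"
    and N: "lie_nilradical br N" and ab: "lie_abelian_on br N" and nz: "N \<noteq> {0}"
    and Y: "\<And>c. complex_eigenvalue_on N (br Y) c \<Longrightarrow> 0 < Re c"
  shows "\<exists>ip. is_inner_product ip \<and> negative_ricci br ip"
proof -
  obtain B :: "'a set" where B: "lin_basis B" using lie_lin_basis[OF L] .
  have Ns: "subspace N" and Ninv: "\<And>x y. y \<in> N \<Longrightarrow> br x y \<in> N"
    using N by (auto simp: lie_nilradical_def lie_ideal_def)
  note bl = lie_bilinear[OF L]
  note lin = lie_ad_linear(1)[OF L]
  have der: "br x y \<in> N" for x y by (rule derived_in_abelian_nilradical[OF L sol N ab])
  have ab0: "br x y = 0" if "x \<in> N" "y \<in> N" for x y using ab that by (simp add: lie_abelian_on_def)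
  have comm: "br x (br y v) = br y (br x v)" if "v \<in> N" for x y v
    using lie_jacobi[OF L, of x y v] ab0[OF der that, of x y] by simp
  have key: "\<exists>Q E. on_frame Q N E \<and> (\<forall>x\<in>N. x \<noteq> 0 \<longrightarrow> 0 < ricci_form \<sigma> (br Y) Q E x x) \<and>
     (\<forall>z. (\<forall>x\<in>N. Q (br z x) x = 0) \<longrightarrow> (\<exists>k. \<forall>x\<in>N. (br z ^^ k) x = 0))" if "0 < \<sigma>" for \<sigma>
    by (rule adapted_inner_product[OF B Ns that lin Ninv comm Y])
  have tr_frame: "lin_trace (br x) = (\<Sum>e\<in>E. Q (br x e) e)" if "on_frame Q N E" for Q E x
    by (rule lin_trace_into[OF B that lin der])
  define \<tau> where "\<tau> = lin_trace (br Y)"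
  \<comment> \<open>summed over a frame, the last two terms of the Ricci form cancel and twice the trace remains\<close>
  have \<tau>: "0 < \<tau>"
  proof -
    obtain Q E where E: "on_frame Q N E" and pos: "\<And>x. x \<in> N \<Longrightarrow> x \<noteq> 0 \<Longrightarrow> 0 < ricci_form 1 (br Y) Q E x x"
      using key[OF zero_less_one] by blast
    note bq = on_frame_bilinear[OF E]
    have "E \<noteq> {}" using on_frame_span[OF E] nz by auto
    moreover have "e \<noteq> 0" if "e \<in> E" for e
      using on_frame_orth[OF E that that] by (auto simp: bilinear_simps[OF bq])
    ultimately have "0 < (\<Sum>e\<in>E. ricci_form 1 (br Y) Q E e e)"
      using pos on_frame_mem[OF E] on_frame_finite[OF E] by (intro sum_pos) auto
    also have "\<dots> = 2 * (\<Sum>e\<in>E. Q (br Y e) e) + (\<Sum>e\<in>E. Q (br Y e) (br Y e))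
       - (\<Sum>e\<in>E. \<Sum>f\<in>E. (Q (br Y f) e)\<^sup>2)"
      by (simp add: ricci_form_def sum.distrib sum_subtractf sum_distrib_left power2_eq_square)
    also have "(\<Sum>e\<in>E. \<Sum>f\<in>E. (Q (br Y f) e)\<^sup>2) = (\<Sum>e\<in>E. Q (br Y e) (br Y e))"
      by (subst sum.swap) (simp add: on_frame_norm[OF E der] on_frame_sym[OF E, of "br Y _"])
    finally show ?thesis by (simp add: \<tau>_def tr_frame[OF E])
  qed
  obtain Q E where E: "on_frame Q N E" and posQ: "\<And>x. x \<in> N \<Longrightarrow> x \<noteq> 0 \<Longrightarrow> 0 < ricci_form \<tau> (br Y) Q E x x"
    and skewQ: "\<And>z. (\<forall>x\<in>N. Q (br z x) x = 0) \<Longrightarrow> \<exists>k. \<forall>x\<in>N. (br z ^^ k) x = 0"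
    using key[OF \<tau>] by blast
  note bq = on_frame_bilinear[OF E]
  note finE = on_frame_finite[OF E]
  define tr where "tr z = lin_trace (br z)" for z
  have tr: "tr z = (\<Sum>e\<in>E. Q (br z e) e)" for z unfolding tr_def by (rule tr_frame[OF E])
  have lintr: "linear tr"
    by (simp add: linear_iff tr bilinear_simps[OF bl] bilinear_simps[OF bq] sum.distrib sum_distrib_left)
  have trN: "tr z = 0" if "z \<in> N" for z
    using ab0[OF that on_frame_mem[OF E]] by (simp add: tr bilinear_simps[OF bq])
  define K where "K = {z. tr z = 0}"
  have K: "subspace K"
    by (simp add: K_def subspace_def linear_0[OF lintr] linear_add[OF lintr] linear_cmul[OF lintr])
  have EK: "E \<subseteq> K" using trN on_frame_mem[OF E] by (auto simp: K_def)
  obtain F where F: "F \<inter> E = {}" "F \<subseteq> K" "finite F" "independent (E \<union> F)" "span (E \<union> F) = K" "finite E"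
    using extend_to_lin_basis[OF B on_frame_independent[OF E] K EK] .
  have YK: "Y \<notin> K" using \<tau> by (simp add: K_def tr_def \<tau>_def)
  \<comment> \<open>\<open>F\<close> lies in the kernel of the trace, so the mean curvature vector will be a multiple of \<open>Y\<close>\<close>
  define G where "G = E \<union> insert Y F"
  have EF: "E \<inter> insert Y F = {}" "Y \<notin> F" using F EK YK by auto
  have G_eq: "G = insert Y (E \<union> F)" by (auto simp: G_def)
  have G: "lin_basis G"
    unfolding lin_basis_def
  proof (intro conjI)
    show "finite G" using F by (simp add: G_def)
    show "independent G" unfolding G_eq using F YK by (intro real_vector.independent_insertI) auto
    have "x \<in> span G" for x
    proof -
      have "x - (tr x / \<tau>) *\<^sub>R Y \<in> K"
        using \<tau> by (simp add: K_def linear_diff[OF lintr] linear_cmul[OF lintr]) (simp add: tr_def \<tau>_def)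
      then have "x - (tr x / \<tau>) *\<^sub>R Y \<in> span G"
        using F(5) span_mono[of "E \<union> F" G] G_eq by blast
      moreover have "(tr x / \<tau>) *\<^sub>R Y \<in> span G" by (intro span_scale span_base) (simp add: G_def)
      ultimately have "(x - (tr x / \<tau>) *\<^sub>R Y) + (tr x / \<tau>) *\<^sub>R Y \<in> span G" by (rule span_add)
      then show ?thesis by simp
    qed
    then show "span G = UNIV" by blast
  qed
  then have ind: "independent G" and spG: "span G = UNIV" and finG: "finite G" by (auto simp: lin_basis_def)
  define \<phi> where "\<phi> b x = representation G x b" for b x
  have \<phi>lin: "linear (\<phi> b)" for b
    using ind spG by (simp add: linear_iff \<phi>_def real_vector.representation_add real_vector.representation_scale)
  have \<phi>N: "\<phi> b x = (if b \<in> E then Q b x else 0)" if "x \<in> N" for b x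
  proof -
    have "representation G x = representation E x"
      using ind that on_frame_span[OF E] by (intro real_vector.representation_extend) (auto simp: G_def)
    then show ?thesis
      using on_frame_representation[OF E that] real_vector.representation_ne_zero[of E x b]
      by (auto simp: \<phi>_def)
  qed
  define \<pi> where "\<pi> x = (\<Sum>e\<in>E. \<phi> e x *\<^sub>R e)" for x
  have \<pi>N: "\<pi> x \<in> N" for x
    unfolding \<pi>_def by (intro subspace_sum[OF Ns] subspace_scale[OF Ns] on_frame_mem[OF E])
  have Q\<phi>: "(\<Sum>e\<in>E. Q e n * \<phi> e x) = Q n (\<pi> x)" for n x
    by (simp add: \<pi>_def bilinear_sum_right[OF bq] bilinear_rmul[OF bq] on_frame_sym[OF E, of n] mult.commute)
  have \<phi>\<pi>: "\<phi> e (\<pi> x) = \<phi> e x" if "e \<in> E" for e x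
  proof -
    have "\<phi> e (\<pi> x) = (\<Sum>f\<in>E. \<phi> f x * Q e f)"
      using that by (simp add: \<phi>N[OF \<pi>N]) (simp add: \<pi>_def bilinear_sum_right[OF bq] bilinear_rmul[OF bq])
    also have "\<dots> = (\<Sum>f\<in>E. if f = e then \<phi> f x else 0)"
      using that by (intro sum.cong) (auto simp: on_frame_orth[OF E])
    finally show ?thesis using that finE by simp
  qed
  define C where "C = {x. \<forall>e\<in>E. \<phi> e x = 0}"
  have C: "subspace C" using \<phi>lin by (auto simp: C_def subspace_def linear_0 linear_add linear_cmul)
  have xC: "x - \<pi> x \<in> C" for x by (simp add: C_def linear_diff[OF \<phi>lin] \<phi>\<pi>)
  have CN: "x = 0" if "x \<in> C" "x \<in> N" for x
    using on_frame_expand[OF E that(2)] that \<phi>N[OF that(2)] by (simp add: C_def cong: sum.cong)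
  let ?f = "ricci_form \<tau> (br Y) Q E"
  \<comment> \<open>\<open>- h1 / s\<close> is the contribution of \<open>F\<close> to the doubled and negated Ricci form on \<open>N\<close>\<close>
  define h1 where "h1 u u' = (\<Sum>f\<in>F. \<Sum>e\<in>E. Q (br f e) u * Q (br f e) u') - (\<Sum>f\<in>F. Q (br f u) (br f u'))" for u u'
  have h1: "bilinear h1"
    by (simp add: bilinear_def linear_iff h1_def bilinear_simps[OF bl] bilinear_simps[OF bq]
        algebra_simps sum.distrib sum_distrib_left)
  have h1sym: "h1 u u' = h1 u' u" for u u'
    by (simp add: h1_def on_frame_sym[OF E, of "br _ u"] mult.commute)
  have sbf: "symmetric_bilinear ?f"
    using E lin by (intro symmetric_bilinear_ricci_form) (auto simp: on_frame_def)
  have sb0: "symmetric_bilinear (\<lambda>_ _::'a. 0)" and bl0: "bilinear (\<lambda>_ _::'a. 0::real)"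
    by (auto simp: symmetric_bilinear_def bilinear_def linear_zero)
  have "\<exists>s>0. \<forall>w\<in>N. \<forall>c\<in>{0::'a}. w \<noteq> 0 \<or> c \<noteq> 0 \<longrightarrow> ?f w w + s * 0 + 0 - h1 w w / s > 0"
    by (rule perturbed_form_positive[OF B Ns subspace_single_0 sbf posQ sb0 _ bl0 h1]) simp_all
  then obtain s where s: "0 < s" and spos: "\<And>w. w \<in> N \<Longrightarrow> w \<noteq> 0 \<Longrightarrow> 0 < ?f w w - h1 w w / s" by auto
  define fs where "fs u u' = ?f u u' - h1 u u' / s" for u u'
  have sbfs: "symmetric_bilinear fs"
  proof -
    have bf: "bilinear ?f" and symf: "\<And>u u'. ?f u u' = ?f u' u" using sbf by (auto simp: symmetric_bilinear_def)
    have "bilinear fs"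
      by (simp add: bilinear_def linear_iff fs_def bilinear_simps[OF bf] bilinear_simps[OF h1]
          algebra_simps add_divide_distrib)
    moreover have "fs u u' = fs u' u" for u u' by (simp add: fs_def symf[of u] h1sym[of u])
    ultimately show ?thesis by (simp add: symmetric_bilinear_def)
  qed
  \<comment> \<open>the polarised squared norm of the symmetric part of the action of \<open>z\<close> on \<open>N\<close>, up to a constant\<close>
  define g where "g z z' = (\<Sum>e\<in>E. (Q (br z (br z' e)) e + Q (br z' (br z e)) e) / 2 + Q (br z e) (br z' e))" for z z'
  have gdiag: "g z z = (\<Sum>e\<in>E. Q (br z (br z e)) e + Q (br z e) (br z e))" for z by (simp add: g_def)
  have sbg: "symmetric_bilinear g"
  proof -
    have "g z z' = g z' z" for z z' by (simp add: g_def on_frame_sym[OF E, of "br z _"] add.commute)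
    moreover have "bilinear g"
      by (simp add: bilinear_def linear_iff g_def bilinear_simps[OF bl] bilinear_simps[OF bq]
          algebra_simps add_divide_distrib sum.distrib sum_distrib_left)
    ultimately show ?thesis by (simp add: symmetric_bilinear_def)
  qed
  have gpos: "0 < g z z" if "z \<in> C" "z \<noteq> 0" for z
  proof (rule ccontr)
    assume "\<not> 0 < g z z"
    moreover have "g z z = 1/2 * (\<Sum>e\<in>E. \<Sum>f\<in>E. (Q (br z e) f + Q (br z f) e)\<^sup>2)"
      unfolding gdiag by (rule symmetric_part_norm(1)[OF E lin Ninv])
    moreover have "0 \<le> (\<Sum>e\<in>E. \<Sum>f\<in>E. (Q (br z e) f + Q (br z f) e)\<^sup>2)"
      by (intro sum_nonneg) simp
    ultimately have "g z z = 0" by linarith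
    then have 0: "(\<Sum>e\<in>E. Q (br z (br z e)) e + Q (br z e) (br z e)) = 0" unfolding gdiag by simp
    have "\<forall>x\<in>N. Q (br z x) x = 0"
      by (rule ballI, rule symmetric_part_norm(2)[OF E lin Ninv 0])
    from skewQ[OF this] obtain k where k: "\<And>x. x \<in> N \<Longrightarrow> (br z ^^ k) x = 0" by blast
    have "z \<in> N" by (rule nilpotent_action_in_nilradical[OF L sol N ab k])
    then show False using CN that by blast
  qed
  \<comment> \<open>the mixed terms; \<open>h\<close> collects the brackets of pairs from \<open>Y\<close> and \<open>F\<close>\<close>
  define b where "b u z = 2 * \<tau> * Q (br Y z) u + 2 * Q (br Y u) (br Y z) + 2 / s * (\<Sum>f\<in>F. Q (br f u) (br f z))" for u z
  have b: "bilinear b"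
    by (simp add: bilinear_def linear_iff b_def bilinear_simps[OF bl] bilinear_simps[OF bq]
        algebra_simps add_divide_distrib sum.distrib sum_distrib_left)
  define h where "h u u' = 1 / s * (\<Sum>f\<in>F. Q (br Y f) u * Q (br Y f) u')
    + 1 / (2 * s\<^sup>2) * (\<Sum>f\<in>F. \<Sum>f'\<in>F. Q (br f f') u * Q (br f f') u')" for u u'
  have h: "bilinear h"
    by (simp add: bilinear_def linear_iff h_def bilinear_simps[OF bq]
        algebra_simps add_divide_distrib sum.distrib sum_distrib_left)
  have "\<exists>t>0. \<forall>w\<in>N. \<forall>c\<in>C. w \<noteq> 0 \<or> c \<noteq> 0 \<longrightarrow> fs w w + t * g c c + b w c - h w w / t > 0"
    by (rule perturbed_form_positive[OF B Ns C sbfs _ sbg gpos b h]) (use spos in \<open>simp_all add: fs_def\<close>)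
  then obtain t where t: "0 < t"
    and tpos: "\<forall>w\<in>N. \<forall>c\<in>C. w \<noteq> 0 \<or> c \<noteq> 0 \<longrightarrow> fs w w + t * g c c + b w c - h w w / t > 0"
    by (elim exE conjE)
  define r where "r = 1 / t"
  have r: "0 < r" "r * t = 1" using t by (simp_all add: r_def)
  define wt where "wt b = (if b \<in> E then r else if b = Y then 1 else s)" for b
  have wt: "0 < wt b" for b using r s by (simp add: wt_def)
  define ip where "ip x y = (\<Sum>b\<in>G. wt b * representation G x b * representation G y b)" for x y
  note wip = weighted_inner_product[OF bl G wt ip_def]
  have YE: "Y \<notin> E" using EF(1) by auto
  have FE: "f \<notin> E" if "f \<in> F" for f using F(1) that by auto
  have wtE: "wt e = r" if "e \<in> E" for e using that by (simp add: wt_def)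
  have wtY: "wt Y = 1" using EF by (auto simp: wt_def)
  have wtF: "wt f = s" if "f \<in> F" for f using EF that by (auto simp: wt_def)
  have sumG: "(\<Sum>b\<in>G. k b) = (\<Sum>e\<in>E. k e) + (k Y + (\<Sum>f\<in>F. k f))" for k :: "'a \<Rightarrow> real"
    unfolding G_def using EF F by (subst sum.union_disjoint) auto
  have ipN: "ip n x = r * Q n (\<pi> x)" if "n \<in> N" for n x
  proof -
    have "ip n x = (\<Sum>e\<in>E. r * (Q e n * \<phi> e x))"
      unfolding ip_def \<phi>_def[symmetric] sumG \<phi>N[OF that]
      by (simp add: wtE YE FE mult.assoc cong: sum.cong)
    then show ?thesis by (simp add: sum_distrib_left[symmetric] Q\<phi>)
  qed
  have ipNN: "ip n n' = r * Q n n'" if "n \<in> N" "n' \<in> N" for n n'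
  proof -
    have "\<pi> n' = n'" using on_frame_expand[OF E that(2)] by (simp add: \<pi>_def \<phi>N[OF that(2)] cong: sum.cong)
    then show ?thesis by (simp add: ipN[OF that(1)])
  qed
  have ipbr: "ip (br x y) v = r * Q (br x y) (\<pi> v)" for x y v by (rule ipN[OF der])
  have ipbb: "ip (br x y) (br v w) = r * Q (br x y) (br v w)" for x y v w by (rule ipNN[OF der der])
  have Hvec: "(\<Sum>b\<in>G. (lin_trace (br b) / wt b) *\<^sub>R b) = \<tau> *\<^sub>R Y"
  proof -
    have "(\<Sum>b\<in>G. (lin_trace (br b) / wt b) *\<^sub>R b) = (\<Sum>b\<in>G. if b = Y then \<tau> *\<^sub>R Y else 0)"
    proof (rule sum.cong[OF refl])
      fix b assume "b \<in> G"
      then have "b \<noteq> Y \<Longrightarrow> tr b = 0" using EK F(2) by (auto simp: G_def K_def)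
      then show "(lin_trace (br b) / wt b) *\<^sub>R b = (if b = Y then \<tau> *\<^sub>R Y else 0)"
        using wtY by (auto simp: tr_def \<tau>_def)
    qed
    then show ?thesis using finG by (simp add: G_def)
  qed
  have "ricci br ip X < 0" if X: "X \<noteq> 0" for X
  proof -
    define U where "U = \<pi> X"
    define Z where "Z = X - U"
    have UN: "U \<in> N" and ZC: "Z \<in> C" and XUZ: "X = U + Z" using \<pi>N xC by (auto simp: U_def Z_def)
    have brX: "br X y = br Z y" if "y \<in> N" for y
      using ab0[OF UN that] by (simp add: XUZ bilinear_simps[OF bl])
    have antisym: "Q (br x y) v * Q (br x y) v = Q (br y x) v * Q (br y x) v" for x y v
      using lie_antisym[OF L, of x y] by (simp add: bilinear_simps[OF bq])
    have antisym2: "Q (br X y) (br X y) = Q (br y X) (br y X)" for y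
      using lie_antisym[OF L, of X y] by (simp add: bilinear_simps[OF bq])
    have Kill: "killing_form br X X = (\<Sum>e\<in>E. Q (br Z (br Z e)) e)"
    proof -
      have "killing_form br X X = (\<Sum>e\<in>E. Q ((br X \<circ> br X) e) e)"
        unfolding killing_form_def
        by (rule lin_trace_into[OF B E linear_compose[OF lin lin]]) (simp add: der)
      also have "\<dots> = (\<Sum>e\<in>E. Q (br Z (br Z e)) e)"
        by (intro sum.cong refl) (simp add: brX on_frame_mem[OF E] der)
      finally show ?thesis .
    qed
    have T3: "(\<Sum>b\<in>G. ip (br X b) (br X b) / wt b) = (\<Sum>e\<in>E. Q (br Z e) (br Z e))
       + (r * Q (br Y X) (br Y X) + r / s * (\<Sum>f\<in>F. Q (br f X) (br f X)))"
      unfolding sumG ipbb antisym2[symmetric]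
      using r by (simp add: wtE wtY wtF brX[OF on_frame_mem[OF E]] sum_distrib_left cong: sum.cong)
    have split2: "(\<Sum>b\<in>G. \<Sum>c\<in>G. (ip (br b c) X)\<^sup>2 / (wt b * wt c))
      = 2 * r * (\<Sum>e\<in>E. Q (br Y e) U * Q (br Y e) U)
        + 2 * r / s * (\<Sum>f\<in>F. \<Sum>e\<in>E. Q (br f e) U * Q (br f e) U)
        + 2 * r\<^sup>2 / s * (\<Sum>f\<in>F. Q (br Y f) U * Q (br Y f) U)
        + r\<^sup>2 / s\<^sup>2 * (\<Sum>f\<in>F. \<Sum>f'\<in>F. Q (br f f') U * Q (br f f') U)"
    proof -
      define k where "k b c = (ip (br b c) X)\<^sup>2 / (wt b * wt c)" for b c
      have k: "k b c = r\<^sup>2 * (Q (br b c) U * Q (br b c) U) / (wt b * wt c)" for b c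
        by (simp add: k_def ipbr U_def power_mult_distrib power2_eq_square)
      have ksym: "k b c = k c b" for b c unfolding k using antisym[of b c U] by (simp add: mult.commute)
      have kEE: "k e e' = 0" if "e \<in> E" "e' \<in> E" for e e'
        using that on_frame_mem[OF E] by (simp add: k ab0 bilinear_simps[OF bq])
      have kYY: "k Y Y = 0" using L by (simp add: k finite_dim_lie_algebra_def bilinear_simps[OF bq])
      have EFsw: "(\<Sum>e\<in>E. \<Sum>f\<in>F. k e f) = (\<Sum>f\<in>F. \<Sum>e\<in>E. k f e)"
        by (subst sum.swap) (simp add: ksym)
      have EY: "(\<Sum>e\<in>E. k e Y) = (\<Sum>e\<in>E. k Y e)" "(\<Sum>f\<in>F. k f Y) = (\<Sum>f\<in>F. k Y f)"
        by (simp_all add: ksym[of _ Y])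
      have "(\<Sum>b\<in>G. \<Sum>c\<in>G. k b c) = 2 * (\<Sum>e\<in>E. k Y e) + 2 * (\<Sum>f\<in>F. \<Sum>e\<in>E. k f e)
         + 2 * (\<Sum>f\<in>F. k Y f) + (\<Sum>f\<in>F. \<Sum>f'\<in>F. k f f')"
        unfolding sumG by (simp add: sum.distrib kEE kYY EFsw EY)
      also have "(\<Sum>e\<in>E. k Y e) = r * (\<Sum>e\<in>E. Q (br Y e) U * Q (br Y e) U)"
        using r by (simp add: k wtE wtY sum_distrib_left power2_eq_square cong: sum.cong)
      also have "(\<Sum>f\<in>F. \<Sum>e\<in>E. k f e) = r / s * (\<Sum>f\<in>F. \<Sum>e\<in>E. Q (br f e) U * Q (br f e) U)"
        using r by (simp add: k wtE wtF sum_distrib_left power2_eq_square cong: sum.cong)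
      also have "(\<Sum>f\<in>F. k Y f) = r\<^sup>2 / s * (\<Sum>f\<in>F. Q (br Y f) U * Q (br Y f) U)"
        by (simp add: k wtY wtF sum_distrib_left cong: sum.cong)
      also have "(\<Sum>f\<in>F. \<Sum>f'\<in>F. k f f') = r\<^sup>2 / s\<^sup>2 * (\<Sum>f\<in>F. \<Sum>f'\<in>F. Q (br f f') U * Q (br f f') U)"
        by (simp add: k wtF sum_distrib_left power2_eq_square cong: sum.cong)
      finally show ?thesis by (simp add: k_def mult.assoc)
    qed
    have QX: "Q (br y X) (br y X) = Q (br y U) (br y U) + 2 * Q (br y U) (br y Z) + Q (br y Z) (br y Z)" for y
      by (simp add: XUZ bilinear_simps[OF bl] bilinear_simps[OF bq] on_frame_sym[OF E, of "br y Z" "br y U"])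
    have T1: "ip (br (\<tau> *\<^sub>R Y) X) X = \<tau> * r * (Q (br Y U) U + Q (br Y Z) U)"
      by (simp add: bilinear_simps[OF bl] ipN[OF subspace_scale[OF Ns der]] U_def[symmetric] bilinear_simps[OF bq])
        (simp add: XUZ bilinear_simps[OF bl] bilinear_simps[OF bq] algebra_simps)
    define A1 where "A1 = (\<Sum>e\<in>E. Q (br Y e) U * Q (br Y e) U)"
    define A2 where "A2 = (\<Sum>f\<in>F. \<Sum>e\<in>E. Q (br f e) U * Q (br f e) U)"
    define A3 where "A3 = (\<Sum>f\<in>F. Q (br Y f) U * Q (br Y f) U)"
    define A4 where "A4 = (\<Sum>f\<in>F. \<Sum>f'\<in>F. Q (br f f') U * Q (br f f') U)"
    define A5 where "A5 = (\<Sum>f\<in>F. Q (br f U) (br f U))"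
    define A6 where "A6 = (\<Sum>f\<in>F. Q (br f U) (br f Z))"
    define A7 where "A7 = (\<Sum>f\<in>F. Q (br f Z) (br f Z))"
    have sF: "(\<Sum>f\<in>F. Q (br f X) (br f X)) = A5 + 2 * A6 + A7"
      unfolding QX A5_def A6_def A7_def by (simp add: sum.distrib sum_distrib_left)
    have ric: "ricci br ip X = - (\<tau> * r * (Q (br Y U) U + Q (br Y Z) U))
      - 1/2 * (\<Sum>e\<in>E. Q (br Z (br Z e)) e)
      - 1/2 * ((\<Sum>e\<in>E. Q (br Z e) (br Z e))
         + (r * (Q (br Y U) (br Y U) + 2 * Q (br Y U) (br Y Z) + Q (br Y Z) (br Y Z)) + r / s * (A5 + 2 * A6 + A7)))
      + 1/4 * (2 * r * A1 + 2 * r / s * A2 + 2 * r\<^sup>2 / s * A3 + r\<^sup>2 / s\<^sup>2 * A4)"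
      unfolding wip(2) Hvec T1 Kill T3 split2 QX[of Y] sF A1_def A2_def A3_def A4_def ..
    have e1: "fs U U = 2 * \<tau> * Q (br Y U) U + Q (br Y U) (br Y U) - A1 - (A2 - A5) / s"
      by (simp add: fs_def ricci_form_def h1_def A1_def A2_def A5_def)
    have e2: "g Z Z = (\<Sum>e\<in>E. Q (br Z (br Z e)) e) + (\<Sum>e\<in>E. Q (br Z e) (br Z e))"
      by (simp add: gdiag sum.distrib)
    have e3: "b U Z = 2 * \<tau> * Q (br Y Z) U + 2 * Q (br Y U) (br Y Z) + 2 / s * A6"
      by (simp add: b_def A6_def)
    have e4: "h U U = 1 / s * A3 + 1 / (2 * s\<^sup>2) * A4"
      by (simp add: h_def A3_def A4_def)
    have "- 2 * ricci br ip X = r * fs U U + g Z Z + r * b U Z - r\<^sup>2 * h U U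
      + (r * Q (br Y Z) (br Y Z) + r / s * A7)"
      unfolding ric e1 e2 e3 e4 by (simp add: algebra_simps add_divide_distrib diff_divide_distrib)
    also have "r * fs U U + g Z Z + r * b U Z - r\<^sup>2 * h U U = r * (fs U U + t * g Z Z + b U Z - h U U / t)"
      using t by (simp add: r_def field_simps power2_eq_square)
    finally have *: "- 2 * ricci br ip X = r * (fs U U + t * g Z Z + b U Z - h U U / t)
      + (r * Q (br Y Z) (br Y Z) + r / s * A7)" .
    have "0 < fs U U + t * g Z Z + b U Z - h U U / t"
      by (rule tpos[rule_format, OF UN ZC]) (use X XUZ in auto)
    then have "0 < r * (fs U U + t * g Z Z + b U Z - h U U / t)" using r by simp
    moreover have "0 \<le> A7" unfolding A7_def by (intro sum_nonneg on_frame_nonneg[OF E der])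
    moreover have "0 \<le> Q (br Y Z) (br Y Z)" by (rule on_frame_nonneg[OF E der])
    ultimately have "0 < - 2 * ricci br ip X"
      unfolding * using r s by (intro add_pos_nonneg add_nonneg_nonneg mult_nonneg_nonneg) auto
    then show ?thesis by simp
  qed
  then show ?thesis using wip(1) by (auto simp: negative_ricci_def)
qed

section \<open>Characterisation of negative Ricci curvature\<close>

theorem mainTheorem2:
  fixes br :: "'a::real_vector \<Rightarrow> 'a \<Rightarrow> 'a" and N :: "'a set"
  assumes "finite_dim_lie_algebra br"
    and "lie_solvable br"
    and "lie_nilradical br N"
    and "lie_abelian_on br N"
  shows "(\<exists>ip :: 'a \<Rightarrow> 'a \<Rightarrow> real. is_inner_product ip \<and> negative_ricci br ip) \<longleftrightarrow>
         (\<exists>Y. \<forall>c. complex_eigenvalue_on N (br Y) c \<longrightarrow> Re c > 0)"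
proof
  assume "\<exists>ip :: 'a \<Rightarrow> 'a \<Rightarrow> real. is_inner_product ip \<and> negative_ricci br ip"
  then show "\<exists>Y. \<forall>c. complex_eigenvalue_on N (br Y) c \<longrightarrow> Re c > 0"
    using negative_ricci_imp_positive_eigenvalues[OF assms] by blast
next
  assume "\<exists>Y. \<forall>c. complex_eigenvalue_on N (br Y) c \<longrightarrow> Re c > 0"
  then obtain Y where Y: "\<And>c. complex_eigenvalue_on N (br Y) c \<Longrightarrow> Re c > 0" by blast
  show "\<exists>ip :: 'a \<Rightarrow> 'a \<Rightarrow> real. is_inner_product ip \<and> negative_ricci br ip"
    \<comment> \<open>then the whole algebra is zero, and the condition on the eigenvalues holds vacuously\<close>
  proof (cases "N = {0}")
    case True
    have "z = 0" for z :: 'a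
      using nilpotent_action_in_nilradical[OF assms, of 0 z] True by simp
    then have "is_inner_product (\<lambda>_ _ :: 'a. 0)" "negative_ricci br (\<lambda>_ _. 0)"
      by (auto simp: is_inner_product_def negative_ricci_def bilinear_def linear_zero)
    then show ?thesis by blast
  next
    case False
    then show ?thesis using positive_eigenvalues_imp_negative_ricci[OF assms _ Y] by blast
  qed
qed

end
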